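(* For every sequence $(G_i)_{i=1}^\infty$ of locally compact second countable groups, there is a finitely generated group which does not coarsely embed into $G_i$ for any $i\geq 1$. In particular, no locally compact second countable group coarsely contains every finitely generated group.
   Context: Every locally compact second countable group $G$ admits a proper left-invariant compatible metric (proper: bounded sets are relatively compact; compatible: it induces the topology of $G$), and any two such metrics on $G$ are coarsely equivalent; each such group is regarded as a coarse space using any one of these metrics. Finitely generated groups are equipped with word metrics associated to finite generating sets. A map $f:X\to Y$ between metric spaces is a coarse embedding if there are nondecreasing functions $\rho_-,\rho_+:[0,\infty)\to[0,\infty)$ with $\rho_-(t)\to\infty$ as $t\to\infty$ and $\rho_-(d_X(x,x'))\leq d_Y(f(x),f(x'))\leq\rho_+(d_X(x,x'))$ for all $x,x'\in X$. If such an $f$ exists, $X$ coarsely embeds into $Y$ and $Y$ coarsely contains $X$. *)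

theory Defs
  imports "HOL-Analysis.Analysis" "HOL-Algebra.Generated_Groups"
begin

locale topological_group = group G for G (structure) +
  fixes T :: "'a topology"
  assumes topspace_eq: "topspace T = carrier G"
    and continuous_mult: "continuous_map (prod_topology T T) T (\<lambda>(x, y). x \<otimes> y)"
    and continuous_inv: "continuous_map T T (\<lambda>x. inv x)"

text \<open>Locally compact groups are Hausdorff by convention; here this is also forced by the existence
  of a compatible metric.\<close>

locale lcsc_group = topological_group +
  assumes Hausdorff: "Hausdorff_space T"
    and locally_compact: "locally_compact_space T"
    and second_countable: "second_countable T"

text \<open>In the next definition the second conjunct is compatibility with the topology, the third is
  left-invariance and the fourth is properness.\<close>

definition proper_left_invariant_compatible_metric ::
    "('a, 'b) monoid_scheme \<Rightarrow> 'a topology \<Rightarrow> ('a \<Rightarrow> 'a \<Rightarrow> real) \<Rightarrow> bool" where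
  "proper_left_invariant_compatible_metric G T d \<longleftrightarrow>
     Metric_space (carrier G) d \<and>
     Metric_space.mtopology (carrier G) d = T \<and>
     (\<forall>g\<in>carrier G. \<forall>x\<in>carrier G. \<forall>y\<in>carrier G. d (g \<otimes>\<^bsub>G\<^esub> x) (g \<otimes>\<^bsub>G\<^esub> y) = d x y) \<and>
     (\<forall>B. Metric_space.mbounded (carrier G) d B \<longrightarrow> compactin T (T closure_of B))"

definition finite_generating_set :: "('a, 'b) monoid_scheme \<Rightarrow> 'a set \<Rightarrow> bool" where
  "finite_generating_set H S \<longleftrightarrow> finite S \<and> S \<subseteq> carrier H \<and> generate H S = carrier H"

definition finitely_generated_group :: "('a, 'b) monoid_scheme \<Rightarrow> bool" where
  "finitely_generated_group H \<longleftrightarrow> group H \<and> (\<exists>S. finite_generating_set H S)"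

definition word_length :: "('a, 'b) monoid_scheme \<Rightarrow> 'a set \<Rightarrow> 'a \<Rightarrow> nat" where
  "word_length H S g =
     (LEAST n. \<exists>ws. set ws \<subseteq> S \<union> (\<lambda>s. inv\<^bsub>H\<^esub> s) ` S \<and> foldr (\<otimes>\<^bsub>H\<^esub>) ws \<one>\<^bsub>H\<^esub> = g \<and> length ws = n)"

text \<open>The least element in \<^const>\<open>word_length\<close> exists for every element of the subgroup generated
  by \<open>S\<close>.\<close>

lemma generate_imp_word:
  assumes "group H" "S \<subseteq> carrier H" "g \<in> generate H S"
  shows "\<exists>ws. set ws \<subseteq> S \<union> (\<lambda>s. inv\<^bsub>H\<^esub> s) ` S \<and> foldr (\<otimes>\<^bsub>H\<^esub>) ws \<one>\<^bsub>H\<^esub> = g"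
proof -
  interpret group H by fact
  let ?A = "S \<union> (\<lambda>s. inv\<^bsub>H\<^esub> s) ` S"
  have A: "?A \<subseteq> carrier H" using assms(2) by auto
  have closed: "foldr (\<otimes>\<^bsub>H\<^esub>) ws \<one>\<^bsub>H\<^esub> \<in> carrier H" if "set ws \<subseteq> ?A" for ws
    using that A by (induction ws) auto
  have app: "foldr (\<otimes>\<^bsub>H\<^esub>) (us @ vs) \<one>\<^bsub>H\<^esub> = foldr (\<otimes>\<^bsub>H\<^esub>) us \<one>\<^bsub>H\<^esub> \<otimes>\<^bsub>H\<^esub> foldr (\<otimes>\<^bsub>H\<^esub>) vs \<one>\<^bsub>H\<^esub>"
    if "set us \<subseteq> ?A" "set vs \<subseteq> ?A" for us vs
    using that(1)
  proof (induction us)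
    case Nil
    then show ?case using closed[OF that(2)] by simp
  next
    case (Cons a us)
    have "a \<in> carrier H" using A Cons.prems by auto
    moreover have "set us \<subseteq> ?A" using Cons.prems by simp
    ultimately show ?case
      using Cons.IH closed[of us] closed[OF that(2)] by (simp add: m_assoc)
  qed
  from assms(3) show ?thesis
  proof induction
    case one
    show ?case by (rule exI[of _ "[]"]) simp
  next
    case (incl h)
    then show ?case using assms(2) by (intro exI[of _ "[h]"]) auto
  next
    case (inv h)
    then show ?case using assms(2) by (intro exI[of _ "[inv\<^bsub>H\<^esub> h]"]) auto
  next
    case (eng h1 h2)
    then obtain us vs where
      "set us \<subseteq> ?A" "foldr (\<otimes>\<^bsub>H\<^esub>) us \<one>\<^bsub>H\<^esub> = h1" "set vs \<subseteq> ?A" "foldr (\<otimes>\<^bsub>H\<^esub>) vs \<one>\<^bsub>H\<^esub> = h2"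
      by blast
    then show ?case using app[of us vs] by (intro exI[of _ "us @ vs"]) auto
  qed
qed

definition word_metric :: "('a, 'b) monoid_scheme \<Rightarrow> 'a set \<Rightarrow> 'a \<Rightarrow> 'a \<Rightarrow> real" where
  "word_metric H S x y = real (word_length H S (inv\<^bsub>H\<^esub> x \<otimes>\<^bsub>H\<^esub> y))"

definition coarse_embedding ::
    "'a set \<Rightarrow> ('a \<Rightarrow> 'a \<Rightarrow> real) \<Rightarrow> 'b set \<Rightarrow> ('b \<Rightarrow> 'b \<Rightarrow> real) \<Rightarrow> ('a \<Rightarrow> 'b) \<Rightarrow> bool" where
  "coarse_embedding X dX Y dY f \<longleftrightarrow>
     f \<in> X \<rightarrow> Y \<and>
     (\<exists>\<rho>\<^sub>m \<rho>\<^sub>p :: real \<Rightarrow> real.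
        \<rho>\<^sub>m \<in> {0..} \<rightarrow> {0..} \<and> \<rho>\<^sub>p \<in> {0..} \<rightarrow> {0..} \<and>
        mono_on {0..} \<rho>\<^sub>m \<and> mono_on {0..} \<rho>\<^sub>p \<and>
        filterlim \<rho>\<^sub>m at_top at_top \<and>
        (\<forall>x\<in>X. \<forall>x'\<in>X. \<rho>\<^sub>m (dX x x') \<le> dY (f x) (f x') \<and> dY (f x) (f x') \<le> \<rho>\<^sub>p (dX x x')))"

text \<open>The finitely generated group \<open>H\<close> coarsely embeds into the locally compact second countable
  group \<open>(G, T)\<close>. Any two word metrics on \<open>H\<close>, and any two proper left-invariant compatible metrics
  on \<open>G\<close>, are coarsely equivalent, and such metrics always exist, so the choice of \<open>S\<close> and \<open>d\<close> is
  immaterial. With the existential reading, the negation says that there is no coarse embedding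
  for any choice of metrics.\<close>

definition coarsely_embeds_into ::
    "('a, 'c) monoid_scheme \<Rightarrow> ('b, 'd) monoid_scheme \<Rightarrow> 'b topology \<Rightarrow> bool" where
  "coarsely_embeds_into H G T \<longleftrightarrow>
     (\<exists>S d f. finite_generating_set H S \<and>
        proper_left_invariant_compatible_metric G T d \<and>
        coarse_embedding (carrier H) (word_metric H S) (carrier G) d f)"

end

(*
The proof is a counting argument. Up to a bounded error, a Lipschitz map from a path with N vertices
into a proper metric group G is a word of length N over a finite alphabet, namely a cover of a ball by
unit balls; so there are at most B^N such maps, with B independent of N. On the other hand a path
with N vertices can be folded to a graph of large girth in superexponentially many ways. Identifying
vertices greedily, one finds a folding with which no map of bounded multiplicity is compatible: for
each of the B^N candidates two identified vertices have distant images.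

A colouring of the edges by a number of colours that does not depend on N turns the folded path into
a small cancellation labelling. Every colour acts as an involution on the quotient of the free product
of copies of Z/2 by the labels of closed paths. Two paths from a common vertex then act equally if and
only if their ends agree, so a Lipschitz map of bounded multiplicity on the group generated by these
involutions would restrict to a compatible map on the folded path. That no further identifications
occur follows from the windmill argument for rotation families, carried out in the Cayley tree of the
free product.

There are countably many triples (i, L, M) of an index of a group, a Lipschitz constant and a
multiplicity. The involutions that belong to all of them are encoded by one finitely generated group
of permutations, in which the m-th involution has length at most 4m + 4. Its length is known before
the involution is chosen, so the construction for (i, L, M) can use the resulting Lipschitz constant.
*)

theory Submission
  imports Defs "HOL-Library.FuncSet"
begin

section \<open>Rotation families in trees\<close>

text \<open>The delicate point is the order of the choices. The colours become generators, so their
  number \<open>4 * palette\<close> must be fixed before the Lipschitz constant, which fixes the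
  finite alphabet of size B, which together with the multiplicity M fixes the length N of the path.
  A palette independent of N is possible because N is only exponential in the girth: with a
  parameter \<mu> one has N = 4 ^ (80 * \<mu> + 3), common labels may have length 6 * \<mu>, and
  there are only 4 ^ O(\<mu>) pairs of walks of that length, which a union bound over colourings
  handles with a constant number of colours. Large girth alone would not control the quotient; the
  windmill argument needs it to be at least 13 times the length of a common label. The candidates
  die because each of the N / 4 identifications has at least 4 ^ (g + 1) admissible partners, g = 80
  * \<mu>, of which a candidate respects at most M; so it suffices that 4 ^ (g + 1) exceeds M * B ^
  4. Involutions are convenient as colours because an edge then carries the same letter in both
  directions.\<close>

text \<open>A group acting simply transitively on the vertices of a tree, given by its word length:
  \<open>four_point\<close> is the four point condition of a tree metric.\<close>

locale tree_group =
  fixes len :: "'a::group_add \<Rightarrow> nat"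
  assumes len_eq_0: "len x = 0 \<longleftrightarrow> x = 0"
    and len_uminus: "len (- x) = len x"
    and four_point: "len (- u + z) + len (- x + y)
          \<le> max (len (- u + x) + len (- z + y)) (len (- u + y) + len (- z + x))"
    and interpolate: "k \<le> len x \<Longrightarrow> \<exists>y. len y = k \<and> len (- y + x) = len x - k"
begin

section \<open>Segments and convex sets in a tree\<close>

definition d :: "'a \<Rightarrow> 'a \<Rightarrow> nat" where "d x y = len (- x + y)"

definition seg :: "'a \<Rightarrow> 'a \<Rightarrow> 'a set" where "seg x y = {z. d x z + d z y = d x y}"

definition convex :: "'a set \<Rightarrow> bool" where "convex A \<longleftrightarrow> (\<forall>x\<in>A. \<forall>y\<in>A. seg x y \<subseteq> A)"

lemma d_translate [simp]: "d (g + x) (g + y) = d x y"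
proof -
  have "- (g + x) + (g + y) = - x + y" by (simp add: minus_add add.assoc del: add_uminus_conv_diff)
  then show ?thesis by (simp add: d_def)
qed

lemma d_self [simp]: "d x x = 0" by (simp add: d_def len_eq_0)

lemma d_eq_0 [simp]: "d x y = 0 \<longleftrightarrow> x = y"
proof -
  have "- x + y = 0 \<longleftrightarrow> x = y" by (metis add.right_inverse add_minus_cancel add.right_neutral left_minus)
  then show ?thesis by (simp add: d_def len_eq_0)
qed

lemma d_commute: "d x y = d y x"
proof -
  have "- x + y = - (- y + x)" by (simp add: minus_add del: add_uminus_conv_diff)
  then show ?thesis by (simp add: d_def len_uminus)
qed

lemma d_four_point: "d u z + d x y \<le> max (d u x + d z y) (d u y + d z x)"
  using four_point by (simp add: d_def)

lemma d_triangle: "d x y \<le> d x z + d z y"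
  using d_four_point[of z z x y] by (simp add: d_commute)

lemma seg_commute: "seg x y = seg y x" by (auto simp: seg_def d_commute add.commute)

lemma seg_self [simp]: "seg x x = {x}" by (auto simp: seg_def d_commute)

lemma seg_translate: "g + z \<in> seg (g + x) (g + y) \<longleftrightarrow> z \<in> seg x y" by (simp add: seg_def)

text \<open>Triangles in a tree are tripods: the larger term on the right of the four point
  condition decides which of the other two sides contains u.\<close>

lemma tripod: "seg x y \<subseteq> seg x z \<union> seg z y"
proof
  fix u assume u: "u \<in> seg x y"
  have "d u z + d x y \<le> max (d u x + d z y) (d u y + d z x)" by (rule d_four_point)
  then have "d u z + d u y \<le> d z y \<or> d u z + d u x \<le> d z x"
    using u by (auto simp: seg_def d_commute max_def split: if_splits)
  then show "u \<in> seg x z \<union> seg z y"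
    using d_triangle[of z y u] d_triangle[of x z u] by (auto simp: seg_def d_commute)
qed

lemma seg_point:
  assumes "k \<le> d x y" obtains z where "z \<in> seg x y" "d x z = k" "d z y = d x y - k"
proof -
  obtain w where w: "len w = k" "len (- w + (- x + y)) = len (- x + y) - k"
    using interpolate[of k "- x + y"] assms by (auto simp: d_def)
  have 1: "d x (x + w) = k" using w by (simp add: d_def add.assoc[symmetric])
  have "- (x + w) + y = - w + (- x + y)" by (simp add: minus_add add.assoc del: add_uminus_conv_diff)
  then have 2: "d (x + w) y = d x y - k" using w by (simp add: d_def)
  show ?thesis by (rule that[of "x + w"]) (use 1 2 assms in \<open>auto simp: seg_def\<close>)
qed

text \<open>Local geodesics in a tree are geodesics. If m were off the segment from x to y,
  \<open>tripod\<close> would put m between y and m', and the distance equations would force m = m';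
  likewise for m'.\<close>

lemma between_trans:
  assumes "m \<in> seg x m'" "m' \<in> seg m y" "m \<noteq> m'" shows "m \<in> seg x y" "m' \<in> seg x y"
proof -
  show "m \<in> seg x y"
  proof (rule ccontr)
    assume "m \<notin> seg x y"
    then have "m \<in> seg y m'" using tripod[of x m' y] assms(1) by auto
    then have "d y m + d m m' = d y m'" by (simp add: seg_def)
    moreover have "d m m' + d m' y = d m y" using assms(2) by (simp add: seg_def)
    ultimately have "d m m' = 0" by (simp add: d_commute[of y] d_commute[of m' x] d_commute[of _ m] del: d_eq_0)
    then show False using assms(3) by simp
  qed
  show "m' \<in> seg x y"
  proof (rule ccontr)
    assume "m' \<notin> seg x y"
    then have "m' \<in> seg m x" using tripod[of m y x] assms(2) by auto
    then have "d m m' + d m' x = d m x" by (simp add: seg_def)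
    moreover have "d x m + d m m' = d x m'" using assms(1) by (simp add: seg_def)
    ultimately have "d m m' = 0" by (simp add: d_commute[of y] d_commute[of m' x] d_commute[of _ m] del: d_eq_0)
    then show False using assms(3) by simp
  qed
qed

lemma convexD: "convex A \<Longrightarrow> x \<in> A \<Longrightarrow> y \<in> A \<Longrightarrow> z \<in> seg x y \<Longrightarrow> z \<in> A"
  by (auto simp: convex_def)

lemma convex_translate: "convex A \<Longrightarrow> convex ((+) g ` A)"
  unfolding convex_def
proof (clarsimp, goal_cases)
  case (1 x y z)
  have "g + (- g + z) = z" by (simp add: add.assoc[symmetric])
  then have "- g + z \<in> seg x y" using 1 seg_translate by metis
  then have "- g + z \<in> A" using 1 by blast
  then show ?case using \<open>g + (- g + z) = z\<close> by (metis imageI)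
qed

lemma convex_Un:
  assumes "convex A" "convex B" "A \<inter> B \<noteq> {}" shows "convex (A \<union> B)"
proof -
  obtain c where c: "c \<in> A" "c \<in> B" using assms by auto
  have "seg x y \<subseteq> A \<union> B" if "x \<in> A" "y \<in> B" for x y
    using tripod[of x y c] convexD[OF assms(1) \<open>x \<in> A\<close> c(1)] convexD[OF assms(2) c(2) \<open>y \<in> B\<close>] by auto
  then show ?thesis
    using assms(1,2) unfolding convex_def by (metis Un_iff le_supI1 le_supI2 seg_commute)
qed

text \<open>A convex set that misses m stays in one branch of the tree with m removed, so m
  separates w from all of C or from none of it.\<close>

lemma same_branch:
  assumes "convex C" "m \<notin> C" "y \<in> C" "y' \<in> C" "m \<in> seg w y" shows "m \<in> seg w y'"
  using tripod[of w y y'] convexD[OF assms(1,4,3)] assms by auto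

lemma seg_triangle3: "seg x y \<subseteq> seg x u \<union> seg u v \<union> seg v y"
  using tripod[of x y u] tripod[of u y v] by auto

end

section \<open>Subgroups and rotation families\<close>

inductive_set gen :: "'a::group_add set \<Rightarrow> 'a set" for S where
  zero: "0 \<in> gen S"
| step: "x \<in> gen S \<Longrightarrow> s \<in> S \<Longrightarrow> x + s \<in> gen S"

definition subgrp :: "'a::group_add set \<Rightarrow> bool" where
  "subgrp N \<longleftrightarrow> 0 \<in> N \<and> (\<forall>a\<in>N. \<forall>b\<in>N. a + b \<in> N) \<and> (\<forall>a\<in>N. - a \<in> N)"

lemma gen_add: "y \<in> gen S \<Longrightarrow> x \<in> gen S \<Longrightarrow> x + y \<in> gen S"
  by (induction y rule: gen.induct) (auto simp: add.assoc[symmetric] intro: gen.step)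

lemma gen_incl: "s \<in> S \<Longrightarrow> s \<in> gen S" using gen.step[OF gen.zero] by force

lemma subgrp_gen:
  assumes "\<And>s. s \<in> S \<Longrightarrow> - s \<in> S" shows "subgrp (gen S)"
proof -
  have "- x \<in> gen S" if "x \<in> gen S" for x
    using that by (induction rule: gen.induct) (auto simp: minus_add simp del: add_uminus_conv_diff intro: gen_add gen_incl assms gen.zero)
  then show ?thesis by (auto simp: subgrp_def intro: gen.zero gen_add)
qed

text \<open>Members are kept apart from their point sets because two members may have the same
  points; \<open>overlap\<close> limits such coincidences. The tension between
  \<open>overlap\<close> and \<open>displace\<close> is the small cancellation condition.\<close>

locale spinning_family = tree_group len for len :: "'a::group_add \<Rightarrow> nat" +
  fixes tr :: "'a \<Rightarrow> 'y \<Rightarrow> 'y" and pts :: "'y \<Rightarrow> 'a set" and F :: "'y set" and \<theta> :: nat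
  assumes tr_0: "tr 0 Y = Y" and tr_tr: "tr g (tr h Y) = tr (g + h) Y"
    and pts_tr: "pts (tr g Y) = (+) g ` pts Y"
    and tr_F: "Y \<in> F \<Longrightarrow> tr g Y \<in> F"
    and convex_pts: "Y \<in> F \<Longrightarrow> convex (pts Y)"
    and pts_ne: "Y \<in> F \<Longrightarrow> pts Y \<noteq> {}"
    and overlap: "\<lbrakk>Y \<in> F; Z \<in> F; Y \<noteq> Z; x \<in> pts Y \<inter> pts Z; y \<in> pts Y \<inter> pts Z\<rbrakk> \<Longrightarrow> d x y \<le> \<theta>"
    and displace: "\<lbrakk>Y \<in> F; tr g Y = Y; g \<noteq> 0; x \<in> pts Y\<rbrakk> \<Longrightarrow> 13 * \<theta> \<le> d x (g + x)"
    and cover: "d x y \<le> 1 \<Longrightarrow> \<exists>Y\<in>F. x \<in> pts Y \<and> y \<in> pts Y"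
    and theta: "2 \<le> \<theta>"
begin

definition Stab :: "'y \<Rightarrow> 'a set" where "Stab Y = {g. tr g Y = Y}"

lemma subgrp_Stab: "subgrp (Stab Y)"
proof -
  have "tr (- a) Y = Y" if "tr a Y = Y" for a
    using tr_tr[of "- a" a Y] that by (simp add: tr_0)
  moreover have "tr (a + b) Y = Y" if "tr a Y = Y" "tr b Y = Y" for a b
    using tr_tr[of a b Y] that by simp
  ultimately show ?thesis by (auto simp: subgrp_def Stab_def tr_0)
qed

lemma Stab_tr: "b \<in> Stab (tr h Y) \<longleftrightarrow> - h + b + h \<in> Stab Y"
proof -
  have "tr b (tr h Y) = tr h Y \<longleftrightarrow> tr (- h) (tr b (tr h Y)) = tr (- h) (tr h Y)"
    by (metis tr_tr tr_0 right_minus)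
  then show ?thesis by (simp add: Stab_def tr_tr tr_0 add.assoc)
qed

lemma Stab_pts: "b \<in> Stab Y \<Longrightarrow> x \<in> pts Y \<Longrightarrow> b + x \<in> pts Y"
  using pts_tr[of b Y] by (auto simp: Stab_def)

text \<open>This is the invariant of the windmill induction: a member is either absorbed together
  with its rotations or meets W in a bounded set. The bound 3 * \<theta> leaves room for the value
  \<theta> + \<theta> + 1 that arises when a member runs along two others in succession.\<close>

definition nice :: "'a set \<Rightarrow> 'a set \<Rightarrow> bool" where
  "nice W N \<longleftrightarrow> W \<noteq> {} \<and> convex W \<and> subgrp N \<and> (\<forall>a\<in>N. \<forall>x\<in>W. a + x \<in> W) \<and>
     (\<forall>Y\<in>F. pts Y \<subseteq> W \<and> Stab Y \<subseteq> N \<or> (\<forall>x\<in>pts Y \<inter> W. \<forall>y\<in>pts Y \<inter> W. d x y \<le> 3 * \<theta>))"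

end

section \<open>Windmills: translates of a convex set joined by rotations\<close>

locale windmill = spinning_family len tr pts F \<theta>
  for len :: "'a::group_add \<Rightarrow> nat" and tr :: "'a \<Rightarrow> 'y \<Rightarrow> 'y" and pts F \<theta> +
  fixes W N
  assumes nice: "nice W N"
begin

abbreviation T :: "'a \<Rightarrow> 'a set" where "T h \<equiv> (+) h ` W"

text \<open>Linked translates arise from each other by a rotation b about a member Z touching the
  first. The term a only changes the representative, since \<open>T h\<close> depends on the coset
  of h modulo N.\<close>

definition linked :: "('a \<times> 'a) set" where
  "linked = {(h, h'). \<exists>Z\<in>F. pts Z \<inter> T h \<noteq> {} \<and> (\<exists>b\<in>Stab Z. \<exists>a\<in>N. h' = b + h + a)}"

lemma W_convex: "convex W" and W_ne: "W \<noteq> {}" and sub_N: "subgrp N"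
  and N_W: "a \<in> N \<Longrightarrow> x \<in> W \<Longrightarrow> a + x \<in> W"
  and dich: "Y \<in> F \<Longrightarrow> pts Y \<subseteq> W \<and> Stab Y \<subseteq> N \<or> (\<forall>x\<in>pts Y \<inter> W. \<forall>y\<in>pts Y \<inter> W. d x y \<le> 3 * \<theta>)"
  using nice by (auto simp: nice_def)

lemma T_convex: "convex (T h)" by (rule convex_translate[OF W_convex])

lemma T_add: "T (g + h) = (+) g ` T h" by (auto simp: add.assoc image_image)

lemma T_N: assumes "- h + h' \<in> N" shows "T h' = T h"
proof -
  have *: "T h' \<subseteq> T h" if "- h + h' \<in> N" for h h'
  proof
    fix x assume "x \<in> T h'"
    then obtain w where w: "w \<in> W" "x = h' + w" by auto
    then have "x = h + ((- h + h') + w)" by (simp add: add.assoc[symmetric])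
    then show "x \<in> T h" using N_W[OF that w(1)] by blast
  qed
  have "- h' + h = - (- h + h')" by (simp add: minus_add del: add_uminus_conv_diff)
  then have "- h' + h \<in> N" using assms sub_N by (auto simp: subgrp_def)
  then show ?thesis using * assms by blast
qed

lemma linked_N: assumes "- h + h' \<in> N" "(h', x) \<in> linked" shows "(h, x) \<in> linked"
proof -
  obtain Z b a where Z: "Z \<in> F" "pts Z \<inter> T h' \<noteq> {}" "b \<in> Stab Z" "a \<in> N" "x = b + h' + a"
    using assms(2) unfolding linked_def by blast
  have "x = b + h + ((- h + h') + a)" using Z by (simp add: add.assoc)
  moreover have "(- h + h') + a \<in> N" using assms Z sub_N by (auto simp: subgrp_def)
  ultimately show ?thesis unfolding linked_def using Z T_N[OF assms(1)] by blast
qed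

lemma T_step:
  assumes "b \<in> Stab Z" "a \<in> N" "h' = b + h + a"
  shows "T h' = (+) b ` T h"
proof -
  have "- (b + h) + h' = a" using assms(3) by (simp add: minus_add add.assoc del: add_uminus_conv_diff)
  then have "T h' = T (b + h)" using T_N assms(2) by metis
  then show ?thesis using T_add by simp
qed

lemma touch_step:
  assumes "\<exists>b\<in>Stab Z. \<exists>a\<in>N. h' = b + h + a" "pts Z \<inter> T h \<noteq> {}"
  shows "pts Z \<inter> T h' \<noteq> {}"
proof -
  obtain b a where ba: "b \<in> Stab Z" "a \<in> N" "h' = b + h + a" using assms by blast
  obtain x where "x \<in> pts Z" "x \<in> T h" using assms by blast
  then have "b + x \<in> pts Z \<inter> T h'" using T_step[OF ba] Stab_pts ba(1) by blast
  then show ?thesis by blast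
qed

lemma far_not_mem:
  assumes "Z \<in> F" "Z' \<in> F" "Z \<noteq> Z'" "m \<in> pts Z" "pts Z \<inter> T h \<noteq> {}" "pts Z' \<inter> T h \<noteq> {}"
    and far: "\<forall>q\<in>pts Z \<inter> T h. d m q > \<theta> + 1"
  shows "m \<notin> pts Z'"
proof
  assume m: "m \<in> pts Z'"
  obtain q p where q: "q \<in> pts Z" "q \<in> T h" and p: "p \<in> pts Z'" "p \<in> T h" using assms by auto
  have "\<theta> + 1 < d m q" using far q by blast
  then have "\<theta> + 1 \<le> d m q" by simp
  then obtain z where z: "z \<in> seg m q" "d m z = \<theta> + 1" by (meson seg_point)
  have zZ: "z \<in> pts Z" using convexD[OF convex_pts[OF assms(1)] assms(4) q(1) z(1)] .
  have "z \<in> seg m p \<union> seg p q" using tripod z(1) by blast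
  moreover have "z \<notin> pts Z'" using overlap[OF assms(1,2,3), of m z] assms(4) m zZ z by auto
  then have "z \<notin> seg m p" using convexD[OF convex_pts[OF assms(2)] m p(1)] by auto
  ultimately have "z \<in> T h" using convexD[OF T_convex p(2) q(2)] by auto
  then have "\<theta> + 1 < d m z" using far zZ by blast
  then show False using z(2) by simp
qed

text \<open>A non-trivial link excludes the first alternative of \<open>nice\<close> for Z
  translated by - h: it would put the conjugate of b into N, and with it the link.\<close>

lemma overlap_bound:
  assumes "Z \<in> F" "b \<in> Stab Z" "a \<in> N" "h' = b + h + a" "- h + h' \<notin> N" "pts Z \<inter> T h \<noteq> {}"
  shows "b \<noteq> 0" "\<And>x y. x \<in> pts Z \<inter> T h \<Longrightarrow> y \<in> pts Z \<inter> T h \<Longrightarrow> d x y \<le> 3 * \<theta>"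
proof -
  show "b \<noteq> 0" using assms by (auto simp: add.assoc[symmetric])
  have e: "- h + h' = (- h + b + h) + a" using assms by (simp add: add.assoc)
  have "\<not> Stab (tr (- h) Z) \<subseteq> N"
  proof
    assume "Stab (tr (- h) Z) \<subseteq> N"
    moreover have "- h + b + h \<in> Stab (tr (- h) Z)"
      unfolding Stab_tr using assms(2) by (simp add: add.assoc)
    ultimately show False using e assms sub_N by (auto simp: subgrp_def)
  qed
  then have *: "\<forall>x\<in>pts (tr (- h) Z) \<inter> W. \<forall>y\<in>pts (tr (- h) Z) \<inter> W. d x y \<le> 3 * \<theta>"
    using dich[OF tr_F[OF assms(1)], of "- h"] by blast
  fix x y assume xy: "x \<in> pts Z \<inter> T h" "y \<in> pts Z \<inter> T h"
  then have "- h + x \<in> pts (tr (- h) Z) \<inter> W" "- h + y \<in> pts (tr (- h) Z) \<inter> W"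
    by (auto simp: pts_tr add.assoc[symmetric])
  then have "d (- h + x) (- h + y) \<le> 3 * \<theta>" using * by blast
  then show "d x y \<le> 3 * \<theta>" by simp
qed

definition far :: "'y \<Rightarrow> 'a \<Rightarrow> 'a \<Rightarrow> bool" where
  "far Z h m \<longleftrightarrow> m \<in> pts Z \<and> (\<forall>q\<in>pts Z \<inter> T h. d m q > \<theta> + 1)"

lemma far_not_T: "far Z h m \<Longrightarrow> m \<notin> T h"
  unfolding far_def by (metis IntI d_self not_less_zero)

text \<open>The rotation moves p by at least 13 * \<theta>, but Z meets each of the two translates
  only within 3 * \<theta> of p or q, so the middle of the segment is far from both. Two points more
  than \<theta> apart are produced because a single one could lie on a third member, while two
  contradict \<open>overlap\<close>.\<close>

lemma crossing:
  assumes "Z \<in> F" "b \<in> Stab Z" "a \<in> N" "h' = b + h + a" "- h + h' \<notin> N" "pts Z \<inter> T h \<noteq> {}"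
  obtains p q m m' where "p \<in> pts Z \<inter> T h" "q \<in> pts Z \<inter> T h'" "m \<in> seg p q" "m' \<in> seg p q"
    "d m m' > \<theta>" "far Z h m" "far Z h m'" "far Z h' m" "far Z h' m'"
proof -
  note sm = overlap_bound[OF assms]
  have T': "T h' = (+) b ` T h" by (rule T_step[OF assms(2-4)])
  obtain p where p: "p \<in> pts Z" "p \<in> T h" using assms by auto
  define q where "q = b + p"
  have q: "q \<in> pts Z" "q \<in> T h'" using p T' Stab_pts[OF assms(2)] by (auto simp: q_def)
  have sm': "d x y \<le> 3 * \<theta>" if xy: "x \<in> pts Z \<inter> T h'" "y \<in> pts Z \<inter> T h'" for x y
  proof -
    have *: "- b + z \<in> pts Z \<inter> T h" if "z \<in> pts Z \<inter> T h'" for z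
    proof -
      have "- b \<in> Stab Z" using subgrp_Stab assms(2) by (auto simp: subgrp_def)
      then have "- b + z \<in> pts Z" using Stab_pts that by auto
      moreover have "- b + z \<in> T h" using that T' by (auto simp: add.assoc[symmetric])
      ultimately show ?thesis by auto
    qed
    have "d (- b + x) (- b + y) \<le> 3 * \<theta>" using sm(2) *[OF xy(1)] *[OF xy(2)] by blast
    then show ?thesis by simp
  qed
  have D: "13 * \<theta> \<le> d p q" unfolding q_def
    by (rule displace[OF assms(1)]) (use assms sm p in \<open>auto simp: Stab_def\<close>)
  have pick: "\<exists>m. m \<in> seg p q \<and> d p m = k \<and> far Z h m \<and> far Z h' m" if k: "5 * \<theta> \<le> k" "k \<le> 6 * \<theta> + 1" for k
  proof -
    have "k \<le> d p q" using k D theta by simp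
    then obtain m where m: "m \<in> seg p q" "d p m = k" "d m q = d p q - k" by (meson seg_point)
    have "m \<in> pts Z" using convexD[OF convex_pts[OF assms(1)] p(1) q(1) m(1)] .
    moreover have "d m x > \<theta> + 1" if "x \<in> pts Z \<inter> T h" for x
    proof -
      have "d p x \<le> 3 * \<theta>" using sm(2) p that by blast
      moreover have "d p m \<le> d p x + d x m" by (rule d_triangle)
      ultimately show ?thesis using m k theta by (simp add: d_commute)
    qed
    moreover have "d m x > \<theta> + 1" if "x \<in> pts Z \<inter> T h'" for x
    proof -
      have "d x q \<le> 3 * \<theta>" using sm' q that by blast
      moreover have "d m q \<le> d m x + d x q" by (rule d_triangle)
      ultimately show ?thesis using m k D theta by simp
    qed
    ultimately show ?thesis using m by (auto simp: far_def)
  qed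
  \<comment> \<open>At distance 5 * \<theta> from p there remain 2 * \<theta> > \<theta> + 1 to the
    overlap with \<open>T h\<close>. The second distance puts m' more than \<theta> beyond m and
    still leaves 13 * \<theta> - (6 * \<theta> + 1) - 3 * \<theta> > \<theta> + 1 at the other
    end.\<close>
  obtain m where m: "m \<in> seg p q" "d p m = 5 * \<theta>" "far Z h m" "far Z h' m" using pick[of "5 * \<theta>"] by auto
  obtain m' where m': "m' \<in> seg p q" "d p m' = 6 * \<theta> + 1" "far Z h m'" "far Z h' m'"
    using pick[of "6 * \<theta> + 1"] theta by auto
  have "d p m' \<le> d p m + d m m'" by (rule d_triangle)
  then have "d m m' > \<theta>" using m m' by simp
  then show ?thesis using that m m' p q by blast
qed

text \<open>A path of translates without backtracking: no link is trivial and no two consecutive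
  rotations are about the same member.\<close>

definition chain :: "nat \<Rightarrow> (nat \<Rightarrow> 'a) \<Rightarrow> (nat \<Rightarrow> 'y) \<Rightarrow> bool" where
  "chain k h Z \<longleftrightarrow> (\<forall>i<k. Z i \<in> F \<and> pts (Z i) \<inter> T (h i) \<noteq> {} \<and>
       (\<exists>b\<in>Stab (Z i). \<exists>a\<in>N. h (Suc i) = b + h i + a) \<and> - h i + h (Suc i) \<notin> N) \<and>
     (\<forall>i. Suc i < k \<longrightarrow> Z i \<noteq> Z (Suc i))"

lemma chainD:
  assumes "chain k h Z"
  shows "i < k \<Longrightarrow> Z i \<in> F" "i < k \<Longrightarrow> pts (Z i) \<inter> T (h i) \<noteq> {}"
    "i < k \<Longrightarrow> \<exists>b\<in>Stab (Z i). \<exists>a\<in>N. h (Suc i) = b + h i + a"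
    "i < k \<Longrightarrow> - h i + h (Suc i) \<notin> N" "Suc i < k \<Longrightarrow> Z i \<noteq> Z (Suc i)"
  using assms unfolding chain_def by blast+

text \<open>The crossing points of successive links line up on one geodesic. The starting set A is
  left open because it will be either W itself or a translate together with a member attached to
  it.\<close>

lemma chain_separation:
  assumes ch: "chain (Suc k) h Z"
    and A: "convex A" "A \<inter> T (h 0) \<noteq> {}" "\<And>m. far (Z 0) (h 0) m \<Longrightarrow> m \<notin> A"
  shows "\<exists>m m'. d m m' > \<theta> \<and> far (Z k) (h (Suc k)) m \<and> far (Z k) (h (Suc k)) m' \<and>
           (\<forall>s\<in>A. \<forall>y\<in>T (h (Suc k)). m \<in> seg s y \<and> m' \<in> seg s y)"
  using ch
proof (induction k)
  case 0
  obtain b a where ba: "b \<in> Stab (Z 0)" "a \<in> N" "h 1 = b + h 0 + a"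
    using chainD(3)[OF 0, of 0] by auto
  have 1: "Z 0 \<in> F" "- h 0 + h 1 \<notin> N" "pts (Z 0) \<inter> T (h 0) \<noteq> {}"
    using chainD(1,2,4)[OF 0, of 0] by simp_all
  obtain p q m m' where pq: "p \<in> pts (Z 0) \<inter> T (h 0)" "q \<in> pts (Z 0) \<inter> T (h 1)"
    "m \<in> seg p q" "m' \<in> seg p q" "d m m' > \<theta>" "far (Z 0) (h 0) m" "far (Z 0) (h 0) m'"
    "far (Z 0) (h 1) m" "far (Z 0) (h 1) m'"
    by (rule crossing[OF 1(1) ba 1(2,3)])
  have *: "m \<in> seg s y" if m: "m \<in> seg p q" "far (Z 0) (h 0) m" "far (Z 0) (h 1) m"
    and s: "s \<in> A" and y: "y \<in> T (h 1)" for m s y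
  proof -
    have "m \<notin> T (h 1)" "m \<notin> T (h 0)" using m(2,3) far_not_T by blast+
    then have "m \<in> seg y p" using same_branch[OF T_convex _ _ y m(1)] pq seg_commute by blast
    moreover have "convex (A \<union> T (h 0))" using convex_Un A T_convex by blast
    moreover have "m \<notin> A \<union> T (h 0)" using A m \<open>m \<notin> T (h 0)\<close> by auto
    ultimately have "m \<in> seg y s"
      using same_branch[of "A \<union> T (h 0)" m p s y] pq s by blast
    then show ?thesis by (simp add: seg_commute)
  qed
  have "\<forall>s\<in>A. \<forall>y\<in>T (h 1). m \<in> seg s y \<and> m' \<in> seg s y"
    using *[OF pq(3,6,8)] *[OF pq(4,7,9)] by blast
  then show ?case using pq(5,8,9) unfolding One_nat_def by (intro exI[of _ m] exI[of _ m'] conjI)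
next
  case (Suc k)
  have ch': "chain (Suc k) h Z" using Suc.prems by (simp add: chain_def)
  obtain m0 where m0: "far (Z k) (h (Suc k)) m0" "\<forall>s\<in>A. \<forall>y\<in>T (h (Suc k)). m0 \<in> seg s y"
    using Suc.IH[OF ch'] by blast
  let ?h = "h (Suc k)" and ?h' = "h (Suc (Suc k))" and ?Z = "Z (Suc k)"
  have last: "Suc k < Suc (Suc k)" by simp
  obtain b a where ba: "b \<in> Stab ?Z" "a \<in> N" "?h' = b + ?h + a"
    using chainD(3)[OF Suc.prems last] by blast
  obtain p q m m' where pq: "p \<in> pts ?Z \<inter> T ?h" "q \<in> pts ?Z \<inter> T ?h'"
    "m \<in> seg p q" "m' \<in> seg p q" "d m m' > \<theta>" "far ?Z ?h m" "far ?Z ?h m'"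
    "far ?Z ?h' m" "far ?Z ?h' m'"
    by (rule crossing[OF chainD(1)[OF Suc.prems last] ba chainD(4,2)[OF Suc.prems last]])
  have ZZ: "Z k \<in> F" "?Z \<in> F" "Z k \<noteq> ?Z"
    using chainD(1)[OF ch', of k] chainD(1)[OF Suc.prems last] chainD(5)[OF Suc.prems, of k] by simp_all
  have touch: "pts (Z k) \<inter> T ?h \<noteq> {}" "pts ?Z \<inter> T ?h \<noteq> {}"
    using touch_step[OF chainD(3)[OF ch', of k] chainD(2)[OF ch', of k]] chainD(2)[OF Suc.prems last] by simp_all
  have m0nZ: "m0 \<notin> pts ?Z" using far_not_mem[OF ZZ(1,2,3) _ touch] m0(1) unfolding far_def by blast
  have m0T: "m0 \<notin> T ?h" using m0(1) far_not_T by blast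
  have cv: "convex (pts ?Z \<union> T ?h)" "convex (pts (Z k) \<union> T ?h)"
    using convex_Un convex_pts ZZ T_convex touch by blast+
  have *: "m \<in> seg s y" if m: "m \<in> seg p q" "far ?Z ?h m" "far ?Z ?h' m"
    and s: "s \<in> A" and y: "y \<in> T ?h'" for m s y
  proof -
    have mT: "m \<notin> T ?h'" "m \<notin> T ?h" using m(2,3) far_not_T by blast+
    have mZ: "m \<notin> pts (Z k)"
      using far_not_mem[OF ZZ(2,1) ZZ(3)[symmetric] _ touch(2,1)] m(2) unfolding far_def by blast
    have "q \<in> T ?h'" "p \<in> T ?h" using pq by blast+
    then have 1: "m \<in> seg y p" using same_branch[OF T_convex mT(1) _ y m(1)] seg_commute by blast
    have m0Z: "m0 \<in> pts (Z k)" using m0(1) by (simp add: far_def)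
    \<comment> \<open>Here p is replaced by m0, both being in the convex set
      \<open>pts (Z k) \<union> T ?h\<close> that misses m. In the next claim p is replaced by m
      inside \<open>pts ?Z \<union> T ?h\<close>, which misses m0. Two overlapping geodesics
      result.\<close>
    have 2: "m \<in> seg m0 y"
      using same_branch[OF cv(2) _ _ _ 1] mT mZ \<open>p \<in> T ?h\<close> m0Z seg_commute by blast
    have "m0 \<in> seg s p" using m0(2) s \<open>p \<in> T ?h\<close> by blast
    then have 3: "m0 \<in> seg s m"
      using same_branch[OF cv(1)] m0nZ m0T \<open>p \<in> T ?h\<close> m(2) unfolding far_def by blast
    have "m0 \<noteq> m" using mZ m0Z by blast
    then show ?thesis using between_trans(1)[OF 3 2] between_trans(2)[OF 3 2] by blast
  qed
  have "\<forall>s\<in>A. \<forall>y\<in>T ?h'. m \<in> seg s y \<and> m' \<in> seg s y"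
    using *[OF pq(3,6,8)] *[OF pq(4,7,9)] by blast
  then show ?case using pq(5,8,9) by (intro exI[of _ m] exI[of _ m'] conjI)
qed

text \<open>In a shortest linked path a trivial link, or two consecutive rotations about one member,
  could be merged with a neighbour. The length is minimised over all pairs satisfying P, so proper
  subpaths have no such end points. Invariance of P under N is needed to drop a trivial last link,
  which changes the representative of the end.\<close>

lemma minimal_chain:
  assumes inv: "\<And>h h' h''. P h h' \<Longrightarrow> - h' + h'' \<in> N \<Longrightarrow> P h h''"
    and ex: "P h0 h1" "(h0, h1) \<in> linked ^^ k0"
  shows "\<exists>k h Z. chain k h Z \<and> P (h 0) (h k) \<and>
           (\<forall>i j. i \<le> j \<longrightarrow> j \<le> k \<longrightarrow> P (h i) (h j) \<longrightarrow> i = 0 \<and> j = k)"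
proof -
  let ?Q = "\<lambda>k. \<exists>h h'. P h h' \<and> (h, h') \<in> linked ^^ k"
  define k where "k = (LEAST k. ?Q k)"
  have "?Q k" unfolding k_def by (rule LeastI[of ?Q k0]) (use ex in blast)
  then obtain a0 b0 where "P a0 b0" "(a0, b0) \<in> linked ^^ k" by blast
  then obtain h where h: "P (h 0) (h k)" "\<And>i. i < k \<Longrightarrow> (h i, h (Suc i)) \<in> linked"
    unfolding relpow_fun_conv by blast
  have min: "k \<le> j" if "P x y" "(x, y) \<in> linked ^^ j" for x y j
    unfolding k_def by (rule Least_le) (use that in blast)
  have sub: "(h i, h j) \<in> linked ^^ (j - i)" if "i \<le> j" "j \<le> k" for i j
    unfolding relpow_fun_conv by (rule exI[of _ "\<lambda>l. h (i + l)"]) (use that h in auto)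
  have short: "(h i, h (Suc (Suc i))) \<notin> linked" if "Suc i < k" for i
  proof
    assume "(h i, h (Suc (Suc i))) \<in> linked"
    then have "(h 0, h (Suc (Suc i))) \<in> linked ^^ Suc i" using sub[of 0 i] that by auto
    then have "(h 0, h k) \<in> linked ^^ (Suc i + (k - Suc (Suc i)))"
      using sub[of "Suc (Suc i)" k] that unfolding relpow_add by auto
    then have "k \<le> Suc i + (k - Suc (Suc i))" using min h(1) by blast
    then show False using that by simp
  qed
  have nt: "- h i + h (Suc i) \<notin> N" if i: "i < k" for i
  proof
    assume a: "- h i + h (Suc i) \<in> N"
    show False
    proof (cases "Suc i = k")
      case True
      have "- h (Suc i) + h i = - (- h i + h (Suc i))"
        by (simp add: minus_add del: add_uminus_conv_diff)
      then have "- h k + h i \<in> N" using a True sub_N by (auto simp: subgrp_def)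
      then have "k \<le> i - 0" using min[OF inv[OF h(1)] sub[of 0 i]] i by auto
      then show False using i by simp
    next
      case False
      then show False using linked_N[OF a h(2)[of "Suc i"]] short[of i] i by auto
    qed
  qed
  obtain Z where Z: "\<And>i. i < k \<Longrightarrow> Z i \<in> F \<and> pts (Z i) \<inter> T (h i) \<noteq> {} \<and>
      (\<exists>b\<in>Stab (Z i). \<exists>a\<in>N. h (Suc i) = b + h i + a)"
  proof -
    have "\<forall>i. \<exists>Z. i < k \<longrightarrow> Z \<in> F \<and> pts Z \<inter> T (h i) \<noteq> {} \<and>
      (\<exists>b\<in>Stab Z. \<exists>a\<in>N. h (Suc i) = b + h i + a)" using h(2) unfolding linked_def by blast
    then show ?thesis using that by metis
  qed
  have ne: "Z i \<noteq> Z (Suc i)" if i: "Suc i < k" for i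
  proof
    assume eq: "Z i = Z (Suc i)"
    obtain b a b' a' where ba: "b \<in> Stab (Z i)" "a \<in> N" "h (Suc i) = b + h i + a"
      "b' \<in> Stab (Z i)" "a' \<in> N" "h (Suc (Suc i)) = b' + h (Suc i) + a'"
      using Z[of i] Z[of "Suc i"] eq i by (metis Suc_lessD)
    have "h (Suc (Suc i)) = (b' + b) + h i + (a + a')" using ba by (simp add: add.assoc)
    moreover have "b' + b \<in> Stab (Z i)" "a + a' \<in> N"
      using ba subgrp_Stab sub_N by (auto simp: subgrp_def)
    ultimately have "(h i, h (Suc (Suc i))) \<in> linked" unfolding linked_def using Z[of i] i by auto
    then show False using short i by blast
  qed
  have "i = 0 \<and> j = k" if "i \<le> j" "j \<le> k" "P (h i) (h j)" for i j
    using min[OF that(3) sub[OF that(1,2)]] that by auto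
  moreover have "chain k h Z" unfolding chain_def using Z nt ne by metis
  ultimately show ?thesis using h(1) by metis
qed

section \<open>One step of the windmill construction\<close>

definition N' :: "'a set" where "N' = gen (N \<union> \<Union>{Stab Y |Y. Y \<in> F \<and> pts Y \<inter> W \<noteq> {}})"

definition W' :: "'a set" where "W' = \<Union>{pts Z |Z. Z \<in> F \<and> (\<exists>h\<in>N'. pts Z \<inter> T h \<noteq> {})}"

lemma exists_member: "\<exists>Y\<in>F. x \<in> pts Y" using cover[of x x] by auto

lemma sub_N': "subgrp N'"
  unfolding N'_def
proof (rule subgrp_gen)
  fix s assume "s \<in> N \<union> \<Union>{Stab Y |Y. Y \<in> F \<and> pts Y \<inter> W \<noteq> {}}"
  then show "- s \<in> N \<union> \<Union>{Stab Y |Y. Y \<in> F \<and> pts Y \<inter> W \<noteq> {}}"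
    using sub_N subgrp_Stab unfolding subgrp_def by blast
qed

lemma N_N': "N \<subseteq> N'" unfolding N'_def by (rule subsetI, rule gen_incl) simp

lemma Stab_N':
  assumes "Z \<in> F" "h \<in> N'" "pts Z \<inter> T h \<noteq> {}" shows "Stab Z \<subseteq> N'"
proof
  fix b assume b: "b \<in> Stab Z"
  have Z: "Z = tr h (tr (- h) Z)" by (simp add: tr_tr tr_0)
  then have c: "- h + b + h \<in> Stab (tr (- h) Z)" using b Stab_tr by metis
  obtain w where "w \<in> W" "h + w \<in> pts Z" using assms(3) by auto
  then have "w \<in> pts (tr (- h) Z) \<inter> W" by (auto simp: pts_tr image_iff intro!: bexI[of _ "h + w"])
  then have "- h + b + h \<in> N'" unfolding N'_def using c tr_F[OF assms(1)] by (intro gen_incl) blast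
  then have "h + (- h + b + h) + - h \<in> N'" using assms(2) sub_N' unfolding subgrp_def by blast
  then show "b \<in> N'" by (simp add: add.assoc)
qed

lemma W_W': "x \<in> T h \<Longrightarrow> h \<in> N' \<Longrightarrow> x \<in> W'"
  using exists_member[of x] unfolding W'_def by blast

text \<open>Appending a rotation s about Y on the right amounts to rotating on the left by a
  conjugate of s about a translate of Y, which is a link.\<close>

lemma N'_reach: assumes "n \<in> N'" shows "(h, h + n) \<in> linked\<^sup>*"
  using assms unfolding N'_def
proof (induction rule: gen.induct)
  case zero
  then show ?case by simp
next
  case (step x s)
  have "(h + x, h + x + s) \<in> linked" using step.hyps(2)
  proof
    assume s: "s \<in> N"
    obtain w where "w \<in> W" using W_ne by auto
    obtain Z where "Z \<in> F" "h + x + w \<in> pts Z" using exists_member by blast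
    moreover have "0 \<in> Stab Z" by (simp add: Stab_def tr_0)
    moreover have "h + x + s = 0 + (h + x) + s" by simp
    ultimately show ?thesis unfolding linked_def using s \<open>w \<in> W\<close> by blast
  next
    assume "s \<in> \<Union>{Stab Y |Y. Y \<in> F \<and> pts Y \<inter> W \<noteq> {}}"
    then obtain Y where Y: "Y \<in> F" "s \<in> Stab Y" "pts Y \<inter> W \<noteq> {}" by auto
    let ?Z = "tr (h + x) Y"
    have "pts ?Z \<inter> T (h + x) \<noteq> {}" using Y(3) by (auto simp: pts_tr)
    moreover have "(h + x) + s + - (h + x) \<in> Stab ?Z"
      unfolding Stab_tr using Y(2) by (simp add: add.assoc minus_add del: add_uminus_conv_diff)
    moreover have "h + x + s = ((h + x) + s + - (h + x)) + (h + x) + 0"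
      by (simp add: add.assoc minus_add del: add_uminus_conv_diff)
    moreover have "0 \<in> N" using sub_N by (simp add: subgrp_def)
    ultimately show ?thesis unfolding linked_def using tr_F[OF Y(1)] by blast
  qed
  then show ?case using step.IH by (simp add: add.assoc)
qed

lemma linked_N': assumes "(h, h') \<in> linked" "h \<in> N'" shows "h' \<in> N'"
proof -
  obtain Z b a where Z: "Z \<in> F" "pts Z \<inter> T h \<noteq> {}" "b \<in> Stab Z" "a \<in> N" "h' = b + h + a"
    using assms(1) unfolding linked_def by blast
  then have "b \<in> N'" "a \<in> N'" using Stab_N' N_N' assms(2) by auto
  then show ?thesis using Z assms(2) sub_N' by (auto simp: subgrp_def)
qed

text \<open>A minimal chain from W to its translate by n either has length 0, which means that n is
  in N, or has two distinct crossing points on every segment between the two translates. The second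
  is impossible when they share a point.\<close>

lemma stab_W: assumes "n \<in> N'" "x \<in> W" "n + x \<in> W" shows "n \<in> N"
proof -
  let ?P = "\<lambda>h h'. h = 0 \<and> - h' + n \<in> N"
  have "(0, 0 + n) \<in> linked\<^sup>*" by (rule N'_reach[OF assms(1)])
  then obtain k0 where k0: "(0, n) \<in> linked ^^ k0" unfolding rtrancl_power by auto
  have P0: "?P 0 n" using sub_N by (simp add: subgrp_def)
  have inv: "?P h h''" if "?P h h'" "- h' + h'' \<in> N" for h h' h''
  proof -
    have "- h'' + n = - (- h' + h'') + (- h' + n)"
      by (simp add: add.assoc minus_add del: add_uminus_conv_diff)
    then show ?thesis using that sub_N by (auto simp: subgrp_def)
  qed
  have "\<exists>k h Z. chain k h Z \<and> ?P (h 0) (h k) \<and>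
      (\<forall>i j. i \<le> j \<longrightarrow> j \<le> k \<longrightarrow> ?P (h i) (h j) \<longrightarrow> i = 0 \<and> j = k)"
    by (rule minimal_chain[of ?P, OF _ P0 k0]) (erule inv, assumption)
  then obtain k h Z where ch: "chain k h Z" and C1: "?P (h 0) (h k)" by blast
  show ?thesis
  proof (cases k)
    case 0
    then show ?thesis using C1 by auto
  next
    case (Suc k')
    have "\<exists>m m'. d m m' > \<theta> \<and> far (Z k') (h (Suc k')) m \<and> far (Z k') (h (Suc k')) m' \<and>
           (\<forall>s\<in>T 0. \<forall>y\<in>T (h (Suc k')). m \<in> seg s y \<and> m' \<in> seg s y)"
    proof (rule chain_separation)
      show "chain (Suc k') h Z" using ch Suc by simp
      show "convex (T 0)" by (rule T_convex)
      show "T 0 \<inter> T (h 0) \<noteq> {}" using C1 W_ne by simp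
      fix m assume m: "far (Z 0) (h 0) m"
      then have "m \<notin> T (h 0)" by (rule far_not_T)
      then show "m \<notin> T 0" using C1 by simp
    qed
    then obtain m m' where m: "d m m' > \<theta>" "\<forall>s\<in>T 0. \<forall>y\<in>T (h k). m \<in> seg s y \<and> m' \<in> seg s y"
      using Suc by blast
    have "n + x \<in> T n" using assms by simp
    moreover have "T n = T (h k)" using T_N C1 by blast
    moreover have "n + x \<in> T 0" using assms by simp
    ultimately have "m \<in> seg (n + x) (n + x)" "m' \<in> seg (n + x) (n + x)" using m by blast+
    then show ?thesis using m(1) by simp
  qed
qed

text \<open>Let s and t hang on members A and B. If A and B touch one translate, Y avoids it and so
  runs along A and then B, at most \<theta> in each with one further step. If a chain of positive
  length is needed, both crossing points of its last link lie on Y and on another member, against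
  \<open>overlap\<close>.\<close>

lemma overlap_bound_W':
  assumes Y: "Y \<in> F" "\<And>h. h \<in> N' \<Longrightarrow> pts Y \<inter> T h = {}"
    and st: "s \<in> pts Y" "s \<in> W'" "t \<in> pts Y" "t \<in> W'"
  shows "d s t \<le> 3 * \<theta>"
proof -
  \<comment> \<open>A and B are quantified inside P, so that minimality ranges over all ways of
    attaching s and t.\<close>
  define P where "P h h' \<longleftrightarrow> h \<in> N' \<and> h' \<in> N' \<and> (\<exists>A B. A \<in> F \<and> B \<in> F \<and> s \<in> pts A \<and> t \<in> pts B \<and>
      pts A \<inter> T h \<noteq> {} \<and> pts B \<inter> T h' \<noteq> {})" for h h'
  obtain A0 h0 where A0: "A0 \<in> F" "s \<in> pts A0" "h0 \<in> N'" "pts A0 \<inter> T h0 \<noteq> {}"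
    using st(2) unfolding W'_def by blast
  obtain B0 h1 where B0: "B0 \<in> F" "t \<in> pts B0" "h1 \<in> N'" "pts B0 \<inter> T h1 \<noteq> {}"
    using st(4) unfolding W'_def by blast
  have P0: "P h0 h1" unfolding P_def using A0 B0 by blast
  have "- h0 + h1 \<in> N'" using P0 sub_N' by (auto simp: subgrp_def P_def)
  then have "(h0, h0 + (- h0 + h1)) \<in> linked\<^sup>*" by (rule N'_reach)
  then obtain k0 where k0: "(h0, h1) \<in> linked ^^ k0" unfolding rtrancl_power by auto
  have inv: "P h h''" if "P h h'" "- h' + h'' \<in> N" for h h' h''
  proof -
    have "h'' = h' + (- h' + h'')" by simp
    then have "h'' \<in> N'" using that N_N' sub_N' unfolding subgrp_def P_def by (metis subsetD)
    then show ?thesis using that(1) T_N[OF that(2)] unfolding P_def by metis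
  qed
  have "\<exists>k h Z. chain k h Z \<and> P (h 0) (h k) \<and>
      (\<forall>i j. i \<le> j \<longrightarrow> j \<le> k \<longrightarrow> P (h i) (h j) \<longrightarrow> i = 0 \<and> j = k)"
    by (rule minimal_chain[of P, OF _ P0 k0]) (erule inv, assumption)
  then obtain k h Z where ch: "chain k h Z" and C1: "P (h 0) (h k)"
    and min0: "\<forall>i j. i \<le> j \<longrightarrow> j \<le> k \<longrightarrow> P (h i) (h j) \<longrightarrow> i = 0 \<and> j = k" by blast
  have min: "i = 0 \<and> j = k" if "i \<le> j" "j \<le> k" "P (h i) (h j)" for i j
    using min0[rule_format, OF that] .
  have C: "P (h 0) (h k)"
    "\<And>i. i < k \<Longrightarrow> Z i \<in> F" "\<And>i. i < k \<Longrightarrow> pts (Z i) \<inter> T (h i) \<noteq> {}"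
    "\<And>i. i < k \<Longrightarrow> \<exists>b\<in>Stab (Z i). \<exists>a\<in>N. h (Suc i) = b + h i + a"
    "\<And>i. i < k \<Longrightarrow> - h i + h (Suc i) \<notin> N" "\<And>i. Suc i < k \<Longrightarrow> Z i \<noteq> Z (Suc i)"
    using chainD[OF ch] C1 by blast+
  obtain A B where A: "A \<in> F" "s \<in> pts A" "pts A \<inter> T (h 0) \<noteq> {}"
    and B: "B \<in> F" "t \<in> pts B" "pts B \<inter> T (h k) \<noteq> {}" using C(1) unfolding P_def by blast
  have hN: "h i \<in> N'" if "i \<le> k" for i
    using that
  proof (induction i)
    case 0
    then show ?case using C(1) unfolding P_def by blast
  next
    case (Suc i)
    then have "i < k" by simp
    then have "(h i, h (Suc i)) \<in> linked" unfolding linked_def using C(2-4)[of i] by blast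
    then show ?case using linked_N' Suc.IH Suc.prems Suc_leD by blast
  qed
  have YT: "Y \<noteq> X" if "h \<in> N'" "pts X \<inter> T h \<noteq> {}" for X h using Y(2) that by blast
  show ?thesis
  proof (cases k)
    case 0
    have YA: "Y \<noteq> A" "Y \<noteq> B" using YT[OF hN[of 0]] A B 0 by blast+
    obtain u v where u: "u \<in> pts A" "u \<in> T (h 0)" and v: "v \<in> pts B" "v \<in> T (h 0)"
      using A B 0 by blast
    have cov: "z \<in> pts A \<or> z \<in> pts B" if z: "z \<in> seg s t" for z
    proof -
      have "z \<in> pts Y" using convexD[OF convex_pts[OF Y(1)] st(1,3) z] .
      then have "z \<notin> T (h 0)" using Y(2)[of "h 0"] hN by blast
      then have "z \<notin> seg u v" using convexD[OF T_convex u(2) v(2)] by blast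
      then have "z \<in> seg s u \<or> z \<in> seg v t" using seg_triangle3[of s t u v] z by blast
      then show ?thesis using convexD[OF convex_pts[OF A(1)] A(2) u(1)]
          convexD[OF convex_pts[OF B(1)] v(1) B(2)] by blast
    qed
    show ?thesis
    proof (rule ccontr)
      assume "\<not> ?thesis"
      then have big: "d s t > 3 * \<theta>" by simp
      then obtain z where z: "z \<in> seg s t" "d s z = \<theta> + 1" "d z t = d s t - (\<theta> + 1)"
        using seg_point[of "\<theta> + 1" s t] theta by auto
      have zY: "z \<in> pts Y" using convexD[OF convex_pts[OF Y(1)] st(1,3) z(1)] .
      have "z \<notin> pts A" using overlap[OF Y(1) A(1) YA(1), of s z] st A zY z by auto
      then have "z \<in> pts B" using cov z by blast
      then have "d z t \<le> \<theta>" using overlap[OF Y(1) B(1) YA(2), of z t] st B zY by auto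
      then show False using z big theta by simp
    qed
  next
    case (Suc k')
    \<comment> \<open>Otherwise A touches the next translate as well and the chain could start
      there; similarly at the other end for B.\<close>
    have ZA: "A \<noteq> Z 0"
    proof
      assume eq: "A = Z 0"
      have "pts (Z 0) \<inter> T (h (Suc 0)) \<noteq> {}" using touch_step[OF C(4)[of 0] C(3)[of 0]] Suc by simp
      moreover have "h (Suc 0) \<in> N'" "h k \<in> N'" using hN Suc by auto
      ultimately have "P (h (Suc 0)) (h k)" unfolding P_def using A B eq by blast
      then show False using min[of "Suc 0" k] Suc by simp
    qed
    have ZB: "Z k' \<noteq> B"
    proof
      assume eq: "Z k' = B"
      have "pts (Z k') \<inter> T (h k') \<noteq> {}" using C(3) Suc by simp
      moreover have "h 0 \<in> N'" "h k' \<in> N'" using hN Suc by auto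
      ultimately have "P (h 0) (h k')" unfolding P_def using A B eq by blast
      then show False using min[of 0 k'] Suc by simp
    qed
    have "\<exists>m m'. d m m' > \<theta> \<and> far (Z k') (h (Suc k')) m \<and> far (Z k') (h (Suc k')) m' \<and>
           (\<forall>s\<in>pts A \<union> T (h 0). \<forall>y\<in>T (h (Suc k')). m \<in> seg s y \<and> m' \<in> seg s y)"
    proof (rule chain_separation)
      show "chain (Suc k') h Z" using ch Suc by simp
      show "(pts A \<union> T (h 0)) \<inter> T (h 0) \<noteq> {}" using W_ne by blast
      show "convex (pts A \<union> T (h 0))" using convex_Un convex_pts A T_convex by blast
      fix m assume m: "far (Z 0) (h 0) m"
      then have "m \<notin> T (h 0)" by (rule far_not_T)
      moreover have "m \<in> pts (Z 0)" "\<forall>q\<in>pts (Z 0) \<inter> T (h 0). \<theta> + 1 < d m q" using m by (auto simp: far_def)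
      then have "m \<notin> pts A" using far_not_mem[OF C(2)[of 0] A(1) ZA[symmetric] _ C(3)[of 0] A(3)] Suc by blast
      ultimately show "m \<notin> pts A \<union> T (h 0)" by blast
    qed
    then obtain m m' where m: "d m m' > \<theta>" "far (Z k') (h k) m" "far (Z k') (h k) m'"
      "\<forall>s\<in>pts A \<union> T (h 0). \<forall>y\<in>T (h k). m \<in> seg s y"
      "\<forall>s\<in>pts A \<union> T (h 0). \<forall>y\<in>T (h k). m' \<in> seg s y"
      using Suc by blast
    have touch: "pts (Z k') \<inter> T (h k) \<noteq> {}"
      using touch_step[OF C(4)[of k'] C(3)[of k']] Suc by simp
    obtain v where v: "v \<in> pts B" "v \<in> T (h k)" using B by blast
    have on: "m \<in> seg s t" if "far (Z k') (h k) m" "\<forall>s\<in>pts A \<union> T (h 0). \<forall>y\<in>T (h k). m \<in> seg s y" for m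
    proof -
      have "m \<in> pts (Z k')" "\<forall>q\<in>pts (Z k') \<inter> T (h k). \<theta> + 1 < d m q" using that(1) by (auto simp: far_def)
      then have "m \<notin> pts B" using far_not_mem[OF C(2) B(1) ZB _ touch B(3)] Suc by blast
      then show ?thesis using same_branch[OF convex_pts[OF B(1)] _ v(1) B(2)] that(2) v(2) A(2) by blast
    qed
    note on[OF m(2,4)] on[OF m(3,5)]
    then have "m \<in> pts Y" "m' \<in> pts Y" using convexD[OF convex_pts[OF Y(1)] st(1,3)] by blast+
    moreover have "Y \<noteq> Z k'" using YT[OF hN[of k'] C(3)[of k']] Suc by simp
    ultimately have "d m m' \<le> \<theta>"
      using overlap[OF Y(1) C(2)[of k'], of m m'] m Suc by (auto simp: far_def)
    then show ?thesis using m by simp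
  qed
qed

text \<open>By \<open>tripod\<close> the relation \<open>e\<close> is transitive, so it is enough to
  connect every point to one base point w: inside translates, inside members, and along
  links.\<close>

lemma convex_W': "convex W'"
proof -
  define e where "e s t \<longleftrightarrow> seg s t \<subseteq> W'" for s t
  have tran: "e s u" if "e s t" "e t u" for s t u using that tripod[of s u t] by (auto simp: e_def)
  have sy: "e s t" if "e t s" for s t using that by (simp add: e_def seg_commute)
  have inZ: "e s t" if "Z \<in> F" "h \<in> N'" "pts Z \<inter> T h \<noteq> {}" "s \<in> pts Z" "t \<in> pts Z" for Z h s t
    using convexD[OF convex_pts[OF that(1)] that(4,5)] that(1-3) unfolding e_def W'_def by blast
  have inT: "e s t" if "h \<in> N'" "s \<in> T h" "t \<in> T h" for h s t
    using convexD[OF T_convex that(2,3)] W_W' that(1) unfolding e_def by blast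
  obtain w where w: "w \<in> W" using W_ne by auto
  have key: "h' \<in> N' \<and> e w (h' + w)" if "(0, h') \<in> linked\<^sup>*" for h'
    using that
  proof (induction rule: rtrancl_induct)
    case base
    have "0 \<in> N'" using sub_N' by (simp add: subgrp_def)
    then show ?case using inT[of 0 w w] w by simp
  next
    case (step h h')
    obtain Z b a where Z: "Z \<in> F" "pts Z \<inter> T h \<noteq> {}" "b \<in> Stab Z" "a \<in> N" "h' = b + h + a"
      using step.hyps(2) unfolding linked_def by blast
    have h': "h' \<in> N'" using linked_N' step by blast
    obtain x where x: "x \<in> pts Z" "x \<in> T h" using Z by auto
    have T': "T h' = (+) b ` T h" by (rule T_step[OF Z(3-5)])
    have "e (h + w) x" using inT[of h] x w step.IH by auto
    moreover have "e x (b + x)" using inZ[OF Z(1) _ Z(2) x(1)] Stab_pts[OF Z(3) x(1)] step.IH by blast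
    moreover have "e (b + x) (h' + w)"
    proof (rule inT[OF h'])
      show "b + x \<in> T h'" using T' x by blast
      show "h' + w \<in> T h'" using w by blast
    qed
    ultimately show ?case using tran step.IH h' by blast
  qed
  have base: "e w s" if s: "s \<in> W'" for s
  proof -
    obtain Z h where Z: "Z \<in> F" "h \<in> N'" "pts Z \<inter> T h \<noteq> {}" "s \<in> pts Z" using s unfolding W'_def by blast
    then obtain x where x: "x \<in> pts Z" "x \<in> T h" by blast
    have "e w (h + w)" using key[of h] N'_reach[OF Z(2), of 0] by simp
    moreover have "e (h + w) x" using inT[OF Z(2)] x w by blast
    moreover have "e x s" using inZ[OF Z(1-3)] x Z by blast
    ultimately show ?thesis using tran by blast
  qed
  have "e s t" if "s \<in> W'" "t \<in> W'" for s t using base[OF that(1)] base[OF that(2)] tran sy by blast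
  then show ?thesis by (auto simp: convex_def e_def)
qed

lemma nice': "nice W' N'"
  unfolding nice_def
proof (intro conjI ballI)
  have "0 \<in> N'" using sub_N' by (simp add: subgrp_def)
  then have WW: "x \<in> W'" if "x \<in> W" for x using W_W'[of x 0] that by simp
  then show "W' \<noteq> {}" using W_ne by blast
  show "convex W'" by (rule convex_W')
  show "subgrp N'" by (rule sub_N')
  show "a + x \<in> W'" if "a \<in> N'" "x \<in> W'" for a x
  proof -
    obtain Z h where Z: "Z \<in> F" "h \<in> N'" "pts Z \<inter> T h \<noteq> {}" "x \<in> pts Z"
      using \<open>x \<in> W'\<close> unfolding W'_def by blast
    then obtain y where y: "y \<in> pts Z" "y \<in> T h" by blast
    have "a + y \<in> pts (tr a Z) \<inter> T (a + h)" using y by (auto simp: pts_tr add.assoc)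
    moreover have "a + h \<in> N'" using that Z sub_N' by (simp add: subgrp_def)
    moreover have "a + x \<in> pts (tr a Z)" using Z by (simp add: pts_tr)
    ultimately show ?thesis unfolding W'_def using tr_F[OF Z(1)] by blast
  qed
  fix Y assume Y: "Y \<in> F"
  show "pts Y \<subseteq> W' \<and> Stab Y \<subseteq> N' \<or> (\<forall>x\<in>pts Y \<inter> W'. \<forall>y\<in>pts Y \<inter> W'. d x y \<le> 3 * \<theta>)"
  proof (cases "\<exists>h\<in>N'. pts Y \<inter> T h \<noteq> {}")
    case True
    then obtain h where "h \<in> N'" "pts Y \<inter> T h \<noteq> {}" by blast
    then have "pts Y \<subseteq> W'" "Stab Y \<subseteq> N'" using Y Stab_N' unfolding W'_def by blast+
    then show ?thesis by blast
  next
    case False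
    then have "d s t \<le> 3 * \<theta>" if "s \<in> pts Y" "s \<in> W'" "t \<in> pts Y" "t \<in> W'" for s t
      using overlap_bound_W'[OF Y _ that] by blast
    then show ?thesis by blast
  qed
qed

text \<open>This is where the covering of the edges enters: every step enlarges the windmill by its
  neighbourhood of radius 1, so the iteration exhausts the tree.\<close>

lemma nbhd_W': "x \<in> W \<Longrightarrow> d x y \<le> 1 \<Longrightarrow> y \<in> W'"
proof -
  assume "x \<in> W" "d x y \<le> 1"
  moreover from this obtain Y where "Y \<in> F" "x \<in> pts Y" "y \<in> pts Y" using cover by blast
  moreover have "0 \<in> N'" using sub_N' by (simp add: subgrp_def)
  ultimately show "y \<in> W'" unfolding W'_def by force
qed

end

section \<open>Exhausting the tree by windmills\<close>

context spinning_family
begin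

text \<open>Starting from a single member of the family, the windmills \<open>W i\<close> exhaust the tree, and an element
  of \<open>N (Suc i)\<close> that moves a point of \<open>W i\<close> to a point of \<open>W i\<close> already lies in \<open>N i\<close>.\<close>

theorem rotation_subgroup_stabilizer:
  assumes "Y0 \<in> F" "n \<in> gen (\<Union>(Stab ` F))" "x \<in> pts Y0" "n + x \<in> pts Y0"
  shows "tr n Y0 = Y0"
proof -
  define st where "st = rec_nat (pts Y0, Stab Y0)
      (\<lambda>_ p. (windmill.W' tr pts F (fst p) (snd p), windmill.N' tr pts F (fst p) (snd p)))"
  define W where "W i = fst (st i)" for i
  define N where "N i = snd (st i)" for i
  have W0: "W 0 = pts Y0" "N 0 = Stab Y0" by (simp_all add: W_def N_def st_def)
  have WS: "W (Suc i) = windmill.W' tr pts F (W i) (N i)" "N (Suc i) = windmill.N' tr pts F (W i) (N i)" for i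
    by (simp_all add: W_def N_def st_def)
  have nice0: "nice (pts Y0) (Stab Y0)"
  proof -
    have "d x y \<le> 3 * \<theta>" if "Y \<in> F" "Y \<noteq> Y0" "x \<in> pts Y \<inter> pts Y0" "y \<in> pts Y \<inter> pts Y0" for x y Y
      using overlap[OF that(1) assms(1) that(2-4)] by simp
    then show ?thesis
      unfolding nice_def using pts_ne convex_pts subgrp_Stab Stab_pts assms(1) by (metis subset_refl)
  qed
  have wm: "windmill len tr pts F \<theta> (W i) (N i)" for i
  proof (induction i)
    case 0
    show ?case by unfold_locales (simp add: W0 nice0)
  next
    case (Suc i)
    then interpret windmill len tr pts F \<theta> "W i" "N i" .
    show ?case by unfold_locales (simp add: WS nice')
  qed
  have mono: "W i \<subseteq> W (Suc i)" "N i \<subseteq> N (Suc i)" for i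
    using windmill.nbhd_W'[OF wm, of _ i] windmill.N_N'[OF wm, of i] unfolding WS
    by (metis d_self le0 subsetI)+
  have W0i: "W 0 \<subseteq> W i" for i by (induction i) (use mono in auto)
  have monoN: "N i \<subseteq> N j" if "i \<le> j" for i j using lift_Suc_mono_le[of N] mono that by blast
  have reach: "y \<in> W (d x y)" for y
  proof (induction "d x y" arbitrary: y)
    case 0
    then show ?case using assms W0 by auto
  next
    case (Suc k)
    obtain z where z: "d x z = k" "d z y = d x y - k"
      using seg_point[of k x y] Suc.hyps(2) by (metis Suc_n_not_le_n nat_le_linear)
    then have "z \<in> W k" "d z y \<le> 1" using Suc.hyps by auto
    then have "y \<in> W (Suc k)" unfolding WS using windmill.nbhd_W'[OF wm] by blast
    then show ?case using Suc.hyps by simp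
  qed
  have stab: "\<exists>i. Stab Y \<subseteq> N i" if Y: "Y \<in> F" for Y
  proof -
    obtain y where y: "y \<in> pts Y" using pts_ne[OF Y] by auto
    let ?i = "d x y"
    interpret wi: windmill len tr pts F \<theta> "W ?i" "N ?i" by (rule wm)
    have "0 \<in> wi.N'" using wi.sub_N' by (simp add: subgrp_def)
    then have "Stab Y \<subseteq> wi.N'" using wi.Stab_N'[OF Y, of 0] reach[of y] y by auto
    then show ?thesis using WS(2) by metis
  qed
  have "\<exists>i. n \<in> N i"
    using assms(2)
  proof (induction rule: gen.induct)
    case zero
    then show ?case using windmill.sub_N[OF wm] by (auto simp: subgrp_def)
  next
    case (step z s)
    then obtain i j where i: "z \<in> N i" and j: "s \<in> N j" using stab by blast
    then have "z \<in> N (max i j)" "s \<in> N (max i j)" using monoN[of i "max i j"] monoN[of j "max i j"] by auto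
    then show ?case using windmill.sub_N[OF wm, of "max i j"] by (auto simp: subgrp_def)
  qed
  then obtain i where "n \<in> N i" by blast
  then have "n \<in> N 0"
  proof (induction i)
    case (Suc i)
    have W: "x \<in> W i" "n + x \<in> W i" using assms(3,4) W0(1) W0i by blast+
    have "n \<in> N i" using windmill.stab_W[OF wm _ W] Suc.prems unfolding WS .
    then show ?case by (rule Suc.IH)
  qed
  then show ?thesis by (simp add: W0 Stab_def)
qed

end

section \<open>Groups generated by the colours of a graph\<close>

text \<open>The free product of groups of order 2 indexed by \<^typ>\<open>nat\<close>, written additively.\<close>

typedef rword = "{w :: nat list. distinct_adj w}"
  by (rule exI[of _ "[]"]) simp

setup_lifting type_definition_rword

fun lmul :: "nat \<Rightarrow> nat list \<Rightarrow> nat list" where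
  "lmul c [] = [c]"
| "lmul c (a # w) = (if a = c then w else c # a # w)"

definition mul :: "nat list \<Rightarrow> nat list \<Rightarrow> nat list" where "mul u w = foldr lmul u w"

lemma mul_simps [simp]: "mul [] w = w" "mul (c # u) w = lmul c (mul u w)"
  "mul (u @ v) w = mul u (mul v w)"
  by (simp_all add: mul_def)

lemma distinct_adj_lmul: "distinct_adj w \<Longrightarrow> distinct_adj (lmul c w)"
  by (cases w) (auto dest: distinct_adj_ConsD)

lemma distinct_adj_mul: "distinct_adj w \<Longrightarrow> distinct_adj (mul u w)"
  by (induction u) (auto intro: distinct_adj_lmul)

lemma lmul_lmul: "distinct_adj w \<Longrightarrow> lmul c (lmul c w) = w"
  by (cases w rule: remdups_adj.cases) auto

lemma mul_lmul: "distinct_adj u \<Longrightarrow> distinct_adj w \<Longrightarrow> mul (lmul c u) w = lmul c (mul u w)"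
  by (cases u) (auto simp: lmul_lmul distinct_adj_mul)

lemma mul_assoc: "distinct_adj v \<Longrightarrow> distinct_adj w \<Longrightarrow> mul (mul u v) w = mul u (mul v w)"
  by (induction u) (auto simp: mul_lmul distinct_adj_mul)

lemma mul_append: "distinct_adj (u @ w) \<Longrightarrow> mul u w = u @ w"
proof (induction u)
  case (Cons c u)
  then have "distinct_adj (u @ w)" by (cases "u @ w") auto
  then show ?case using Cons by (cases "u @ w") auto
qed simp

lemma mul_Nil: "distinct_adj u \<Longrightarrow> mul u [] = u" using mul_append[of u "[]"] by simp

lemma mul_rev: "mul (rev u) (u @ w) = w" by (induction u) auto

lemma distinct_adj_rev_iff: "distinct_adj (rev u) \<longleftrightarrow> distinct_adj u" by simp

instantiation rword :: group_add
begin
lift_definition zero_rword :: rword is "[]" by simp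
lift_definition plus_rword :: "rword \<Rightarrow> rword \<Rightarrow> rword" is mul by (rule distinct_adj_mul)
lift_definition uminus_rword :: "rword \<Rightarrow> rword" is rev by simp
definition "minus_rword (a :: rword) b = a + - b"
instance
proof
  fix a b c :: rword
  show "a + b + c = a + (b + c)" by transfer (simp add: mul_assoc)
  show "0 + a = a" by transfer simp
  show "a + 0 = a" by transfer (simp add: mul_Nil)
  show "- a + a = 0" by transfer (use mul_rev[of _ "[]"] in simp)
  show "a + - b = a - b" by (simp add: minus_rword_def)
qed
end

section \<open>The Cayley tree of the free product\<close>

lift_definition len :: "rword \<Rightarrow> nat" is length .

fun lcp :: "nat list \<Rightarrow> nat list \<Rightarrow> nat" where
  "lcp (a # x) (b # y) = (if a = b then Suc (lcp x y) else 0)"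
| "lcp _ _ = 0"

text \<open>The common prefix length is the Gromov product at the identity, and its ultrametric
  inequality is the four point condition with that base point.\<close>

lemma lcp_ultra: "min (lcp x z) (lcp z y) \<le> lcp x y"
proof (induction x y arbitrary: z rule: lcp.induct)
  case (1 a x b y)
  then show ?case by (cases z) (auto simp: min_le_iff_disj)
qed (auto split: list.splits simp: min_le_iff_disj elim: lcp.elims)

lemma lcp_commute: "lcp x y = lcp y x"
  by (induction x y rule: lcp.induct) (auto split: list.splits elim: lcp.elims)

lemma length_mul_rev:
  "distinct_adj x \<Longrightarrow> distinct_adj y \<Longrightarrow> length (mul (rev x) y) + 2 * lcp x y = length x + length y"
proof (induction x y rule: lcp.induct)
  case (1 a x b y)
  have d: "distinct_adj x" "distinct_adj y" using 1 by (auto dest: distinct_adj_ConsD)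
  show ?case
  proof (cases "a = b")
    case True
    then show ?thesis using 1 d by simp
  next
    case False
    then have "distinct_adj (rev (a # x) @ b # y)"
      using 1(2,3) distinct_adj_rev_iff[of "a # x"] by (subst distinct_adj_append_iff) (auto simp del: distinct_adj_rev)
    then have "length (mul (rev (a # x)) (b # y)) = length (rev (a # x) @ b # y)" by (metis mul_append)
    then show ?thesis using False by simp
  qed
qed (auto simp: mul_Nil)

lemma len_diff: "len (- x + y) + 2 * lcp (Rep_rword x) (Rep_rword y) = len x + len y"
  by transfer (simp add: length_mul_rev)

lemma tree_group_rword: "tree_group len"
proof
  fix x y z u :: rword and k
  show "len x = 0 \<longleftrightarrow> x = 0" by transfer simp
  show "len (- x) = len x" by transfer simp
  \<comment> \<open>The case u = 0; the general condition follows by translating u to the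
    identity.\<close>
  have *: "len z + len (- x + y) \<le> max (len x + len (- z + y)) (len y + len (- z + x))" for x y z
    using len_diff[of x y] len_diff[of z y] len_diff[of z x]
      lcp_ultra[of "Rep_rword x" "Rep_rword z" "Rep_rword y"]
    by (auto simp: lcp_commute[of "Rep_rword x" "Rep_rword z"] min_def max_def split: if_splits)
  show "len (- u + z) + len (- x + y) \<le> max (len (- u + x) + len (- z + y)) (len (- u + y) + len (- z + x))"
    using *[of "- u + z" "- u + x" "- u + y"]
    by (simp add: minus_add add.assoc del: add_uminus_conv_diff)
  assume "k \<le> len x"
  then show "\<exists>y. len y = k \<and> len (- y + x) = len x - k"
  proof transfer
    fix k and x :: "nat list" assume x: "distinct_adj x" "k \<le> length x"
    have "distinct_adj (take k x @ drop k x)" using x by simp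
    then have "distinct_adj (take k x)" using distinct_adj_append_iff by blast
    moreover have "mul (rev (take k x)) x = drop k x"
      using mul_rev[of "take k x" "drop k x"] by (simp del: mul_simps)
    ultimately show "\<exists>y\<in>{w. distinct_adj w}. length y = k \<and> length (mul (rev y) x) = length x - k"
      using x by (intro bexI[of _ "take k x"]) auto
  qed
qed

lemma length_mul_le: "length (mul u w) \<le> length u + length w"
proof (induction u)
  case (Cons c u)
  then show ?case by (cases "mul u w") auto
qed simp

lemma mul_eq_append: "length (mul u w) = length u + length w \<Longrightarrow> mul u w = u @ w"
proof (induction u)
  case (Cons c u)
  then show ?case using length_mul_le[of u w] by (cases "mul u w") (auto split: if_splits)
qed simp

section \<open>Lifting a coloured graph to the tree\<close>

primrec run :: "(nat \<Rightarrow> 'v \<Rightarrow> 'v \<Rightarrow> bool) \<Rightarrow> 'v \<Rightarrow> nat list \<Rightarrow> 'v \<Rightarrow> bool" where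
  "run E v [] u \<longleftrightarrow> u = v"
| "run E v (c # w) u \<longleftrightarrow> (\<exists>v'. E c v v' \<and> run E v' w u)"

lemma run_append: "run E v (a @ b) u \<longleftrightarrow> (\<exists>t. run E v a t \<and> run E t b u)"
  by (induction a arbitrary: v) auto

text \<open>Every colour is a partial involution of the vertices. For the lifted components
  \<open>girth\<close> becomes the displacement of stabilizers, \<open>pieces\<close> the bound on
  overlaps, and \<open>every_colour\<close> the covering of the edges of the tree.\<close>

locale coloured_graph =
  fixes E :: "nat \<Rightarrow> 'v \<Rightarrow> 'v \<Rightarrow> bool" and \<theta> :: nat
  assumes sym: "E c u v \<Longrightarrow> E c v u"
    and functional: "E c u v \<Longrightarrow> E c u v' \<Longrightarrow> v = v'"
    and every_colour: "\<exists>u v. E c u v"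
    and girth: "\<lbrakk>run E v w v; distinct_adj w; w \<noteq> []\<rbrakk> \<Longrightarrow> 13 * \<theta> \<le> length w"
    and pieces: "\<lbrakk>run E u w u'; run E v w v'; distinct_adj w; u \<noteq> v\<rbrakk> \<Longrightarrow> length w \<le> \<theta>"
    and theta: "2 \<le> \<theta>"
begin

lemma run_functional: "run E v w u \<Longrightarrow> run E v w u' \<Longrightarrow> u = u'"
  by (induction w arbitrary: v) (auto dest: functional)

text \<open>Cancelling a letter means crossing an edge back; by \<open>sym\<close> and
  \<open>functional\<close> this returns to v.\<close>

lemma run_lmul: "E c v v1 \<Longrightarrow> run E v1 w z \<longleftrightarrow> run E v (lmul c w) z"
  by (cases w) (auto dest: functional sym)

lemma run_mul: "run E v a u \<Longrightarrow> run E u b z \<longleftrightarrow> run E v (mul a b) z"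
proof (induction a arbitrary: v)
  case (Cons c a)
  then obtain v' where v': "E c v v'" "run E v' a u" by auto
  have "run E u b z \<longleftrightarrow> run E v' (mul a b) z" by (rule Cons.IH[OF v'(2)])
  also have "\<dots> \<longleftrightarrow> run E v (lmul c (mul a b)) z" by (rule run_lmul[OF v'(1)])
  finally show ?case by simp
qed auto

text \<open>The lift of a component of the graph to the Cayley tree that puts the vertex \<open>v\<close> over \<open>x\<close>.\<close>

definition chart :: "rword \<Rightarrow> 'v \<Rightarrow> (rword \<times> 'v) set" where
  "chart x v = {(y, u). run E v (Rep_rword (- x + y)) u}"

definition charts :: "(rword \<times> 'v) set set" where "charts = {chart x v |x v. True}"

definition shift :: "rword \<Rightarrow> (rword \<times> 'v) set \<Rightarrow> (rword \<times> 'v) set" where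
  "shift g Y = (\<lambda>(y, u). (g + y, u)) ` Y"

lemma chart_base: "(x, v) \<in> chart x v" by (simp add: chart_def zero_rword.rep_eq)

lemma chart_eq: assumes "(y, u) \<in> chart x v" shows "chart y u = chart x v"
proof -
  have *: "run E u (Rep_rword (- y + z)) t \<longleftrightarrow> run E v (Rep_rword (- x + z)) t" for z t
  proof -
    have "- x + z = (- x + y) + (- y + z)" by (simp add: add.assoc)
    then have "Rep_rword (- x + z) = mul (Rep_rword (- x + y)) (Rep_rword (- y + z))"
      by (simp add: plus_rword.rep_eq)
    then show ?thesis using run_mul assms by (simp add: chart_def)
  qed
  then show ?thesis by (simp add: chart_def)
qed

lemma chart_functional: "(y, u) \<in> chart x v \<Longrightarrow> (y, u') \<in> chart x v \<Longrightarrow> u = u'"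
  by (auto simp: chart_def dest: run_functional)

lemma charts_eq: "Y \<in> charts \<Longrightarrow> (y, u) \<in> Y \<Longrightarrow> Y = chart y u"
  unfolding charts_def using chart_eq by auto

lemma shift_chart: "shift g (chart x v) = chart (g + x) v"
proof -
  have e: "- (g + x) + (g + y) = - x + y" for y by (simp add: minus_add add.assoc del: add_uminus_conv_diff)
  have "(z, u) \<in> shift g (chart x v)" if "(z, u) \<in> chart (g + x) v" for z u
  proof -
    have "z = g + (- g + z)" by (simp add: add.assoc[symmetric])
    then have "(- g + z, u) \<in> chart x v" using that e[of "- g + z"] by (simp add: chart_def)
    then show ?thesis unfolding shift_def using \<open>z = g + (- g + z)\<close> by force
  qed
  then show ?thesis by (auto simp: shift_def chart_def e)
qed

lemma Rep_reduced [simp]: "distinct_adj (Rep_rword x)" using Rep_rword by auto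

sublocale spinning_family len shift "\<lambda>Y. fst ` Y" charts \<theta>
proof -
  interpret tree_group len by (rule tree_group_rword)
  show "spinning_family len shift (\<lambda>Y. fst ` Y) charts \<theta>"
  proof
    fix Y Z :: "(rword \<times> 'v) set" and g h x y :: rword
    show "shift 0 Y = Y" by (simp add: shift_def)
    show "shift g (shift h Y) = shift (g + h) Y"
      by (auto simp: shift_def image_image add.assoc split_beta)
    show "fst ` shift g Y = (+) g ` fst ` Y" by (auto simp: shift_def image_image split_beta)
    show "2 \<le> \<theta>" by (rule theta)
    show "shift g Y \<in> charts" if "Y \<in> charts" using that shift_chart unfolding charts_def by blast
    show "fst ` Y \<noteq> {}" if "Y \<in> charts" using that chart_base unfolding charts_def by fastforce
    show "convex (fst ` Y)" if Y: "Y \<in> charts"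
      unfolding convex_def
    proof (intro ballI subsetI)
      fix y z t assume yz: "y \<in> fst ` Y" "z \<in> fst ` Y" and t: "t \<in> seg y z"
      obtain u u' where u: "(y, u) \<in> Y" "(z, u') \<in> Y" using yz by auto
      have Yc: "Y = chart y u" using charts_eq Y u by blast
      \<comment> \<open>Lengths add up at a point of the segment, so nothing cancels: the label from
        y to z is a concatenation and its run passes over t.\<close>
      have e: "- y + z = (- y + t) + (- t + z)" by (simp add: add.assoc)
      have "len (- y + z) = len (- y + t) + len (- t + z)" using t by (simp add: seg_def d_def)
      then have "Rep_rword (- y + z) = Rep_rword (- y + t) @ Rep_rword (- t + z)"
        unfolding e by transfer (rule mul_eq_append)
      then have "\<exists>s. run E u (Rep_rword (- y + t)) s" using u Yc by (auto simp: chart_def run_append)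
      then show "t \<in> fst ` Y" unfolding Yc chart_def by force
    qed
    show "d x y \<le> \<theta>" if YZ: "Y \<in> charts" "Z \<in> charts" "Y \<noteq> Z" "x \<in> fst ` Y \<inter> fst ` Z" "y \<in> fst ` Y \<inter> fst ` Z"
    proof -
      obtain u u' t t' where u: "(x, u) \<in> Y" "(x, u') \<in> Z" "(y, t) \<in> Y" "(y, t') \<in> Z" using YZ(4,5) by auto
      have c: "Y = chart x u" "Z = chart x u'" using charts_eq YZ u by auto
      then have "u \<noteq> u'" using YZ by auto
      then show ?thesis using pieces[of u "Rep_rword (- x + y)" t u' t'] u c
        by (simp add: chart_def d_def len.rep_eq)
    qed
    show "13 * \<theta> \<le> d x (g + x)" if Y: "Y \<in> charts" "shift g Y = Y" "g \<noteq> 0" "x \<in> fst ` Y"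
    proof -
      obtain u where u: "(x, u) \<in> Y" using Y by auto
      \<comment> \<open>A shift keeps the vertex component, so the label from x to g + x is read
        along a closed run at u.\<close>
      then have "(g + x, u) \<in> Y" using Y(2) unfolding shift_def by force
      then have "run E u (Rep_rword (- x + (g + x))) u" using charts_eq Y u by (auto simp: chart_def)
      moreover have "- x + (g + x) \<noteq> 0" using Y(3)
        by (metis add.assoc add_right_cancel add_0 add_left_cancel minus_add_cancel add_0_right)
      then have "Rep_rword (- x + (g + x)) \<noteq> []" using Rep_rword_inject zero_rword.rep_eq by metis
      ultimately show ?thesis using girth by (simp add: d_def len.rep_eq)
    qed
    show "\<exists>Y\<in>charts. x \<in> fst ` Y \<and> y \<in> fst ` Y" if "d x y \<le> 1"
    proof (cases "x = y")
      case True
      then show ?thesis using chart_base[of x] unfolding charts_def by force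
    next
      case False
      then have "length (Rep_rword (- x + y)) = 1" using that d_eq_0[of x y]
        by (cases "Rep_rword (- x + y)") (simp_all add: d_def len.rep_eq)
      then obtain c where c: "Rep_rword (- x + y) = [c]" by (auto simp: length_Suc_conv)
      obtain u v where "E c u v" using every_colour by blast
      then have "(y, v) \<in> chart x u" using c by (simp add: chart_def)
      then show ?thesis using chart_base[of x u] unfolding charts_def by force
    qed
  qed
qed

text \<open>The stabilizer of \<open>chart 0 v\<close> consists of the elements whose reduced words
  label closed runs at v, and shifts conjugate stabilizers. Hence this is the normal closure of the
  labels of closed runs.\<close>

definition rel :: "rword set" where "rel = gen (\<Union>(Stab ` charts))"

definition orb :: "rword \<Rightarrow> rword set" where "orb x = {n + x |n. n \<in> rel}"

lemma subgrp_rel: "subgrp rel"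
  unfolding rel_def
proof (rule subgrp_gen)
  fix s assume "s \<in> \<Union> (Stab ` charts)"
  then show "- s \<in> \<Union> (Stab ` charts)" using subgrp_Stab unfolding subgrp_def by blast
qed

lemma orb_eq_iff: "orb x = orb y \<longleftrightarrow> (\<exists>n\<in>rel. y = n + x)"
proof
  assume "orb x = orb y"
  moreover have "y \<in> orb y" unfolding orb_def using subgrp_rel by (auto simp: subgrp_def intro!: exI[of _ 0])
  ultimately show "\<exists>n\<in>rel. y = n + x" by (auto simp: orb_def)
next
  assume "\<exists>n\<in>rel. y = n + x"
  then obtain n where n: "n \<in> rel" "y = n + x" by auto
  have "m + x \<in> orb y" if "m \<in> rel" for m
  proof -
    have "m + x = (m + - n) + y" using n by (simp add: add.assoc[symmetric] del: add_uminus_conv_diff) (simp add: add.assoc)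
    moreover have "m + - n \<in> rel" using that n subgrp_rel unfolding subgrp_def by blast
    ultimately show ?thesis unfolding orb_def by blast
  qed
  moreover have "m + y \<in> orb x" if "m \<in> rel" for m
    using that n subgrp_rel unfolding orb_def subgrp_def by (auto simp: add.assoc[symmetric])
  ultimately show "orb x = orb y" by (auto simp: orb_def)
qed

definition letter :: "nat \<Rightarrow> rword" where "letter c = Abs_rword [c]"

lemma Rep_letter: "Rep_rword (letter c) = [c]" by (simp add: letter_def Abs_rword_inverse)

lemma letter_letter: "letter c + letter c = 0"
proof -
  have "Rep_rword (letter c + letter c) = Rep_rword 0"
    by (simp add: plus_rword.rep_eq Rep_letter zero_rword.rep_eq)
  then show ?thesis by (simp add: Rep_rword_inject)
qed

text \<open>Right multiplication by a letter in the quotient by \<open>rel\<close>, whose elements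
  are the sets \<open>orb x\<close>. Other sets are fixed, which makes it an involution of the whole
  type.\<close>

definition perm :: "nat \<Rightarrow> rword set \<Rightarrow> rword set" where
  "perm c S = (if S \<in> range orb then (\<lambda>x. x + letter c) ` S else S)"

lemma perm_orb: "perm c (orb x) = orb (x + letter c)"
proof -
  have "(\<lambda>y. y + letter c) ` orb x = orb (x + letter c)"
    unfolding orb_def by (auto simp: add.assoc image_iff) (metis add.assoc)
  then show ?thesis by (simp add: perm_def)
qed

lemma perm_perm: "perm c (perm c S) = S"
proof (cases "S \<in> range orb")
  case True
  then obtain x where "S = orb x" by auto
  then show ?thesis by (simp add: perm_orb add.assoc letter_letter)
qed (simp add: perm_def)

definition wd :: "nat list \<Rightarrow> rword" where "wd ws = foldr (\<lambda>c. (+) (letter c)) ws 0"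

lemma fold_perm_orb: "fold perm ws (orb x) = orb (x + wd ws)"
  by (induction ws arbitrary: x) (auto simp: wd_def perm_orb add.assoc)

lemma fold_perm_other: "S \<notin> range orb \<Longrightarrow> fold perm ws S = S"
  by (induction ws) (auto simp: perm_def)

lemma run_wd: "run E v ws u \<Longrightarrow> run E v (Rep_rword (wd ws)) u"
proof (induction ws arbitrary: v)
  case Nil
  then show ?case by (simp add: wd_def zero_rword.rep_eq)
next
  case (Cons c ws)
  then obtain v' where v': "E c v v'" "run E v' ws u" by auto
  have "Rep_rword (wd (c # ws)) = lmul c (Rep_rword (wd ws))"
    by (simp add: wd_def plus_rword.rep_eq Rep_letter)
  then show ?case using run_lmul[OF v'(1)] Cons.IH[OF v'(2)] by simp
qed

lemma run_chart: "run E v ws u \<Longrightarrow> (x + wd ws, u) \<in> chart x v"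
  using run_wd by (simp add: chart_def)

text \<open>If the ends agree, the two words differ by a stabilizer of the lifted component, which
  is a relator. Conversely, a relator that moves a point of a chart to a point of the same chart
  stabilizes that chart by the rotation theorem, and shifts preserve vertices.\<close>

theorem fold_perm_eq_iff:
  assumes "run E v ws u" "run E v ws' u'"
  shows "fold perm ws = fold perm ws' \<longleftrightarrow> u = u'"
proof
  assume "u = u'"
  have "orb (x + wd ws) = orb (x + wd ws')" for x
  proof -
    let ?y = "x + wd ws" and ?y' = "x + wd ws'"
    have Y: "chart x v = chart ?y u" "chart x v = chart ?y' u"
      using chart_eq run_chart assms \<open>u = u'\<close> by metis+
    have "?y' + - ?y + ?y = ?y'" by (simp add: add.assoc)
    then have "shift (?y' + - ?y) (chart x v) = chart x v" using Y shift_chart by metis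
    then have "?y' + - ?y \<in> Stab (chart x v)" by (simp add: Stab_def)
    then have "?y' + - ?y \<in> rel" unfolding rel_def charts_def by (intro gen_incl) blast
    then show ?thesis unfolding orb_eq_iff using \<open>?y' + - ?y + ?y = ?y'\<close> by metis
  qed
  then have "fold perm ws S = fold perm ws' S" for S
    using fold_perm_orb fold_perm_other by (cases "S \<in> range orb") auto
  then show "fold perm ws = fold perm ws'" by blast
next
  assume "fold perm ws = fold perm ws'"
  then have "orb (wd ws) = orb (wd ws')" using fold_perm_orb[of ws 0] fold_perm_orb[of ws' 0] by simp
  then obtain n where n: "n \<in> rel" "wd ws' = n + wd ws" unfolding orb_eq_iff by blast
  let ?Y = "chart 0 v"
  have m: "(wd ws, u) \<in> ?Y" "(wd ws', u') \<in> ?Y" using run_chart[of v _ _ 0] assms by auto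
  have "?Y \<in> charts" by (auto simp: charts_def)
  then have "shift n ?Y = ?Y"
    using rotation_subgroup_stabilizer[of ?Y n "wd ws"] n m unfolding rel_def by force
  then have "(n + wd ws, u) \<in> ?Y" using m(1) unfolding shift_def by force
  then show "u = u'" using chart_functional m(2) n by metis
qed

end

section \<open>Folding a path\<close>

text \<open>The pair \<open>(i, b)\<close> is the edge between the positions \<open>i\<close> and \<open>Suc i\<close> of a path, traversed
  forwards if \<open>b\<close> holds. A map \<open>r\<close> on positions folds the path.\<close>

type_synonym move = "nat \<times> bool"

definition src :: "(nat \<Rightarrow> 'v) \<Rightarrow> move \<Rightarrow> 'v" where "src r s = r (if snd s then fst s else Suc (fst s))"
definition dst :: "(nat \<Rightarrow> 'v) \<Rightarrow> move \<Rightarrow> 'v" where "dst r s = r (if snd s then Suc (fst s) else fst s)"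

primrec walk :: "nat \<Rightarrow> (nat \<Rightarrow> 'v) \<Rightarrow> 'v \<Rightarrow> move list \<Rightarrow> 'v \<Rightarrow> bool" where
  "walk n r x [] y \<longleftrightarrow> x = y"
| "walk n r x (s # ws) y \<longleftrightarrow> Suc (fst s) < n \<and> src r s = x \<and> walk n r (dst r s) ws y"

text \<open>Backtracking is judged by edge indices of the unfolded path, so two edges folded onto
  the same pair of vertices already form a cycle of length 2.\<close>

definition girth_ge :: "nat \<Rightarrow> (nat \<Rightarrow> 'v) \<Rightarrow> nat \<Rightarrow> bool" where
  "girth_ge n r g \<longleftrightarrow> (\<forall>x ws. walk n r x ws x \<longrightarrow> distinct_adj (map fst ws) \<longrightarrow> ws \<noteq> [] \<longrightarrow> g \<le> length ws)"

lemma girth_geD: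
  "\<lbrakk>girth_ge n r g; walk n r x ws x; distinct_adj (map fst ws); ws \<noteq> []\<rbrakk> \<Longrightarrow> g \<le> length ws"
  by (simp add: girth_ge_def)

lemma walk_append: "walk n r x (us @ vs) y \<longleftrightarrow> (\<exists>z. walk n r x us z \<and> walk n r z vs y)"
  by (induction us arbitrary: x) auto

definition rev_move :: "move \<Rightarrow> move" where "rev_move s = (fst s, \<not> snd s)"

lemma walk_rev: "walk n r x ws y \<Longrightarrow> walk n r y (rev (map rev_move ws)) x"
  by (induction ws arbitrary: x) (auto simp: walk_append rev_move_def src_def dst_def)

lemma walk_id_monotone:
  "\<lbrakk>walk n id x (s # ws) y; distinct_adj (map fst (s # ws))\<rbrakk> \<Longrightarrow>
    (if snd s then y = x + Suc (length ws) else x = y + Suc (length ws))"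
proof (induction ws arbitrary: x s)
  case Nil
  then show ?case by (auto simp: src_def dst_def split: if_splits)
next
  case (Cons s' ws)
  have w: "walk n id (dst id s) (s' # ws) y" "src id s = x" "src id s' = dst id s"
    using Cons.prems(1) unfolding walk.simps by blast+
  have w2: "distinct_adj (map fst (s' # ws))" "fst s \<noteq> fst s'" using Cons.prems(2) by simp_all
  have IH: "if snd s' then y = dst id s + Suc (length ws) else dst id s = y + Suc (length ws)"
    by (rule Cons.IH[OF w(1) w2(1)])
  show ?case using IH w(2,3) w2(2) by (auto simp: src_def dst_def split: if_splits)
qed

lemma girth_id: "girth_ge n id g"
  unfolding girth_ge_def
proof (intro allI impI)
  fix x ws assume "walk n id x ws x" "distinct_adj (map fst ws)" "ws \<noteq> []"
  then obtain s ws' where "ws = s # ws'" "walk n id x (s # ws') x" "distinct_adj (map fst (s # ws'))"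
    by (metis list.exhaust)
  then show "g \<le> length ws" using walk_id_monotone[of n x s ws' x] by (auto split: if_splits)
qed

section \<open>Girth under the identification of two vertices\<close>

context
  fixes n :: nat and r :: "nat \<Rightarrow> 'v" and a b :: 'v and f :: "'v \<Rightarrow> 'v"
  assumes ab: "a \<noteq> b" and f: "f = (\<lambda>x. if x = a then b else x)"
begin

text \<open>A walk in the quotient is cut at its first jump between a and b; up to there it is a
  walk before the identification.\<close>

lemma walk_identify_split:
  "\<lbrakk>walk n (f \<circ> r) x ws y; ws \<noteq> []\<rbrakk> \<Longrightarrow>
     (\<exists>y0. walk n r (src r (hd ws)) ws y0 \<and> f y0 = y) \<or>
     (\<exists>us vs z. ws = us @ vs \<and> us \<noteq> [] \<and> vs \<noteq> [] \<and> walk n r (src r (hd ws)) us z \<and> z \<in> {a, b} \<and>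
        src r (hd vs) \<in> {a, b} \<and> src r (hd vs) \<noteq> z \<and> walk n (f \<circ> r) b vs y)"
proof (induction ws arbitrary: x)
  case (Cons s ws)
  show ?case
  proof (cases ws)
    case Nil
    then show ?thesis using Cons.prems by (auto simp: dst_def)
  next
    case (Cons s' ws')
    have w: "Suc (fst s) < n" "walk n (f \<circ> r) (dst (f \<circ> r) s) ws y" "src (f \<circ> r) s' = dst (f \<circ> r) s"
      using Cons.prems(1) unfolding Cons walk.simps by blast+
    have w3: "f (src r s') = f (dst r s)" using w(3) by (simp add: src_def dst_def)
    show ?thesis
    proof (cases "dst r s = src r s'")
      case True
      have ne: "ws \<noteq> []" and hd: "src r (hd ws) = dst r s" using Cons True by simp_all
      have ext: "walk n r (src r (hd (s # ws))) (s # us) z" if "walk n r (src r (hd ws)) us z" for us z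
        using that w(1) hd by simp
      show ?thesis using Cons.IH[OF w(2) ne]
      proof (elim disjE exE conjE)
        fix y0 assume "walk n r (src r (hd ws)) ws y0" "f y0 = y"
        then show ?thesis using ext by blast
      next
        fix us vs z
        assume a: "ws = us @ vs" "us \<noteq> []" "vs \<noteq> []" "walk n r (src r (hd ws)) us z" "z \<in> {a, b}"
          "src r (hd vs) \<in> {a, b}" "src r (hd vs) \<noteq> z" "walk n (f \<circ> r) b vs y"
        then have "s # ws = (s # us) @ vs" "s # us \<noteq> []" by simp_all
        then show ?thesis using ext[OF a(4)] a(3,5-8) by blast
      qed
    next
      case False
      then have "dst r s \<in> {a, b}" "src r s' \<in> {a, b}" "f (dst r s) = b"
        using w3 by (auto simp: f split: if_splits)
      moreover have "dst (f \<circ> r) s = f (dst r s)" by (simp add: dst_def)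
      ultimately have "walk n (f \<circ> r) b ws y" using w(2) by metis
      moreover have "s # ws = [s] @ ws" "[s] \<noteq> []" "ws \<noteq> []" "src r (hd ws) = src r s'"
        "walk n r (src r (hd (s # ws))) [s] (dst r s)" using w(1) Cons by simp_all
      ultimately show ?thesis
        using False \<open>dst r s \<in> {a, b}\<close> \<open>src r s' \<in> {a, b}\<close> by metis
    qed
  qed
qed simp

text \<open>Suppose a closed walk is too short. Without a jump it was closed before or joins a to b.
  With one jump, starting the closed walk at the jump turns it into a walk from a to b, unless its
  first part already runs between points of {a, b}. With two jumps the part between them does so.
  All of this is excluded by \<open>no\<close>.\<close>

lemma girth_identify:
  assumes g: "girth_ge n r g" and far: "\<And>ws. walk n r a ws b \<Longrightarrow> g \<le> length ws"
  shows "girth_ge n (f \<circ> r) g"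
  unfolding girth_ge_def
proof (intro allI impI, rule ccontr)
  fix x ws assume ws: "walk n (f \<circ> r) x ws x" "distinct_adj (map fst ws)" "ws \<noteq> []" and "\<not> g \<le> length ws"
  then have short: "length ws < g" by simp
  have no: False if wz: "walk n r z us z'" "z \<in> {a, b}" "z' \<in> {a, b}" "length us < g"
    "z \<noteq> z' \<or> distinct_adj (map fst us) \<and> us \<noteq> []" for z z' us
  proof (cases "z = z'")
    case True
    then have "walk n r z us z" "distinct_adj (map fst us)" "us \<noteq> []" using that(1,5) by simp_all
    then have "g \<le> length us" by (rule girth_geD[OF g])
    then show False using that(4) by simp
  next
    case False
    then consider "z = a" "z' = b" | "z = b" "z' = a" using wz(2,3) by blast
    then have "g \<le> length us"
    proof cases
      case 1
      then show ?thesis using far that(1) by blast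
    next
      case 2
      then have "walk n r a (rev (map rev_move us)) b" using walk_rev[OF that(1)] by simp
      then have "g \<le> length (rev (map rev_move us))" by (rule far)
      then show ?thesis by simp
    qed
    then show False using that(4) by simp
  qed
  let ?x0 = "src r (hd ws)"
  have fx: "f ?x0 = x" using ws(1,3) by (cases ws) (simp_all add: src_def)
  show False
  proof (rule disjE[OF walk_identify_split[OF ws(1,3)]])
    assume "\<exists>y0. walk n r ?x0 ws y0 \<and> f y0 = x"
    then obtain y0 where y0: "walk n r ?x0 ws y0" "f y0 = x" by blast
    show False
    proof (cases "?x0 = y0")
      case True
      then have "walk n r y0 ws y0" using y0(1) by simp
      then have "g \<le> length ws" using ws(2,3) by (rule girth_geD[OF g])
      then show False using short by simp
    next
      case False
      then have "?x0 \<in> {a, b}" "y0 \<in> {a, b}" using fx y0 by (auto simp: f split: if_splits)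
      then show False using no[OF y0(1)] short False by blast
    qed
  next
    assume "\<exists>us vs z. ws = us @ vs \<and> us \<noteq> [] \<and> vs \<noteq> [] \<and> walk n r (src r (hd ws)) us z \<and> z \<in> {a, b} \<and>
        src r (hd vs) \<in> {a, b} \<and> src r (hd vs) \<noteq> z \<and> walk n (f \<circ> r) b vs x"
    then obtain us vs z where uv: "ws = us @ vs" "us \<noteq> []" "vs \<noteq> []" "walk n r ?x0 us z" "z \<in> {a, b}"
      "src r (hd vs) \<in> {a, b}" "src r (hd vs) \<noteq> z" "walk n (f \<circ> r) b vs x" by blast
    have da: "distinct_adj (map fst us)" "distinct_adj (map fst vs)"
      using ws(2) uv(1) by (simp_all add: distinct_adj_append_iff)
    show False
    proof (rule disjE[OF walk_identify_split[OF uv(8,3)]])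
      assume "\<exists>y0. walk n r (src r (hd vs)) vs y0 \<and> f y0 = x"
      then obtain y0 where y0: "walk n r (src r (hd vs)) vs y0" "f y0 = x" by blast
      show False
      proof (cases "?x0 = y0")
        case True
        then have "walk n r (src r (hd vs)) (vs @ us) z" using y0(1) uv(4) unfolding walk_append by blast
        moreover have "length (vs @ us) < g" using short uv(1) by simp
        ultimately show False using no[OF _ uv(6,5)] uv(7) by blast
      next
        case False
        then have "?x0 \<in> {a, b}" using fx y0 by (auto simp: f split: if_splits)
        moreover have "length us < g" using short uv(1) by simp
        ultimately show False using no[OF uv(4) _ uv(5)] da(1) uv(2) by blast
      qed
    next
      assume "\<exists>us' vs' z'. vs = us' @ vs' \<and> us' \<noteq> [] \<and> vs' \<noteq> [] \<and> walk n r (src r (hd vs)) us' z' \<and>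
        z' \<in> {a, b} \<and> src r (hd vs') \<in> {a, b} \<and> src r (hd vs') \<noteq> z' \<and> walk n (f \<circ> r) b vs' x"
      then obtain us' vs' z' where u': "vs = us' @ vs'" "us' \<noteq> []" "walk n r (src r (hd vs)) us' z'" "z' \<in> {a, b}"
        by blast
      have "distinct_adj (map fst us')" using da(2) u'(1) by (simp add: distinct_adj_append_iff)
      moreover have "length us' < g" using short uv(1) u'(1) by simp
      ultimately show False using no[OF u'(3) uv(6) u'(4)] u'(2) by blast
    qed
  qed
qed

end

section \<open>Greedy choice of the identifications\<close>

definition glue :: "(nat \<Rightarrow> nat) \<Rightarrow> nat \<Rightarrow> nat \<Rightarrow> nat" where "glue \<sigma> t i = (if i < t then \<sigma> i else i)"

lemma card_fibre:
  assumes "inj_on \<sigma> {..<t}" shows "finite {p. glue \<sigma> t p = y}" "card {p. glue \<sigma> t p = y} \<le> 2"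
proof -
  have sub: "{p. glue \<sigma> t p = y} \<subseteq> insert y {p \<in> {..<t}. \<sigma> p = y}" by (auto simp: glue_def)
  have "card {p \<in> {..<t}. \<sigma> p = y} \<le> Suc 0"
    by (subst card_le_Suc0_iff_eq) (use assms in \<open>auto dest: inj_onD\<close>)
  then have c: "card (insert y {p \<in> {..<t}. \<sigma> p = y}) \<le> 2" by (simp add: card_insert_if)
  show "finite {p. glue \<sigma> t p = y}" using sub by (rule finite_subset) simp
  show "card {p. glue \<sigma> t p = y} \<le> 2" using card_mono[OF _ sub] c by simp
qed

lemma card_moves:
  assumes "inj_on \<sigma> {..<t}" shows "finite {s. src (glue \<sigma> t) s = y}" "card {s. src (glue \<sigma> t) s = y} \<le> 4"
proof -
  let ?S = "{p. glue \<sigma> t p = y} \<times> (UNIV :: bool set)"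
  have "s \<in> (\<lambda>(p, b). (if b then p else p - 1, b)) ` ?S" if "src (glue \<sigma> t) s = y" for s
    using that by (intro image_eqI[of _ _ "(if snd s then fst s else Suc (fst s), snd s)"])
      (auto simp: src_def prod_eq_iff)
  then have sub: "{s. src (glue \<sigma> t) s = y} \<subseteq> (\<lambda>(p, b). (if b then p else p - 1, b)) ` ?S" by blast
  have fin: "finite ?S" using card_fibre[OF assms] by simp
  show "finite {s. src (glue \<sigma> t) s = y}" using finite_subset[OF sub] fin by blast
  have "card ?S \<le> 4" using card_fibre(2)[OF assms, of y] by (simp add: card_cartesian_product)
  then show "card {s. src (glue \<sigma> t) s = y} \<le> 4"
    using card_mono[OF finite_imageI[OF fin] sub] card_image_le[OF fin] le_trans by blast
qed

lemma card_walks: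
  assumes "inj_on \<sigma> {..<t}"
  shows "finite {ws. length ws = k \<and> (\<exists>y. walk n (glue \<sigma> t) x ws y)} \<and>
     card {ws. length ws = k \<and> (\<exists>y. walk n (glue \<sigma> t) x ws y)} \<le> 4 ^ k"
proof (induction k arbitrary: x)
  case 0
  have "{ws. length ws = 0 \<and> (\<exists>y. walk n (glue \<sigma> t) x ws y)} = {[]}" by auto
  then show ?case by simp
next
  case (Suc k)
  let ?W = "\<lambda>k x. {ws. length ws = k \<and> (\<exists>y. walk n (glue \<sigma> t) x ws y)}"
  let ?S = "{s. src (glue \<sigma> t) s = x}"
  let ?U = "\<Union>s\<in>?S. (#) s ` ?W k (dst (glue \<sigma> t) s)"
  have sub: "?W (Suc k) x \<subseteq> ?U"
  proof clarify
    fix ws y assume "length ws = Suc k" "walk n (glue \<sigma> t) x ws y"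
    then obtain s ws' where "ws = s # ws'" "s \<in> ?S" "ws' \<in> ?W k (dst (glue \<sigma> t) s)"
      by (cases ws) auto
    then show "ws \<in> ?U" by blast
  qed
  have fin: "finite ?U" using card_moves(1)[OF assms] Suc.IH by blast
  have "card ?U \<le> (\<Sum>s\<in>?S. card ((#) s ` ?W k (dst (glue \<sigma> t) s)))"
    by (rule card_UN_le) (rule card_moves(1)[OF assms])
  also have "\<dots> \<le> (\<Sum>s\<in>?S. 4 ^ k)"
    by (rule sum_mono) (use Suc.IH card_image_le le_trans in blast)
  also have "\<dots> \<le> 4 * 4 ^ k" using card_moves(2)[OF assms, of x] by simp
  finally show ?case using finite_subset[OF sub fin] card_mono[OF fin sub] by simp
qed

lemma card_ball:
  assumes "inj_on \<sigma> {..<t}"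
  shows "finite {y. \<exists>ws. length ws < g \<and> walk n (glue \<sigma> t) x ws y} \<and>
     card {y. \<exists>ws. length ws < g \<and> walk n (glue \<sigma> t) x ws y} \<le> 4 ^ g"
proof -
  let ?W = "\<lambda>k. {ws. length ws = k \<and> (\<exists>y. walk n (glue \<sigma> t) x ws y)}"
  let ?e = "\<lambda>ws. THE y. walk n (glue \<sigma> t) x ws y"
  have det: "y = y'" if "walk n (glue \<sigma> t) x ws y" "walk n (glue \<sigma> t) x ws y'" for x y y' ws
    using that by (induction ws arbitrary: x) auto
  let ?U = "\<Union>k<g. ?e ` ?W k"
  have sub: "{y. \<exists>ws. length ws < g \<and> walk n (glue \<sigma> t) x ws y} \<subseteq> ?U"
  proof clarify
    fix y ws assume w: "length ws < g" "walk n (glue \<sigma> t) x ws y"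
    then have "?e ws = y" using det by blast
    then show "y \<in> ?U" using w by force
  qed
  have fin: "finite ?U" using card_walks[OF assms] by blast
  have "card ?U \<le> (\<Sum>k<g. card (?e ` ?W k))" by (rule card_UN_le) simp
  also have "\<dots> \<le> (\<Sum>k<g. 4 ^ k)"
    by (rule sum_mono) (use card_walks[OF assms] card_image_le le_trans in blast)
  also have "\<dots> \<le> 4 ^ g" by (induction g) auto
  finally show ?thesis using finite_subset[OF sub fin] card_mono[OF fin sub] by simp
qed

text \<open>Every new identification \<open>t \<sim> j\<close> is chosen among the many admissible \<open>j\<close> so as to be
  respected by at most the average number of the relations \<open>R a\<close> that respect the earlier ones.\<close>

lemma greedy_gluing:
  fixes R :: "'a \<Rightarrow> nat \<Rightarrow> nat \<Rightarrow> bool" and g M :: nat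
  defines "K \<equiv> 4 ^ Suc g" and "m \<equiv> 4 * 4 ^ Suc g"
  assumes A: "finite A" and RM: "\<And>a i. a \<in> A \<Longrightarrow> card {j. j < 4 * m \<and> R a i j} \<le> M"
  assumes "t \<le> m"
  shows "\<exists>\<sigma>. inj_on \<sigma> {..<t} \<and> \<sigma> ` {..<t} \<subseteq> {2 * m..<4 * m} \<and> girth_ge (4 * m) (glue \<sigma> t) g \<and>
     card {a \<in> A. \<forall>i<t. R a i (\<sigma> i)} * K ^ t \<le> M ^ t * card A"
  using \<open>t \<le> m\<close>
proof (induction t)
  case 0
  have "glue (\<lambda>_. 0) 0 = id" by (auto simp: glue_def)
  then have "girth_ge (4 * m) (glue (\<lambda>_. 0) 0) g" using girth_id by metis
  then show ?case by (intro exI[of _ "\<lambda>_. 0"]) simp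
next
  case (Suc t)
  then obtain \<sigma> where s: "inj_on \<sigma> {..<t}" "\<sigma> ` {..<t} \<subseteq> {2 * m..<4 * m}" "girth_ge (4 * m) (glue \<sigma> t) g"
    "card {a \<in> A. \<forall>i<t. R a i (\<sigma> i)} * K ^ t \<le> M ^ t * card A" by auto
  let ?At = "{a \<in> A. \<forall>i<t. R a i (\<sigma> i)}"
  let ?ball = "{y. \<exists>ws. length ws < g \<and> walk (4 * m) (glue \<sigma> t) t ws y}"
  define C where "C = {2 * m..<4 * m} - (\<sigma> ` {..<t} \<union> ?ball)"
  have finC: "finite C" by (simp add: C_def)
  have "card (\<sigma> ` {..<t} \<union> ?ball) \<le> card (\<sigma> ` {..<t}) + card ?ball" by (rule card_Un_le)
  also have "\<dots> \<le> m + 4 ^ g"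
    using card_ball[OF s(1), of g "4 * m" t] card_image_le[of "{..<t}" \<sigma>] Suc.prems by simp
  finally have "card (\<sigma> ` {..<t} \<union> ?ball) \<le> m + 4 ^ g" .
  moreover have "card {2 * m..<4 * m} - card (\<sigma> ` {..<t} \<union> ?ball) \<le> card C"
    unfolding C_def using card_ball[OF s(1), of g "4 * m" t] by (intro diff_card_le_card_Diff) simp
  \<comment> \<open>Of 2 * m targets fewer than m are taken and at most 4 ^ g are too close to t,
    which leaves at least m - 4 ^ g = 15 * 4 ^ g, more than K = 4 * 4 ^ g.\<close>
  ultimately have KC: "K \<le> card C" by (simp add: m_def K_def)
  have "\<exists>j\<in>C. K * card {a \<in> ?At. R a t j} \<le> M * card ?At"
  proof (rule ccontr)
    assume neg: "\<not> ?thesis"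
    have "C \<noteq> {}" using KC by (auto simp: K_def)
    have "(\<Sum>j\<in>C. card {a \<in> ?At. R a t j}) = (\<Sum>a\<in>?At. card {j \<in> C. R a t j})"
      using A finC by (intro sum_multicount_gen) auto
    also have "\<dots> \<le> (\<Sum>a\<in>?At. M)"
    proof (rule sum_mono)
      fix a assume a: "a \<in> ?At"
      have "card {j \<in> C. R a t j} \<le> card {j. j < 4 * m \<and> R a t j}"
        by (rule card_mono) (auto simp: C_def)
      then show "card {j \<in> C. R a t j} \<le> M" using RM[of a t] a by simp
    qed
    finally have le: "(\<Sum>j\<in>C. card {a \<in> ?At. R a t j}) \<le> M * card ?At" by (simp add: mult.commute)
    have "(\<Sum>j\<in>C. M * card ?At) < (\<Sum>j\<in>C. K * card {a \<in> ?At. R a t j})"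
      by (rule sum_strict_mono) (use neg finC \<open>C \<noteq> {}\<close> in \<open>auto simp: not_le\<close>)
    also have "\<dots> \<le> K * (M * card ?At)" using le by (simp add: sum_distrib_left[symmetric])
    also have "\<dots> \<le> card C * (M * card ?At)" using KC by simp
    finally show False by simp
  qed
  then obtain j where j: "j \<in> C" "K * card {a \<in> ?At. R a t j} \<le> M * card ?At" by blast
  let ?\<sigma> = "\<sigma>(t := j)"
  have 1: "inj_on ?\<sigma> {..<Suc t}" using s(1) j(1) by (auto simp: inj_on_def C_def less_Suc_eq)
  have 2: "?\<sigma> ` {..<Suc t} \<subseteq> {2 * m..<4 * m}" using s(2) j(1) by (auto simp: C_def less_Suc_eq)
  have tj: "t \<noteq> j" using j(1) Suc.prems unfolding C_def by auto
  have ne: "\<sigma> i \<noteq> t" if "i < t" for i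
  proof -
    have "2 * m \<le> \<sigma> i" using s(2) that by auto
    then show ?thesis using Suc.prems by linarith
  qed
  have "glue ?\<sigma> (Suc t) = (\<lambda>x. if x = t then j else x) \<circ> glue \<sigma> t"
  proof
    fix i show "glue ?\<sigma> (Suc t) i = ((\<lambda>x. if x = t then j else x) \<circ> glue \<sigma> t) i"
      using ne by (auto simp: glue_def less_Suc_eq)
  qed
  moreover have "girth_ge (4 * m) ((\<lambda>x. if x = t then j else x) \<circ> glue \<sigma> t) g"
  proof (rule girth_identify[OF tj refl s(3)])
    fix ws assume "walk (4 * m) (glue \<sigma> t) t ws j"
    then have "j \<in> ?ball" if "length ws < g" using that by blast
    then show "g \<le> length ws" using j(1) not_le unfolding C_def by blast
  qed
  ultimately have 3: "girth_ge (4 * m) (glue ?\<sigma> (Suc t)) g" by simp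
  have "{a \<in> A. \<forall>i<Suc t. R a i (?\<sigma> i)} = {a \<in> ?At. R a t j}" by (auto simp: less_Suc_eq)
  moreover have "card {a \<in> ?At. R a t j} * K ^ Suc t \<le> M ^ Suc t * card A"
  proof -
    have "card {a \<in> ?At. R a t j} * K ^ Suc t = (K * card {a \<in> ?At. R a t j}) * K ^ t" by simp
    also have "\<dots> \<le> (M * card ?At) * K ^ t" using j(2) by (rule mult_right_mono) simp
    also have "\<dots> \<le> M * (M ^ t * card A)" using s(4) by (simp add: mult.assoc)
    finally show ?thesis by (simp add: mult.assoc)
  qed
  ultimately have "card {a \<in> A. \<forall>i<Suc t. R a i (?\<sigma> i)} * K ^ Suc t \<le> M ^ Suc t * card A" by simp
  with 1 2 3 show ?case by blast
qed

section \<open>Small cancellation colourings\<close>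

text \<open>Join i to j if \<open>e j = e' i\<close> or \<open>e' j = e i\<close>. By injectivity
  every i has at most two neighbours, so repeatedly taking an index and discarding its neighbours
  keeps a third.\<close>

lemma independent_subset:
  fixes e e' :: "'a \<Rightarrow> 'b"
  assumes "finite J" "inj_on e J" "inj_on e' J" "\<forall>i\<in>J. e i \<noteq> e' i"
  shows "\<exists>I\<subseteq>J. card J \<le> 3 * card I \<and> e ` I \<inter> e' ` I = {}"
  using assms
proof (induction J rule: finite_psubset_induct)
  case (psubset J)
  show ?case
  proof (cases "J = {}")
    case False
    then obtain i where i: "i \<in> J" by blast
    let ?X = "insert i ({j \<in> J. e j = e' i} \<union> {j \<in> J. e' j = e i})"
    let ?J = "J - ?X"
    have le1: "card {j \<in> J. f j = y} \<le> 1" if "inj_on f J" for f :: "'a \<Rightarrow> 'b" and y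
      unfolding One_nat_def
      by (subst card_le_Suc0_iff_eq) (use psubset.hyps(1) that in \<open>auto simp: inj_on_def\<close>)
    note c1 = le1[OF psubset.prems(1), of "e' i"] le1[OF psubset.prems(2), of "e i"]
    have "card ?X \<le> 3"
      using card_Un_le[of "{j \<in> J. e j = e' i}" "{j \<in> J. e' j = e i}"] c1 psubset.hyps(1)
      by (simp add: card_insert_if)
    moreover have "card J - card ?X \<le> card ?J" using psubset.hyps(1) by (intro diff_card_le_card_Diff) auto
    ultimately have cJ: "card J \<le> card ?J + 3" by simp
    have "?J \<subset> J" using i by blast
    moreover have "inj_on e ?J" "inj_on e' ?J" using psubset.prems by (auto simp: inj_on_def)
    ultimately obtain I where I: "I \<subseteq> ?J" "card ?J \<le> 3 * card I" "e ` I \<inter> e' ` I = {}"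
      using psubset.IH[of ?J] psubset.prems(3) by blast
    have fI: "finite I" "i \<notin> I" using I(1) psubset.hyps(1) finite_subset by blast+
    have "e ` insert i I \<inter> e' ` insert i I = {}" using I(1,3) i psubset.prems(3) by auto
    then show ?thesis using I(1,2) i cJ fI by (intro exI[of _ "insert i I"]) auto
  qed auto
qed

lemma walk_nth:
  assumes "walk n r x ws y"
  shows "i < length ws \<Longrightarrow> Suc (fst (ws ! i)) < n"
    and "Suc i < length ws \<Longrightarrow> dst r (ws ! i) = src r (ws ! Suc i)"
    and "i < j \<Longrightarrow> j \<le> length ws \<Longrightarrow> walk n r (src r (ws ! i)) (take (j - i) (drop i ws)) (dst r (ws ! (j - 1)))"
proof -
  show 1: "i < length ws \<Longrightarrow> Suc (fst (ws ! i)) < n" for i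
    using assms by (induction ws arbitrary: x i) (auto simp: nth_Cons split: nat.splits)
  show 2: "Suc i < length ws \<Longrightarrow> dst r (ws ! i) = src r (ws ! Suc i)" for i
    using assms
  proof (induction ws arbitrary: x i)
    case (Cons s ws)
    then show ?case by (cases i; cases ws) auto
  qed simp
  show "i < j \<Longrightarrow> j \<le> length ws \<Longrightarrow> walk n r (src r (ws ! i)) (take (j - i) (drop i ws)) (dst r (ws ! (j - 1)))"
  proof (induction "j - i" arbitrary: i)
    case (Suc k)
    have d: "drop i ws = ws ! i # drop (Suc i) ws" using Suc.prems by (simp add: Cons_nth_drop_Suc)
    show ?case
    proof (cases "j = Suc i")
      case True
      then show ?thesis using d 1[of i] Suc.prems by simp
    next
      case False
      then have "walk n r (src r (ws ! Suc i)) (take (j - Suc i) (drop (Suc i) ws)) (dst r (ws ! (j - 1)))"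
        using Suc by simp
      moreover have "dst r (ws ! i) = src r (ws ! Suc i)" using 2[of i] Suc.prems False by simp
      moreover have "take (j - i) (drop i ws) = ws ! i # take (j - Suc i) (drop (Suc i) ws)"
        unfolding d using Suc.prems by (simp add: Suc_diff_Suc[symmetric] take_Suc_Cons)
      ultimately show ?thesis using 1[of i] Suc.prems by simp
    qed
  qed simp
qed

lemma distinct_adj_sub: "distinct_adj xs \<Longrightarrow> distinct_adj (take k (drop i xs))"
  by (metis append_take_drop_id distinct_adj_append_iff)

lemma rev_move_simps [simp]: "src r (rev_move s) = dst r s" "dst r (rev_move s) = src r s"
  "fst (rev_move s) = fst s" "rev_move (rev_move s) = s"
  by (auto simp: src_def dst_def rev_move_def)

lemma move_cases: "fst s = fst s' \<Longrightarrow> s' = s \<or> s' = rev_move s"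
  by (cases s; cases s') (auto simp: rev_move_def)

text \<open>A repeated edge would yield a closed walk shorter than g without backtracking: from one
  passage to the next if the directions agree, and the part strictly between them if they are
  opposite.\<close>

lemma short_walk_distinct:
  assumes g: "girth_ge n r g" and w: "walk n r x ws y" "distinct_adj (map fst ws)" "length ws < g"
  shows "distinct (map fst ws)"
proof -
  have "fst (ws ! i) \<noteq> fst (ws ! j)" if ij: "i < j" "j < length ws" for i j
  proof
    assume eq: "fst (ws ! i) = fst (ws ! j)"
    show False
    proof (rule disjE[OF move_cases[OF eq]])
      assume "ws ! j = ws ! i"
      moreover have "dst r (ws ! (j - 1)) = src r (ws ! j)" using walk_nth(2)[OF w(1), of "j - 1"] ij by simp
      ultimately have "walk n r (src r (ws ! i)) (take (j - i) (drop i ws)) (src r (ws ! i))"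
        using walk_nth(3)[OF w(1), of i j] ij by simp
      moreover have "distinct_adj (map fst (take (j - i) (drop i ws)))"
        using distinct_adj_sub[OF w(2)] by (simp add: take_map drop_map)
      moreover have "take (j - i) (drop i ws) \<noteq> []" using ij by simp
      ultimately have "g \<le> length (take (j - i) (drop i ws))" by (rule girth_geD[OF g])
      then show False using ij w(3) by simp
    next
      assume rv: "ws ! j = rev_move (ws ! i)"
      have ne: "j \<noteq> Suc i"
      proof
        assume "j = Suc i"
        then have "map fst ws ! i \<noteq> map fst ws ! Suc i"
          using w(2) ij by (simp add: distinct_adj_conv_nth)
        then show False using eq ij \<open>j = Suc i\<close> by simp
      qed
      have 1: "dst r (ws ! i) = src r (ws ! Suc i)" using walk_nth(2)[OF w(1), of i] ij by simp
      have 2: "dst r (ws ! (j - 1)) = src r (ws ! j)" using walk_nth(2)[OF w(1), of "j - 1"] ij by simp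
      have "walk n r (src r (ws ! Suc i)) (take (j - Suc i) (drop (Suc i) ws)) (src r (ws ! Suc i))"
        using walk_nth(3)[OF w(1), of "Suc i" j] ij ne 1 2 rv by simp
      moreover have "distinct_adj (map fst (take (j - Suc i) (drop (Suc i) ws)))"
        using distinct_adj_sub[OF w(2)] by (simp add: take_map drop_map)
      moreover have "take (j - Suc i) (drop (Suc i) ws) \<noteq> []" using ij ne by simp
      ultimately have "g \<le> length (take (j - Suc i) (drop (Suc i) ws))" by (rule girth_geD[OF g])
      then show False using ij w(3) by simp
    qed
  qed
  then have "fst (ws ! i) \<noteq> fst (ws ! j)" if "i \<noteq> j" "i < length ws" "j < length ws" for i j
    using that by (metis nat_neq_iff)
  then show ?thesis by (simp add: distinct_conv_nth)
qed

text \<open>The factor 6 is 2 * 3. Of two consecutive indices at least one has different edges in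
  the two walks: equal edges with different sources are traversed in opposite directions, and two
  such in a row close a cycle of length 2. A third of the resulting 3 * \<mu> indices is
  independent.\<close>

lemma independent_indices:
  assumes g: "girth_ge n r g" and L: "L = 6 * \<mu>" "L < g" "2 < g"
    and w: "walk n r x ws y" "distinct_adj (map fst ws)" "length ws = L"
    and w': "walk n r x' ws' y'" "distinct_adj (map fst ws')" "length ws' = L"
    and D: "\<And>i. i < L \<Longrightarrow> src r (ws ! i) \<noteq> src r (ws' ! i)"
  shows "\<exists>I\<subseteq>{..<L}. \<mu> \<le> card I \<and> inj_on (\<lambda>i. fst (ws ! i)) I \<and>
     (\<lambda>i. fst (ws ! i)) ` I \<inter> (\<lambda>i. fst (ws' ! i)) ` I = {}"
proof -
  let ?e = "\<lambda>i. fst (ws ! i)" and ?e' = "\<lambda>i. fst (ws' ! i)"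
  have inj: "inj_on ?e {..<L}" "inj_on ?e' {..<L}"
    using short_walk_distinct[OF g w(1,2)] short_walk_distinct[OF g w'(1,2)] w(3) w'(3) L(2)
    by (auto simp: inj_on_def distinct_conv_nth)
  have "\<exists>i\<in>{2 * s, Suc (2 * s)}. ?e i \<noteq> ?e' i" if s: "s < 3 * \<mu>" for s
  proof (rule ccontr)
    assume "\<not> ?thesis"
    then have eq: "?e (2 * s) = ?e' (2 * s)" "?e (Suc (2 * s)) = ?e' (Suc (2 * s))" by auto
    have lt: "Suc (2 * s) < L" using s L by simp
    have r1: "ws' ! (2 * s) = rev_move (ws ! (2 * s))"
      using move_cases[OF eq(1)] D[of "2 * s"] lt by auto
    have r2: "ws' ! Suc (2 * s) = rev_move (ws ! Suc (2 * s))"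
      using move_cases[OF eq(2)] D[of "Suc (2 * s)"] lt by auto
    have "dst r (ws' ! (2 * s)) = src r (ws' ! Suc (2 * s))" using walk_nth(2)[OF w'(1)] lt w'(3) by simp
    then have cl: "src r (ws ! (2 * s)) = dst r (ws ! Suc (2 * s))" using r1 r2 by simp
    have "walk n r (src r (ws ! (2 * s))) (take 2 (drop (2 * s) ws)) (src r (ws ! (2 * s)))"
      using walk_nth(3)[OF w(1), of "2 * s" "2 * s + 2"] lt w(3) cl by simp
    moreover have "distinct_adj (map fst (take 2 (drop (2 * s) ws)))"
      using distinct_adj_sub[OF w(2)] by (simp add: take_map drop_map)
    moreover have "take 2 (drop (2 * s) ws) \<noteq> []" using lt w(3) by simp
    ultimately have "g \<le> length (take 2 (drop (2 * s) ws))" by (rule girth_geD[OF g])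
    then show False using L(3) by simp
  qed
  then obtain c where c: "\<And>s. s < 3 * \<mu> \<Longrightarrow> c s \<in> {2 * s, Suc (2 * s)} \<and> ?e (c s) \<noteq> ?e' (c s)" by metis
  let ?J = "c ` {..<3 * \<mu>}"
  have "inj_on c {..<3 * \<mu>}"
  proof (rule inj_onI)
    fix s s' assume "s \<in> {..<3 * \<mu>}" "s' \<in> {..<3 * \<mu>}" "c s = c s'"
    moreover have "c s div 2 = s" if "s < 3 * \<mu>" for s using c[OF that] by auto
    ultimately show "s = s'" by (metis lessThan_iff)
  qed
  then have cardJ: "card ?J = 3 * \<mu>" by (simp add: card_image)
  have JL: "?J \<subseteq> {..<L}"
  proof
    fix i assume "i \<in> ?J"
    then obtain s where "s < 3 * \<mu>" "i = c s" by auto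
    then have "i = 2 * s \<or> i = Suc (2 * s)" using c[of s] by blast
    then show "i \<in> {..<L}" using \<open>s < 3 * \<mu>\<close> L(1) by auto
  qed
  have "\<exists>I\<subseteq>?J. card ?J \<le> 3 * card I \<and> ?e ` I \<inter> ?e' ` I = {}"
    by (rule independent_subset) (use c inj JL in \<open>auto intro: inj_on_subset\<close>)
  then obtain I where I: "I \<subseteq> ?J" "card ?J \<le> 3 * card I" "?e ` I \<inter> ?e' ` I = {}" by blast
  have "inj_on ?e I" using inj_on_subset[OF inj(1)] I(1) JL by blast
  then show ?thesis using I JL cardJ by (intro exI[of _ I]) auto
qed

text \<open>The image of I under e' avoids the image under e, so the colours on the latter are
  determined by the others and restriction to the complement is injective.\<close>

lemma card_bad_colourings:
  fixes e e' :: "'i \<Rightarrow> 'e"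
  assumes fin: "finite Ed" "finite I" and sub: "e ` I \<subseteq> Ed" "e' ` I \<subseteq> Ed" and inj: "inj_on e I"
    and dis: "e ` I \<inter> e' ` I = {}"
  shows "card {\<rho> \<in> Ed \<rightarrow>\<^sub>E {..<Q::nat}. \<forall>i\<in>I. \<rho> (e i) = \<rho> (e' i)} * Q ^ card I \<le> Q ^ card Ed"
proof -
  let ?B = "{\<rho> \<in> Ed \<rightarrow>\<^sub>E {..<Q}. \<forall>i\<in>I. \<rho> (e i) = \<rho> (e' i)}"
  let ?h = "\<lambda>\<rho>. restrict \<rho> (Ed - e ` I)"
  have "inj_on ?h ?B"
  proof (rule inj_onI)
    fix \<rho> \<rho>' assume r: "\<rho> \<in> ?B" "\<rho>' \<in> ?B" "?h \<rho> = ?h \<rho>'"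
    have out: "\<rho> x = \<rho>' x" if "x \<in> Ed - e ` I" for x using fun_cong[OF r(3), of x] that by simp
    have "\<rho> x = \<rho>' x" if "x \<in> Ed" for x
    proof (cases "x \<in> e ` I")
      case True
      then obtain i where i: "i \<in> I" "x = e i" by blast
      have "e' i \<in> Ed - e ` I" using i sub dis by blast
      then show ?thesis using out r(1,2) i by auto
    qed (use out that in auto)
    then show "\<rho> = \<rho>'" using r(1,2) by (intro PiE_ext[of \<rho> Ed "\<lambda>_. {..<Q}" \<rho>']) auto
  qed
  moreover have "?h ` ?B \<subseteq> (Ed - e ` I) \<rightarrow>\<^sub>E {..<Q}" by auto
  moreover have "finite ((Ed - e ` I) \<rightarrow>\<^sub>E {..<Q})" using fin by (intro finite_PiE) auto
  ultimately have "card ?B \<le> card ((Ed - e ` I) \<rightarrow>\<^sub>E {..<Q})" using card_inj_on_le by blast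
  also have "\<dots> = Q ^ (card Ed - card I)"
    using fin sub inj by (simp add: card_PiE card_Diff_subset card_image)
  finally have "card ?B * Q ^ card I \<le> Q ^ (card Ed - card I) * Q ^ card I" by simp
  moreover have "card I \<le> card Ed" using card_mono[OF fin(1) sub(1)] inj by (simp add: card_image)
  ultimately show ?thesis by (simp add: power_add[symmetric])
qed

text \<open>Union bound: there are at most \<open>(n * 4 ^ (6 * \<mu>))\<^sup>2\<close> pairs of
  walks, and by the two preceding lemmas a pair is coloured alike by a proportion of at most 1 / Q ^
  \<mu> of the colourings.\<close>

lemma exists_separating_colouring:
  fixes \<sigma> :: "nat \<Rightarrow> nat" and m t n g \<mu> Q :: nat
  defines "r \<equiv> glue \<sigma> t"
  assumes s: "inj_on \<sigma> {..<t}" and g: "girth_ge n r g" and gL: "6 * \<mu> < g" "2 < g"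
    and fx: "\<And>p. p < n \<Longrightarrow> r p < n" and Q: "(n * 4 ^ (6 * \<mu>))\<^sup>2 < Q ^ \<mu>" and mu: "0 < \<mu>"
  shows "\<exists>\<rho>. (\<forall>j. \<rho> j < Q) \<and> (\<forall>x y ws x' y' ws'. walk n r x ws y \<longrightarrow> distinct_adj (map fst ws) \<longrightarrow>
      length ws = 6 * \<mu> \<longrightarrow> walk n r x' ws' y' \<longrightarrow> distinct_adj (map fst ws') \<longrightarrow> length ws' = 6 * \<mu> \<longrightarrow>
      (\<forall>i<6 * \<mu>. src r (ws ! i) \<noteq> src r (ws' ! i)) \<longrightarrow>
      (\<exists>i<6 * \<mu>. \<rho> (fst (ws ! i)) \<noteq> \<rho> (fst (ws' ! i))))"
proof -
  let ?L = "6 * \<mu>"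
  define W where "W = {ws. length ws = ?L \<and> (\<exists>x y. walk n r x ws y)}"
  define Ed where "Ed = {j. Suc j < n}"
  define \<Phi> where "\<Phi> = (Ed \<rightarrow>\<^sub>E {..<Q})"
  define Prs where "Prs = {(ws, ws') \<in> W \<times> W. distinct_adj (map fst ws) \<and> distinct_adj (map fst ws') \<and>
      (\<forall>i<?L. src r (ws ! i) \<noteq> src r (ws' ! i))}"
  define Bad where "Bad p = {\<rho> \<in> \<Phi>. \<forall>i<?L. \<rho> (fst (fst p ! i)) = \<rho> (fst (snd p ! i))}"
    for p :: "move list \<times> move list"
  have finEd: "finite Ed" unfolding Ed_def by (rule finite_subset[of _ "{..<n}"]) auto
  have Q0: "0 < Q" using Q mu by (cases Q) (auto simp: zero_power)
  have card\<Phi>: "card \<Phi> = Q ^ card Ed" unfolding \<Phi>_def using finEd by (simp add: card_PiE)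
  have fin\<Phi>: "finite \<Phi>" unfolding \<Phi>_def using finEd by (intro finite_PiE) auto
  have W: "finite W" "card W \<le> n * 4 ^ ?L"
  proof -
    let ?Wx = "\<lambda>x. {ws. length ws = ?L \<and> (\<exists>y. walk n (glue \<sigma> t) x ws y)}"
    have sub: "W \<subseteq> (\<Union>x<n. ?Wx x)"
    proof
      fix ws assume "ws \<in> W"
      then obtain x y where xy: "length ws = ?L" "walk n r x ws y" by (auto simp: W_def)
      then obtain s ws' where "ws = s # ws'" using mu by (cases ws) auto
      then have "src r s = x" "Suc (fst s) < n" using xy by auto
      then have "x < n" using fx by (auto simp: src_def split: if_splits)
      then show "ws \<in> (\<Union>x<n. ?Wx x)" using xy by (auto simp: r_def)
    qed
    have fin: "finite (\<Union>x<n. ?Wx x)" using card_walks[OF s] by blast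
    have "card (\<Union>x<n. ?Wx x) \<le> (\<Sum>x<n. card (?Wx x))" by (rule card_UN_le) simp
    also have "\<dots> \<le> (\<Sum>x<n. 4 ^ ?L)" by (rule sum_mono) (use card_walks[OF s] in blast)
    finally show "finite W" "card W \<le> n * 4 ^ ?L"
      using finite_subset[OF sub fin] card_mono[OF fin sub] by simp_all
  qed
  have finP: "finite Prs" "card Prs \<le> (n * 4 ^ ?L)\<^sup>2"
  proof -
    have sub: "Prs \<subseteq> W \<times> W" by (auto simp: Prs_def)
    then show "finite Prs" using W(1) finite_subset by blast
    have "card Prs \<le> card W * card W" using card_mono[OF _ sub] W(1) by (simp add: card_cartesian_product)
    also have "\<dots> \<le> (n * 4 ^ ?L) * (n * 4 ^ ?L)" by (intro mult_mono W(2)) auto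
    finally show "card Prs \<le> (n * 4 ^ ?L)\<^sup>2" by (simp add: power2_eq_square)
  qed
  have bad: "card (Bad p) * Q ^ \<mu> \<le> card \<Phi>" if p: "p \<in> Prs" for p
  proof -
    obtain ws ws' where pw: "p = (ws, ws')" by (cases p)
    obtain x y x' y' where w: "walk n r x ws y" "distinct_adj (map fst ws)" "length ws = ?L"
      and w': "walk n r x' ws' y'" "distinct_adj (map fst ws')" "length ws' = ?L"
      and D: "\<And>i. i < ?L \<Longrightarrow> src r (ws ! i) \<noteq> src r (ws' ! i)"
      using p unfolding pw Prs_def W_def by blast
    obtain I where I: "I \<subseteq> {..<?L}" "\<mu> \<le> card I" "inj_on (\<lambda>i. fst (ws ! i)) I"
      "(\<lambda>i. fst (ws ! i)) ` I \<inter> (\<lambda>i. fst (ws' ! i)) ` I = {}"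
      using independent_indices[OF g refl gL w w' D] by blast
    let ?B = "{\<rho> \<in> Ed \<rightarrow>\<^sub>E {..<Q}. \<forall>i\<in>I. \<rho> (fst (ws ! i)) = \<rho> (fst (ws' ! i))}"
    have finI: "finite I" using I(1) finite_subset by blast
    have sub: "(\<lambda>i. fst (ws ! i)) ` I \<subseteq> Ed" "(\<lambda>i. fst (ws' ! i)) ` I \<subseteq> Ed"
      using walk_nth(1)[OF w(1)] walk_nth(1)[OF w'(1)] I(1) w(3) w'(3) by (auto simp: Ed_def)
    have "card ?B * Q ^ card I \<le> Q ^ card Ed"
      by (rule card_bad_colourings[OF finEd finI sub I(3,4)])
    moreover have "Bad p \<subseteq> ?B" using I(1) by (auto simp: Bad_def \<Phi>_def pw)
    then have "card (Bad p) \<le> card ?B" using fin\<Phi> by (intro card_mono) (auto simp: \<Phi>_def)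
    moreover have "Q ^ \<mu> \<le> Q ^ card I" using I(2) Q0 by (intro power_increasing) auto
    ultimately show ?thesis unfolding card\<Phi> by (meson le_trans mult_le_mono)
  qed
  have "\<Phi> - (\<Union>p\<in>Prs. Bad p) \<noteq> {}"
  proof
    assume "\<Phi> - (\<Union>p\<in>Prs. Bad p) = {}"
    then have sub: "\<Phi> \<subseteq> (\<Union>p\<in>Prs. Bad p)" by blast
    have finB: "finite (\<Union>p\<in>Prs. Bad p)" using finP fin\<Phi> by (auto simp: Bad_def)
    have "card \<Phi> \<le> card (\<Union>p\<in>Prs. Bad p)" by (rule card_mono[OF finB sub])
    also have "\<dots> \<le> (\<Sum>p\<in>Prs. card (Bad p))" by (rule card_UN_le[OF finP(1)])
    finally have "card \<Phi> * Q ^ \<mu> \<le> (\<Sum>p\<in>Prs. card (Bad p)) * Q ^ \<mu>" by simp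
    also have "\<dots> \<le> (\<Sum>p\<in>Prs. card \<Phi>)" unfolding sum_distrib_right by (rule sum_mono[OF bad])
    also have "\<dots> \<le> (n * 4 ^ ?L)\<^sup>2 * card \<Phi>" using finP(2) by simp
    also have "\<dots> < Q ^ \<mu> * card \<Phi>" using Q card\<Phi> Q0 by simp
    finally show False by simp
  qed
  then obtain \<rho> where \<rho>: "\<rho> \<in> \<Phi>" "\<And>p. p \<in> Prs \<Longrightarrow> \<rho> \<notin> Bad p" by blast
  let ?\<rho> = "\<lambda>j. if j \<in> Ed then \<rho> j else 0"
  have "?\<rho> j < Q" for j using \<rho>(1) Q0 by (auto simp: \<Phi>_def)
  moreover have "\<exists>i<?L. ?\<rho> (fst (ws ! i)) \<noteq> ?\<rho> (fst (ws' ! i))"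
    if w: "walk n r x ws y" "distinct_adj (map fst ws)" "length ws = ?L"
      "walk n r x' ws' y'" "distinct_adj (map fst ws')" "length ws' = ?L"
      "\<forall>i<?L. src r (ws ! i) \<noteq> src r (ws' ! i)" for x y ws x' y' ws'
  proof -
    have "(ws, ws') \<in> Prs" unfolding Prs_def W_def using w by blast
    then have "\<rho> \<notin> Bad (ws, ws')" by (rule \<rho>(2))
    then have "\<not> (\<forall>i<?L. \<rho> (fst (ws ! i)) = \<rho> (fst (ws' ! i)))" using \<rho>(1) by (simp add: Bad_def)
    then obtain i where i: "i < ?L" "\<rho> (fst (ws ! i)) \<noteq> \<rho> (fst (ws' ! i))" by blast
    have "fst (ws ! i) \<in> Ed" "fst (ws' ! i) \<in> Ed"
      using walk_nth(1)[OF w(1)] walk_nth(1)[OF w(4)] w(3,6) i by (auto simp: Ed_def)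
    then show ?thesis using i by (intro exI[of _ i]) simp
  qed
  ultimately show ?thesis by (intro exI[of _ ?\<rho>]) blast
qed

section \<open>The folded path as a small cancellation graph\<close>

locale glued_path =
  fixes \<sigma> :: "nat \<Rightarrow> nat" and m :: nat and \<mu> g Q :: nat and \<rho> :: "nat \<Rightarrow> nat"
  assumes inj: "inj_on \<sigma> {..<m}" and range: "\<sigma> ` {..<m} \<subseteq> {2 * m..<4 * m}"
    and girth: "girth_ge (4 * m) (glue \<sigma> m) g" and g: "80 * \<mu> \<le> g" and mu: "0 < \<mu>" and m: "0 < m"
    and sep: "\<lbrakk>walk (4 * m) (glue \<sigma> m) x ws y; distinct_adj (map fst ws); length ws = 6 * \<mu>;
        walk (4 * m) (glue \<sigma> m) x' ws' y'; distinct_adj (map fst ws'); length ws' = 6 * \<mu>;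
        \<forall>i<6 * \<mu>. src (glue \<sigma> m) (ws ! i) \<noteq> src (glue \<sigma> m) (ws' ! i)\<rbrakk>
        \<Longrightarrow> \<exists>i<6 * \<mu>. \<rho> (fst (ws ! i)) \<noteq> \<rho> (fst (ws' ! i))"
begin

abbreviation r where "r \<equiv> glue \<sigma> m"

text \<open>The residue modulo 4 makes the colouring proper: at most two positions are folded to the same
  vertex, only one of them less than \<open>m\<close>, and the edges at one position have different parity.\<close>

definition col :: "nat \<Rightarrow> nat" where "col j = 4 * \<rho> j + (j mod 2 + (if j < m then 0 else 2))"

definition E :: "nat \<Rightarrow> nat \<Rightarrow> nat \<Rightarrow> bool" where
  "E c u v \<longleftrightarrow> (\<exists>s. Suc (fst s) < 4 * m \<and> col (fst s) = c \<and> src r s = u \<and> dst r s = v)"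

text \<open>Besides the glued path the graph has an isolated edge of every colour, so that every edge of
  the Cayley tree lies on a chart.\<close>

definition E' :: "nat \<Rightarrow> nat \<Rightarrow> nat \<Rightarrow> bool" where
  "E' c u v \<longleftrightarrow> E c u v \<or> u = 4 * m + 2 * c \<and> v = Suc u \<or> v = 4 * m + 2 * c \<and> u = Suc v"

lemma r_less: "p < 4 * m \<Longrightarrow> r p < 4 * m" using range by (auto simp: glue_def)

lemma col_eq: "col j = col j' \<Longrightarrow> j mod 2 = j' mod 2 \<and> (j < m \<longleftrightarrow> j' < m) \<and> \<rho> j = \<rho> j'"
proof -
  assume a: "col j = col j'"
  have b: "j mod 2 + (if j < m then 0 else 2) < 4" for j :: nat
    using mod_less_divisor[of 2 j] by auto
  have "col j div 4 = \<rho> j" "col j mod 4 = j mod 2 + (if j < m then 0 else 2)" for j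
    using b[of j] unfolding col_def by (simp_all add: div_mult_self4 mod_mult_self4)
  then have "\<rho> j = \<rho> j'" "j mod 2 + (if j < m then 0 else 2) = j' mod 2 + (if j' < m then 0 else (2::nat))"
    using a by metis+
  moreover have "j mod 2 < 2" "j' mod 2 < 2" by simp_all
  ultimately show ?thesis by (auto split: if_splits)
qed

lemma proper:
  assumes "src r s = src r s'" "col (fst s) = col (fst s')"
  shows "s = s'"
proof -
  obtain j b j' b' where sj: "s = (j, b)" "s' = (j', b')" by (cases s; cases s')
  have c: "j mod 2 = j' mod 2" "j < m \<longleftrightarrow> j' < m" using col_eq[OF assms(2)] sj by auto
  let ?p = "if b then j else Suc j" and ?p' = "if b' then j' else Suc j'"
  have rp: "r ?p = r ?p'" using assms(1) by (cases b; cases b'; simp add: sj src_def)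
  have low: "2 * m \<le> \<sigma> p" if "p < m" for p using range that by auto
  \<comment> \<open>Glued partners are at least 2 * m, well beyond m. So edges on the same side of m
    cannot meet the same vertex at positions p < m and p' >= m.\<close>
  have no: "p' < m" if "p < m" "r p = r p'" "k \<le> p" "p' \<le> Suc k'" "k < m \<longleftrightarrow> k' < m" for p p' k k'
  proof (rule ccontr)
    assume "\<not> p' < m"
    then have "\<sigma> p = p'" using that(1,2) by (simp add: glue_def)
    then show False using low[OF that(1)] that m by linarith
  qed
  have "?p = ?p'"
  proof (cases "?p < m")
    case True
    then have "?p' < m" by (rule no[OF _ rp, of j j']) (use c(2) in auto)
    then have "\<sigma> ?p = \<sigma> ?p'" using True rp by (simp only: glue_def if_True)
    then show ?thesis by (rule inj_onD[OF inj]) (use True \<open>?p' < m\<close> in simp_all)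
  next
    case False
    have "\<not> ?p' < m"
    proof
      assume "?p' < m"
      then have "?p < m" by (rule no[OF _ rp[symmetric], of j' j]) (use c(2) in auto)
      then show False using False by simp
    qed
    then show ?thesis using False rp by (simp only: glue_def if_False)
  qed
  then show ?thesis using c(1) sj by (cases b; cases b'; simp) presburger+
qed

lemma run_walk: "run E u w v \<Longrightarrow> \<exists>ws. walk (4 * m) r u ws v \<and> map (\<lambda>s. col (fst s)) ws = w"
proof (induction w arbitrary: u)
  case Nil
  then show ?case by (intro exI[of _ "[]"]) simp
next
  case (Cons c w)
  then obtain t where t: "E c u t" "run E t w v" by auto
  then obtain s where s: "Suc (fst s) < 4 * m" "col (fst s) = c" "src r s = u" "dst r s = t"
    unfolding E_def by blast
  with t(2) obtain ws where "walk (4 * m) r (dst r s) ws v" "map (\<lambda>s. col (fst s)) ws = w" using Cons.IH by blast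
  then show ?case using s by (intro exI[of _ "s # ws"]) simp
qed

lemma walk_adj: "distinct_adj (map (\<lambda>s. col (fst s)) ws) \<Longrightarrow> distinct_adj (map fst ws)"
  using distinct_adj_mapD[of col "map fst ws"] by (simp add: comp_def)

lemma E_less: "E c u v \<Longrightarrow> u < 4 * m \<and> v < 4 * m"
  unfolding E_def src_def dst_def using r_less by (auto split: if_splits)

lemma run_E': "run E' u w v \<Longrightarrow> u < 4 * m \<Longrightarrow> run E u w v"
proof (induction w arbitrary: u)
  case (Cons c w)
  then obtain t where t: "E' c u t" "run E' t w v" by auto
  then have "E c u t" using Cons.prems by (auto simp: E'_def)
  then show ?case using Cons.IH t E_less by auto
qed simp

lemma run_E'_extra:
  assumes "run E' u w v" "\<not> u < 4 * m" "distinct_adj w" shows "length w \<le> 1" "w \<noteq> [] \<Longrightarrow> u \<noteq> v"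
proof -
  have E1: "c = (u - 4 * m) div 2 \<and> \<not> t < 4 * m \<and> (t - 4 * m) div 2 = c \<and> t \<noteq> u"
    if "E' c u t" "\<not> u < 4 * m" for c u t
    using that E_less[of c u t] unfolding E'_def by auto
  have "length w \<le> 1 \<and> (w \<noteq> [] \<longrightarrow> u \<noteq> v)"
  proof (cases w)
    case (Cons c w')
    then obtain t where t: "E' c u t" "run E' t w' v" using assms by auto
    show ?thesis
    proof (cases w')
      case Nil
      then show ?thesis using Cons t E1[OF t(1) assms(2)] by auto
    next
      case (Cons c' w'')
      then obtain t' where "E' c' t t'" using t by auto
      then have "c' = c" using E1[OF t(1) assms(2)] E1[of c' t t'] by auto
      then show ?thesis using assms(3) \<open>w = c # w'\<close> Cons by simp
    qed
  qed simp
  then show "length w \<le> 1" "w \<noteq> [] \<Longrightarrow> u \<noteq> v" by auto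
qed

lemma run_take: "run E u w v \<Longrightarrow> \<exists>v'. run E u (take k w) v'"
  using run_append[of E u "take k w" "drop k w" v] by auto

text \<open>For the pieces: since the colouring is proper, equally labelled walks that start at
  different vertices never meet at the same time, as one sees by reading them backwards. If they had
  more than 6 * \<mu> edges, \<open>sep\<close> would give a place where their colours
  differ.\<close>

lemma coloured_graph: "coloured_graph E' (6 * \<mu>)"
proof
  fix c u v v' :: nat and w :: "nat list"
  show "E' c v u" if "E' c u v"
  proof -
    have "E c v u" if uv: "E c u v"
    proof -
      obtain s where "Suc (fst s) < 4 * m" "col (fst s) = c" "src r s = u" "dst r s = v"
        using uv unfolding E_def by blast
      then show ?thesis unfolding E_def by (intro exI[of _ "rev_move s"]) simp
    qed
    then show ?thesis using that by (auto simp: E'_def)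
  qed
  show "v = v'" if "E' c u v" "E' c u v'"
  proof (cases "u < 4 * m")
    case True
    then have "E c u v" "E c u v'" using that by (auto simp: E'_def)
    then show ?thesis using proper unfolding E_def by metis
  next
    case False
    then have "\<not> E c u v" "\<not> E c u v'" using E_less by blast+
    then show ?thesis using that unfolding E'_def by auto
  qed
  show "\<exists>u v. E' c u v" by (auto simp: E'_def)
  show "2 \<le> 6 * \<mu>" using mu by simp
  show "13 * (6 * \<mu>) \<le> length w" if w: "run E' v w v" "distinct_adj w" "w \<noteq> []"
  proof (cases "v < 4 * m")
    case True
    then obtain ws where ws: "walk (4 * m) r v ws v" "map (\<lambda>s. col (fst s)) ws = w"
      using run_walk[OF run_E'] w by blast
    then have "g \<le> length ws" using girth_geD[OF girth ws(1)] walk_adj w by auto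
    \<comment> \<open>The constant 80 is 13 * 6 = 78 rounded up.\<close>
    then show ?thesis using ws(2) g by auto
  next
    case False
    then show ?thesis using run_E'_extra[OF w(1)] w by blast
  qed
  show "length w \<le> 6 * \<mu>" if w: "run E' u w u'" "run E' v w v'" "distinct_adj w" "u \<noteq> v" for u u' v v' w
  proof (rule ccontr)
    assume len: "\<not> length w \<le> 6 * \<mu>"
    then have uv: "u < 4 * m" "v < 4 * m"
      using run_E'_extra(1)[OF w(1) _ w(3)] run_E'_extra(1)[OF w(2) _ w(3)] mu by linarith+
    let ?w = "take (6 * \<mu>) w"
    obtain t t' where "run E u ?w t" "run E v ?w t'"
      using run_take run_E'[OF w(1) uv(1)] run_E'[OF w(2) uv(2)] by blast
    then obtain ws ws' where ws: "walk (4 * m) r u ws t" "map (\<lambda>s. col (fst s)) ws = ?w"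
      and ws': "walk (4 * m) r v ws' t'" "map (\<lambda>s. col (fst s)) ws' = ?w" using run_walk by blast
    have adj: "distinct_adj (map fst ws)" "distinct_adj (map fst ws')"
      using walk_adj[of ws] walk_adj[of ws'] ws(2) ws'(2) distinct_adj_sub[OF w(3), of "6 * \<mu>" 0]
      by simp_all
    have l: "length ws = 6 * \<mu>" "length ws' = 6 * \<mu>"
      using arg_cong[OF ws(2), of length] arg_cong[OF ws'(2), of length] len by simp_all
    have ce: "col (fst (ws ! i)) = col (fst (ws' ! i))" if "i < 6 * \<mu>" for i
      using arg_cong[OF ws(2)[folded ws'(2)], of "\<lambda>x. x ! i"] that l by simp
    have D: "src r (ws ! i) \<noteq> src r (ws' ! i)" if "i < 6 * \<mu>" for i
      using that
    proof (induction i)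
      case 0
      then have "ws \<noteq> []" "ws' \<noteq> []" using l by auto
      then have "src r (ws ! 0) = u" "src r (ws' ! 0) = v"
        using ws(1) ws'(1) by (auto simp: neq_Nil_conv)
      then show ?case using w(4) by simp
    next
      case (Suc i)
      show ?case
      proof
        assume eq: "src r (ws ! Suc i) = src r (ws' ! Suc i)"
        have "src r (rev_move (ws ! i)) = src r (rev_move (ws' ! i))"
          using walk_nth(2)[OF ws(1), of i] walk_nth(2)[OF ws'(1), of i] Suc.prems l eq by simp
        then have "rev_move (ws ! i) = rev_move (ws' ! i)" using proper ce[of i] Suc.prems by simp
        then have "ws ! i = ws' ! i" by (metis rev_move_simps(4))
        then show False using Suc by simp
      qed
    qed
    then obtain i where "i < 6 * \<mu>" "\<rho> (fst (ws ! i)) \<noteq> \<rho> (fst (ws' ! i))"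
      using sep[OF ws(1) adj(1) l(1) ws'(1) adj(2) l(2)] by blast
    then show False using col_eq[OF ce[of i]] by blast
  qed
qed

end

text \<open>The exponent is what \<open>(N * 4 ^ (6 * \<mu>))\<^sup>2 < palette ^ \<mu>\<close> requires for \<open>N = 4 ^ (80 * \<mu> + 3)\<close>.\<close>

definition palette :: nat where "palette = 4 ^ 200"

text \<open>N is chosen from B and M before A, because A will consist of words of length N. With N =
  4 * m the survivors number at most (M * B ^ 4) ^ m / (4 ^ (g + 1)) ^ m, which is less than 1 since
  \<mu> exceeds M * B ^ 4. The relation \<open>R a i j\<close> stands for "a maps i and j close to
  each other".\<close>

lemma killing_graph:
  fixes B M :: nat
  shows "\<exists>N. 0 < N \<and> (\<forall>(A :: 'a set) R. finite A \<longrightarrow> card A \<le> B ^ N \<longrightarrow>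
      (\<forall>a\<in>A. \<forall>i. card {j. j < N \<and> R a i j} \<le> M) \<longrightarrow>
      (\<exists>E \<theta> (r :: nat \<Rightarrow> nat) col. coloured_graph E \<theta> \<and>
        (\<forall>j. Suc j < N \<longrightarrow> E (col j) (r j) (r (Suc j)) \<and> col j < 4 * palette) \<and>
        (\<forall>v. finite {p. r p = v} \<and> card {p. r p = v} \<le> 2) \<and>
        (\<forall>a\<in>A. \<exists>i<N. \<exists>j<N. r i = r j \<and> \<not> R a i j)))"
proof -
  define \<mu> where "\<mu> = Suc (M * B ^ 4)"
  define g where "g = 80 * \<mu>"
  define m :: nat where "m = 4 * 4 ^ Suc g"
  define N where "N = 4 * m"
  have N4: "N = 4 ^ (g + 3)" by (simp add: N_def m_def eval_nat_numeral)
  have Q: "(N * 4 ^ (6 * \<mu>))\<^sup>2 < palette ^ \<mu>"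
  proof -
    have "(N * 4 ^ (6 * \<mu>))\<^sup>2 = (4 :: nat) ^ (2 * (g + 3 + 6 * \<mu>))"
      unfolding N4 by (simp only: power_add[symmetric] power_mult[symmetric] mult.commute)
    \<comment> \<open>2 * (80 * \<mu> + 3 + 6 * \<mu>) = 172 * \<mu> + 6, and \<mu> is
      positive.\<close>
    also have "\<dots> < 4 ^ (200 * \<mu>)" by (rule power_strict_increasing) (auto simp: g_def \<mu>_def)
    also have "\<dots> = palette ^ \<mu>" by (simp only: palette_def power_mult)
    finally show ?thesis .
  qed
  have "\<exists>E \<theta> (r :: nat \<Rightarrow> nat) col. coloured_graph E \<theta> \<and>
        (\<forall>j. Suc j < N \<longrightarrow> E (col j) (r j) (r (Suc j)) \<and> col j < 4 * palette) \<and>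
        (\<forall>v. finite {p. r p = v} \<and> card {p. r p = v} \<le> 2) \<and>
        (\<forall>a\<in>A. \<exists>i<N. \<exists>j<N. r i = r j \<and> \<not> R a i j)"
    if A: "finite A" "card A \<le> B ^ N" "\<forall>a\<in>A. \<forall>i. card {j. j < N \<and> R a i j} \<le> M" for A :: "'a set" and R
  proof -
    have RM: "card {j. j < 4 * (4 * 4 ^ Suc g) \<and> R a i j} \<le> M" if "a \<in> A" for a i
      using A(3) that unfolding N_def m_def by blast
    obtain \<sigma> where s: "inj_on \<sigma> {..<m}" "\<sigma> ` {..<m} \<subseteq> {2 * m..<4 * m}" "girth_ge (4 * m) (glue \<sigma> m) g"
      "card {a \<in> A. \<forall>i<m. R a i (\<sigma> i)} * (4 ^ Suc g) ^ m \<le> M ^ m * card A"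
      using greedy_gluing[of A g R M m, OF A(1) RM] unfolding m_def by blast
    have "card {a \<in> A. \<forall>i<m. R a i (\<sigma> i)} = 0"
    proof (rule ccontr)
      assume "card {a \<in> A. \<forall>i<m. R a i (\<sigma> i)} \<noteq> 0"
      then have "(4 ^ Suc g) ^ m \<le> card {a \<in> A. \<forall>i<m. R a i (\<sigma> i)} * (4 ^ Suc g) ^ m" by simp
      also have "\<dots> \<le> M ^ m * B ^ N" using s(4) A(2) by (meson le_trans mult_le_mono2)
      also have "\<dots> = (M * B ^ 4) ^ m" by (simp only: N_def power_mult power_mult_distrib)
      also have "\<dots> < (4 ^ Suc g) ^ m"
      proof (rule power_strict_mono)
        have "k < 4 ^ k" for k :: nat by (rule less_exp[THEN less_le_trans]) (simp add: power_mono)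
        then have "M * B ^ 4 < 4 ^ (M * B ^ 4)" .
        also have "\<dots> \<le> 4 ^ Suc g" by (rule power_increasing) (auto simp: g_def \<mu>_def)
        finally show "M * B ^ 4 < 4 ^ Suc g" .
      qed (auto simp: m_def)
      finally show False by simp
    qed
    then have kill: "\<exists>i<m. \<not> R a i (\<sigma> i)" if "a \<in> A" for a using A(1) that by auto
    have low: "2 * m \<le> \<sigma> p" "\<sigma> p < 4 * m" if "p < m" for p using s(2) that by auto
    have fx: "glue \<sigma> m p < N" if "p < N" for p using low that by (auto simp: glue_def N_def)
    obtain \<rho> where \<rho>: "\<forall>j. \<rho> j < palette" "\<forall>x y ws x' y' ws'. walk N (glue \<sigma> m) x ws y \<longrightarrow> distinct_adj (map fst ws) \<longrightarrow>
      length ws = 6 * \<mu> \<longrightarrow> walk N (glue \<sigma> m) x' ws' y' \<longrightarrow> distinct_adj (map fst ws') \<longrightarrow> length ws' = 6 * \<mu> \<longrightarrow>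
      (\<forall>i<6 * \<mu>. src (glue \<sigma> m) (ws ! i) \<noteq> src (glue \<sigma> m) (ws' ! i)) \<longrightarrow>
      (\<exists>i<6 * \<mu>. \<rho> (fst (ws ! i)) \<noteq> \<rho> (fst (ws' ! i)))"
      using exists_separating_colouring[OF s(1) s(3)[folded N_def] _ _ fx Q] by (auto simp: g_def \<mu>_def)
    interpret glued_path \<sigma> m \<mu> g palette \<rho>
    proof
      show "0 < m" by (simp add: m_def)
    qed (use s \<rho>(2) in \<open>auto simp: g_def \<mu>_def N_def\<close>)
    have "E' (col j) (r j) (r (Suc j)) \<and> col j < 4 * palette" if "Suc j < N" for j
    proof
      have "E (col j) (r j) (r (Suc j))"
        unfolding E_def using that by (intro exI[of _ "(j, True)"]) (simp add: src_def dst_def N_def)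
      then show "E' (col j) (r j) (r (Suc j))" by (simp add: E'_def)
      have "j mod 2 + (if j < m then 0 else 2) < 4" using mod_less_divisor[of 2 j] by auto
      moreover have "Suc (\<rho> j) \<le> palette" using \<rho>(1) by (simp add: Suc_le_eq)
      ultimately show "col j < 4 * palette" unfolding col_def by linarith
    qed
    moreover have "\<forall>a\<in>A. \<exists>i<N. \<exists>j<N. r i = r j \<and> \<not> R a i j"
    proof
      fix a assume "a \<in> A"
      then obtain i where i: "i < m" "\<not> R a i (\<sigma> i)" using kill by blast
      have "r i = r (\<sigma> i)" "i < N" "\<sigma> i < N" using i(1) low[OF i(1)] by (auto simp: glue_def N_def)
      then show "\<exists>i<N. \<exists>j<N. r i = r j \<and> \<not> R a i j" using i(2) by blast
    qed
    ultimately show ?thesis using coloured_graph card_fibre[OF s(1)] by blast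
  qed
  moreover have "0 < N" by (simp add: N_def m_def)
  ultimately show ?thesis by blast
qed

section \<open>Counting Lipschitz maps\<close>

locale proper_metric_group = group G + Metric_space "carrier G" d for G (structure) and d +
  assumes left_inv: "\<lbrakk>g \<in> carrier G; x \<in> carrier G; y \<in> carrier G\<rbrakk> \<Longrightarrow> d (g \<otimes> x) (g \<otimes> y) = d x y"
    and proper: "mbounded B \<Longrightarrow> compactin mtopology (mtopology closure_of B)"

lemma proper_metric_groupI:
  assumes "group G" "proper_left_invariant_compatible_metric G T d"
  shows "proper_metric_group G d"
proof -
  have M: "Metric_space (carrier G) d" using assms(2) by (simp add: proper_left_invariant_compatible_metric_def)
  show ?thesis
    using assms M
    by (auto simp: proper_left_invariant_compatible_metric_def proper_metric_group_def
        proper_metric_group_axioms_def)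
qed

context proper_metric_group
begin

lemma finite_cover:
  "\<exists>D. finite D \<and> D \<subseteq> carrier G \<and> (\<forall>x\<in>carrier G. d \<one> x \<le> s \<longrightarrow> (\<exists>c\<in>D. d c x \<le> 1))"
proof -
  let ?B = "mcball \<one> s"
  have "mtotally_bounded (mtopology closure_of ?B)"
    by (rule compactin_imp_mtotally_bounded, rule proper, rule mbounded_mcball)
  then obtain D where D: "finite D" "D \<subseteq> mtopology closure_of ?B"
    "mtopology closure_of ?B \<subseteq> (\<Union>x\<in>D. mball x 1)"
    unfolding mtotally_bounded_def by (metis zero_less_one)
  have "D \<subseteq> carrier G" using D(2) closure_of_subset_topspace[of mtopology ?B] by auto
  moreover have "\<exists>c\<in>D. d c x \<le> 1" if "x \<in> carrier G" "d \<one> x \<le> s" for x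
  proof -
    have "x \<in> ?B" using that by (simp add: in_mcball)
    then have "x \<in> mtopology closure_of ?B" using closure_of_subset[of ?B mtopology] mcball_subset_mspace[of \<one> s] by auto
    then obtain c where "c \<in> D" "x \<in> mball c 1" using D(3) by blast
    then show ?thesis by (intro bexI[of _ c]) (auto simp: in_mball)
  qed
  ultimately show ?thesis using D(1) by blast
qed

lemma d_translate_inv:
  assumes "g \<in> carrier G" "x \<in> carrier G" "y \<in> carrier G"
  shows "d (g \<otimes> x) y = d x (inv g \<otimes> y)"
  using left_inv[of "inv g" "g \<otimes> x" y] assms by (simp add: m_assoc[symmetric])

text \<open>\<open>F\<close> stands for a map on the group generated by the involutions \<open>\<pi> c\<close>, evaluated on words.\<close>

definition admits_map :: "nat \<Rightarrow> (nat \<Rightarrow> 'p \<Rightarrow> 'p) \<Rightarrow> real \<Rightarrow> nat \<Rightarrow> bool" where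
  "admits_map q \<pi> \<Lambda> M \<longleftrightarrow> (\<exists>F :: nat list \<Rightarrow> 'a.
     (\<forall>ws. set ws \<subseteq> {..<q} \<longrightarrow> F ws \<in> carrier G) \<and>
     (\<forall>us ws. set us \<subseteq> {..<q} \<longrightarrow> set ws \<subseteq> {..<q} \<longrightarrow> fold \<pi> us = fold \<pi> ws \<longrightarrow> F us = F ws) \<and>
     (\<forall>ws c. set ws \<subseteq> {..<q} \<longrightarrow> c < q \<longrightarrow> d (F ws) (F (ws @ [c])) \<le> \<Lambda>) \<and>
     (\<forall>ws S. set ws \<subseteq> {..<q} \<longrightarrow> finite S \<longrightarrow>
        S \<subseteq> {fold \<pi> us |us. set us \<subseteq> {..<q} \<and> d (F ws) (F us) \<le> 4} \<longrightarrow> card S \<le> M))"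

text \<open>A Lipschitz path f is tracked within distance 1 by a path q with steps in D. So distance
  2 in q means at most 4 in f, whence the radius 4 in \<open>admits_map\<close>; and equal values of
  f give distance at most 2 in q, whence the 2 in R. The bound 2 * M accounts for the fibres of r,
  of size at most 2. The multiplicity clause of \<open>admits_map\<close> speaks of finite S because
  an infinite set has \<open>card\<close> 0.\<close>

theorem exists_non_embedding:
  fixes \<Lambda> :: real and M :: nat
  assumes "0 \<le> \<Lambda>"
  shows "\<exists>\<pi> :: nat \<Rightarrow> rword set \<Rightarrow> rword set. (\<forall>c x. \<pi> c (\<pi> c x) = x) \<and> \<not> admits_map (4 * palette) \<pi> \<Lambda> M"
proof -
  obtain D where D: "finite D" "D \<subseteq> carrier G"
    "\<And>x. x \<in> carrier G \<Longrightarrow> d \<one> x \<le> \<Lambda> + 1 \<Longrightarrow> \<exists>c\<in>D. d c x \<le> 1" using finite_cover[of "\<Lambda> + 1"] by blast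
  define pos where "pos cs = rec_nat \<one> (\<lambda>j p. p \<otimes> cs ! j)" for cs
  have pos0: "pos cs 0 = \<one>" and posS: "pos cs (Suc j) = pos cs j \<otimes> cs ! j" for cs j
    by (simp_all add: pos_def)
  obtain N where N: "0 < N"
    "\<forall>(A :: 'a list set) R. finite A \<longrightarrow> card A \<le> card D ^ N \<longrightarrow>
      (\<forall>a\<in>A. \<forall>i. card {j. j < N \<and> R a i j} \<le> 2 * M) \<longrightarrow>
      (\<exists>E \<theta> (r :: nat \<Rightarrow> nat) col. coloured_graph E \<theta> \<and>
        (\<forall>j. Suc j < N \<longrightarrow> E (col j) (r j) (r (Suc j)) \<and> col j < 4 * palette) \<and>
        (\<forall>v. finite {p. r p = v} \<and> card {p. r p = v} \<le> 2) \<and>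
        (\<forall>a\<in>A. \<exists>i<N. \<exists>j<N. r i = r j \<and> \<not> R a i j))"
    using killing_graph[of "card D" "2 * M"] by (elim exE conjE) (rule that)
  define R where "R cs i j \<longleftrightarrow> i < N \<and> d (pos cs i) (pos cs j) \<le> 2" for cs i j
  define A where "A = {cs. set cs \<subseteq> D \<and> length cs = N \<and> (\<forall>i. card {j. j < N \<and> R cs i j} \<le> 2 * M)}"
  have "finite {cs. set cs \<subseteq> D \<and> length cs = N}" by (rule finite_lists_length_eq[OF D(1)])
  moreover have sub: "A \<subseteq> {cs. set cs \<subseteq> D \<and> length cs = N}" by (auto simp: A_def)
  ultimately have A: "finite A" "card A \<le> card D ^ N"
    using finite_subset card_mono[OF _ sub] card_lists_length_eq[OF D(1), of N] by metis+
  have RA: "\<forall>a\<in>A. \<forall>i. card {j. j < N \<and> R a i j} \<le> 2 * M" by (simp add: A_def)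
  obtain E \<theta> and r :: "nat \<Rightarrow> nat" and col
    where cg: "coloured_graph E \<theta>"
      and E': "\<forall>j. Suc j < N \<longrightarrow> E (col j) (r j) (r (Suc j)) \<and> col j < 4 * palette"
      and fib': "\<forall>v. finite {p. r p = v} \<and> card {p. r p = v} \<le> 2"
      and kill': "\<forall>a\<in>A. \<exists>i<N. \<exists>j<N. r i = r j \<and> \<not> R a i j"
    using N(2)[THEN spec, THEN spec, THEN mp, THEN mp, THEN mp, OF A RA] by (elim exE conjE) (rule that)
  note E = E'[rule_format] and kill = kill'[rule_format]
  have fib: "finite {p. r p = v}" "card {p. r p = v} \<le> 2" for v using fib' by auto
  interpret coloured_graph E \<theta> by (rule cg)
  \<comment> \<open>The words stop growing after N - 1 letters, so that the path f is defined and
    Lipschitz at every index.\<close>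
  define w where "w j = map col [0..<min j (N - 1)]" for j
  have w_set: "set (w j) \<subseteq> {..<4 * palette}" for j
  proof
    fix c assume "c \<in> set (w j)"
    then obtain k where "k < N - 1" "c = col k" by (auto simp: w_def)
    then show "c \<in> {..<4 * palette}" using E[of k] by simp
  qed
  have w_Suc: "w (Suc j) = (if Suc j < N then w j @ [col j] else w j)" for j
  proof -
    have "min j (N - 1) = j \<and> min (Suc j) (N - 1) = Suc j" if "Suc j < N" using that by auto
    moreover have "min j (N - 1) = min (Suc j) (N - 1)" if "\<not> Suc j < N" using that N(1) by auto
    ultimately show ?thesis by (auto simp: w_def)
  qed
  have run_w: "run E (r 0) (w j) (r j)" if "j < N" for j
    using that
  proof (induction j)
    case 0
    then show ?case by (simp add: w_def)
  next
    case (Suc j)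
    then show ?case using E[of j] w_Suc[of j] by (auto simp: run_append)
  qed
  have w_eq: "fold perm (w i) = fold perm (w j) \<longleftrightarrow> r i = r j" if "i < N" "j < N" for i j
    using fold_perm_eq_iff[OF run_w[OF that(1)] run_w[OF that(2)]] .
  have "\<not> admits_map (4 * palette) perm \<Lambda> M"
  proof
    assume "admits_map (4 * palette) perm \<Lambda> M"
    then obtain F :: "nat list \<Rightarrow> 'a" where
      F1: "\<And>ws. set ws \<subseteq> {..<4 * palette} \<Longrightarrow> F ws \<in> carrier G" and
      F2: "\<And>us ws. set us \<subseteq> {..<4 * palette} \<Longrightarrow> set ws \<subseteq> {..<4 * palette} \<Longrightarrow>
        fold perm us = fold perm ws \<Longrightarrow> F us = F ws" and
      F3: "\<And>ws c. set ws \<subseteq> {..<4 * palette} \<Longrightarrow> c < 4 * palette \<Longrightarrow> d (F ws) (F (ws @ [c])) \<le> \<Lambda>" and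
      F4: "\<And>ws S. set ws \<subseteq> {..<4 * palette} \<Longrightarrow> finite S \<Longrightarrow>
        S \<subseteq> {fold perm us |us. set us \<subseteq> {..<4 * palette} \<and> d (F ws) (F us) \<le> 4} \<Longrightarrow> card S \<le> M"
      unfolding admits_map_def by blast
    define f where "f j = inv (F []) \<otimes> F (w j)" for j
    have F0: "F [] \<in> carrier G" using F1[of "[]"] by simp
    have Fw: "F (w j) \<in> carrier G" for j using F1 w_set by blast
    have fG: "f j \<in> carrier G" for j using F0 Fw by (simp add: f_def)
    have df: "d (f i) (f j) = d (F (w i)) (F (w j))" for i j
      unfolding f_def using F0 Fw by (intro left_inv) auto
    have f0: "f 0 = \<one>" using F0 by (simp add: f_def w_def)
    have fS: "d (f j) (f (Suc j)) \<le> \<Lambda>" for j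
    proof (cases "Suc j < N")
      case True
      then show ?thesis unfolding df w_Suc using F3[OF w_set] E[of j] by simp
    next
      case False
      then show ?thesis unfolding df w_Suc using Fw assms by simp
    qed
    \<comment> \<open>The next step aims from the tracked point p itself at
      \<open>f (Suc j)\<close>, which is within \<Lambda> + 1 of p. Errors are thus corrected and do
      not accumulate.\<close>
    define sel where "sel p j = (SOME c. c \<in> D \<and> d c (inv p \<otimes> f (Suc j)) \<le> 1)" for p j
    define q where "q = rec_nat \<one> (\<lambda>j p. p \<otimes> sel p j)"
    have q0: "q 0 = \<one>" and qS: "q (Suc j) = q j \<otimes> sel (q j) j" for j by (simp_all add: q_def)
    have step: "q j \<in> carrier G \<and> d (q j) (f j) \<le> 1 \<and> sel (q j) j \<in> D" for j
    proof -
      have sel: "sel p j \<in> D \<and> d (sel p j) (inv p \<otimes> f (Suc j)) \<le> 1"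
        if p: "p \<in> carrier G" "d p (f j) \<le> 1" for p j
      proof -
        have "d \<one> (inv p \<otimes> f (Suc j)) = d p (f (Suc j))"
          using d_translate_inv[of p \<one> "f (Suc j)"] p fG by simp
        also have "\<dots> \<le> d p (f j) + d (f j) (f (Suc j))" using p fG by (intro triangle)
        also have "\<dots> \<le> \<Lambda> + 1" using p fS[of j] by simp
        finally have "\<exists>c. c \<in> D \<and> d c (inv p \<otimes> f (Suc j)) \<le> 1"
          using D(3)[of "inv p \<otimes> f (Suc j)"] p fG by blast
        then show ?thesis unfolding sel_def by (rule someI_ex)
      qed
      have "q j \<in> carrier G \<and> d (q j) (f j) \<le> 1"
      proof (induction j)
        case 0
        then show ?case by (simp add: q0 f0)
      next
        case (Suc j)
        have s: "sel (q j) j \<in> D" "d (sel (q j) j) (inv (q j) \<otimes> f (Suc j)) \<le> 1"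
          using sel[of "q j" j] Suc by auto
        then have "sel (q j) j \<in> carrier G" using D(2) by blast
        then show ?case using s Suc d_translate_inv[of "q j" "sel (q j) j" "f (Suc j)"] fG by (simp add: qS)
      qed
      then show ?thesis using sel by blast
    qed
    define cs where "cs = map (\<lambda>j. sel (q j) j) [0..<N]"
    have pos_q: "pos cs j = q j" if "j \<le> N" for j
      using that by (induction j) (auto simp: pos0 posS q0 qS cs_def)
    have fq: "d (f i) (f j) \<le> d (q i) (q j) + 2" for i j
    proof -
      have "d (f i) (f j) \<le> d (f i) (q i) + d (q i) (f j)" using step fG by (intro triangle) auto
      also have "d (q i) (f j) \<le> d (q i) (q j) + d (q j) (f j)" using step fG by (intro triangle) auto
      finally show ?thesis using step[of i] step[of j] by (simp add: commute)
    qed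
    have "card {j. j < N \<and> R cs i j} \<le> 2 * M" for i
    proof (cases "i < N")
      case True
      let ?J = "{j. j < N \<and> R cs i j}"
      have J: "d (F (w i)) (F (w j)) \<le> 4" if "j \<in> ?J" for j
        using that fq[of i j] True pos_q[of i] pos_q[of j] by (simp add: R_def df)
      let ?S = "(\<lambda>j. fold perm (w j)) ` ?J"
      have "?S \<subseteq> {fold perm us |us. set us \<subseteq> {..<4 * palette} \<and> d (F (w i)) (F us) \<le> 4}"
        using J w_set by blast
      then have cS: "card ?S \<le> M" using F4[OF w_set, of ?S i] by simp
      \<comment> \<open>Equal permutations have equal end vertices by \<open>w_eq\<close>, so r
        factors through the permutations.\<close>
      have "card (r ` ?J) \<le> card ?S"
      proof (rule surj_card_le)
        show "finite ?S" by simp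
        show "r ` ?J \<subseteq> (\<lambda>s. r (SOME j. j \<in> ?J \<and> fold perm (w j) = s)) ` ?S"
        proof clarify
          fix j assume j: "j < N" "R cs i j"
          let ?k = "SOME k. k \<in> ?J \<and> fold perm (w k) = fold perm (w j)"
          have "?k \<in> ?J \<and> fold perm (w ?k) = fold perm (w j)" by (rule someI[of _ j]) (use j in auto)
          then have "r j = r ?k" using w_eq[of ?k j] j by auto
          then show "r j \<in> (\<lambda>s. r (SOME j. j \<in> ?J \<and> fold perm (w j) = s)) ` ?S" using j by blast
        qed
      qed
      have "?J \<subseteq> (\<Union>v\<in>r ` ?J. {p. r p = v})" by auto
      then have "card ?J \<le> card (\<Union>v\<in>r ` ?J. {p. r p = v})"
        using fib by (intro card_mono) auto
      also have "\<dots> \<le> (\<Sum>v\<in>r ` ?J. card {p. r p = v})" by (rule card_UN_le) simp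
      also have "\<dots> \<le> (\<Sum>v\<in>r ` ?J. 2)" by (rule sum_mono) (rule fib(2))
      also have "\<dots> \<le> 2 * M" using \<open>card (r ` ?J) \<le> card ?S\<close> cS by simp
      finally show ?thesis .
    qed (simp add: R_def)
    then have "cs \<in> A" using step by (auto simp: A_def cs_def)
    then obtain i j where ij: "i < N" "j < N" "r i = r j" "\<not> R cs i j" using kill[of cs] by metis
    have "F (w i) = F (w j)" by (rule F2[OF w_set w_set]) (simp add: w_eq ij)
    then have "f i = f j" by (simp add: f_def)
    moreover have "d (q i) (q j) \<le> d (q i) (f i) + d (f i) (q j)" using step fG by (intro triangle) auto
    ultimately have "d (q i) (q j) \<le> 2" using step[of i] step[of j] by (simp add: commute)
    then show False using ij pos_q[of i] pos_q[of j] by (simp add: R_def)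
  qed
  then show ?thesis using perm_perm by (intro exI[of _ perm]) blast
qed

end

section \<open>A finitely generated group containing countably many involutions\<close>

definition spin :: "(nat \<Rightarrow> 'p \<Rightarrow> 'p) \<Rightarrow> nat \<Rightarrow> 'p \<times> int \<times> int \<Rightarrow> 'p \<times> int \<times> int" where
  "spin \<pi> m = (\<lambda>(a, i, j). (if i = 0 \<and> j = 0 then \<pi> m a else a, i, j))"

definition up :: "'p \<times> int \<times> int \<Rightarrow> 'p \<times> int \<times> int" where
  "up = (\<lambda>(a, i, j). (a, i, j + 1))"

definition down :: "'p \<times> int \<times> int \<Rightarrow> 'p \<times> int \<times> int" where
  "down = (\<lambda>(a, i, j). (a, i, j - 1))"

text \<open>Only the row j = 0 moves; on the other rows the commutator formed below therefore
  cancels.\<close>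

definition right :: "'p \<times> int \<times> int \<Rightarrow> 'p \<times> int \<times> int" where
  "right = (\<lambda>(a, i, j). (a, if j = 0 then i + 1 else i, j))"

definition left :: "'p \<times> int \<times> int \<Rightarrow> 'p \<times> int \<times> int" where
  "left = (\<lambda>(a, i, j). (a, if j = 0 then i - 1 else i, j))"

text \<open>A single generator stores all involutions, one in each row. Each is repeated along a
  half-line, which differs from its shift by one step in exactly one place.\<close>

definition flip :: "(nat \<Rightarrow> 'p \<Rightarrow> 'p) \<Rightarrow> 'p \<times> int \<times> int \<Rightarrow> 'p \<times> int \<times> int" where
  "flip \<pi> = (\<lambda>(a, i, j). (if 0 \<le> i \<and> 0 \<le> j then \<pi> (nat j) a else a, i, j))"

definition moves :: "(nat \<Rightarrow> 'p \<Rightarrow> 'p) \<Rightarrow> ('p \<times> int \<times> int \<Rightarrow> 'p \<times> int \<times> int) set" where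
  "moves \<pi> = {up, down, right, left, flip \<pi>}"

abbreviation compose_word :: "('w \<Rightarrow> 'w) list \<Rightarrow> 'w \<Rightarrow> 'w" where
  "compose_word \<equiv> fold (\<lambda>g. g)"

definition conj_flip :: "(nat \<Rightarrow> 'p \<Rightarrow> 'p) \<Rightarrow> nat \<Rightarrow> ('p \<times> int \<times> int \<Rightarrow> 'p \<times> int \<times> int) list" where
  "conj_flip \<pi> m = replicate m up @ [flip \<pi>] @ replicate m down"

text \<open>The word \<^const>\<open>conj_flip\<close> acts by \<open>\<pi> m\<close> on all \<open>(a, i, 0)\<close> with \<open>i \<ge> 0\<close>, so that its
  commutator with \<^const>\<open>right\<close> acts only on the points \<open>(a, 0, 0)\<close>.\<close>

definition spin_word :: "(nat \<Rightarrow> 'p \<Rightarrow> 'p) \<Rightarrow> nat \<Rightarrow> ('p \<times> int \<times> int \<Rightarrow> 'p \<times> int \<times> int) list" where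
  "spin_word \<pi> m = [left] @ conj_flip \<pi> m @ [right] @ conj_flip \<pi> m"

lemma compose_conj_flip:
  fixes \<pi> :: "nat \<Rightarrow> 'p \<Rightarrow> 'p"
  shows "compose_word (conj_flip \<pi> m) (a, i, j) = (if 0 \<le> i \<and> 0 \<le> j + int m then \<pi> (nat (j + int m)) a else a, i, j)"
proof -
  have "compose_word (replicate m up) (a, i, j) = (a, i, j + int m)" for a :: 'p and i j
    by (induction m arbitrary: j) (auto simp: up_def)
  moreover have "compose_word (replicate m down) (a, i, j) = (a, i, j - int m)" for a :: 'p and i j
    by (induction m arbitrary: j) (auto simp: down_def)
  ultimately show ?thesis by (simp add: conj_flip_def flip_def)
qed

text \<open>In the row j = 0 the two occurrences of \<open>conj_flip\<close> act at i - 1 and at i: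
  they cancel for i >= 1, only the second acts for i = 0, and neither for i < 0. In other rows both
  act in the same place and cancel.\<close>

lemma compose_spin_word:
  assumes "\<And>m x. \<pi> m (\<pi> m x) = x"
  shows "compose_word (spin_word \<pi> m) = spin \<pi> m"
proof
  fix w :: "'a \<times> int \<times> int"
  obtain a i j where w: "w = (a, i, j)" by (cases w)
  show "compose_word (spin_word \<pi> m) w = spin \<pi> m w"
    using assms by (simp add: w spin_word_def spin_def left_def right_def compose_conj_flip)
qed

lemma set_spin_word: "set (spin_word \<pi> m) \<subseteq> moves \<pi>"
  by (auto simp: spin_word_def conj_flip_def moves_def)

lemma length_spin_word: "length (spin_word \<pi> m) = 4 * m + 4"
  by (simp add: spin_word_def conj_flip_def)

lemma fold_spin:
  "fold (\<lambda>c. spin \<pi> (g c)) ws (a, i, j) = (if i = 0 \<and> j = 0 then fold (\<lambda>c. \<pi> (g c)) ws a else a, i, j)"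
  by (induction ws arbitrary: a) (auto simp: spin_def)

lemma moves_inverse:
  assumes "\<And>m x. \<pi> m (\<pi> m x) = x" "g \<in> moves \<pi>"
  shows "\<exists>h\<in>moves \<pi>. g \<circ> h = id \<and> h \<circ> g = id"
proof -
  have "up \<circ> down = (id :: 'a \<times> int \<times> int \<Rightarrow> _)" "down \<circ> up = (id :: 'a \<times> int \<times> int \<Rightarrow> _)"
    "left \<circ> right = (id :: 'a \<times> int \<times> int \<Rightarrow> _)" "right \<circ> left = (id :: 'a \<times> int \<times> int \<Rightarrow> _)"
    "flip \<pi> \<circ> flip \<pi> = id"
    using assms(1) by (auto simp: up_def down_def left_def right_def flip_def fun_eq_iff)
  then show ?thesis using assms(2) unfolding moves_def by auto
qed

section \<open>Finitely generated permutation groups, numbered\<close>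

locale finitely_generated_action =
  fixes Gen :: "('w \<Rightarrow> 'w) set"
  assumes finite_Gen: "finite Gen"
    and inverse: "g \<in> Gen \<Longrightarrow> \<exists>h\<in>Gen. g \<circ> h = id \<and> h \<circ> g = id"
begin

definition elements :: "('w \<Rightarrow> 'w) set" where
  "elements = compose_word ` lists Gen"

text \<open>A finitely generated group is countable, so numbering its elements yields a group on
  \<open>nat\<close> whatever the type acted upon.\<close>

definition enc :: "('w \<Rightarrow> 'w) \<Rightarrow> nat" where
  "enc = to_nat_on elements"

definition dec :: "nat \<Rightarrow> 'w \<Rightarrow> 'w" where
  "dec = from_nat_into elements"

text \<open>Products are composed from left to right, so that right multiplication by a generator appends
  a letter to a word.\<close>

definition action_group :: "nat monoid" where
  "action_group = \<lparr>carrier = enc ` elements, mult = \<lambda>x y. enc (dec y \<circ> dec x), one = enc id\<rparr>"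

lemma countable_elements: "countable elements"
  unfolding elements_def using finite_Gen by (intro countable_image countable_lists countable_finite)

lemma dec_enc: "g \<in> elements \<Longrightarrow> dec (enc g) = g"
  unfolding dec_def enc_def using countable_elements by simp

lemma elementsI: "set ws \<subseteq> Gen \<Longrightarrow> compose_word ws \<in> elements"
  by (auto simp: elements_def lists_eq_set)

lemma Gen_elements: "g \<in> Gen \<Longrightarrow> g \<in> elements"
  using elementsI[of "[g]"] by simp

lemma elements_comp:
  assumes "g \<in> elements" "h \<in> elements"
  shows "h \<circ> g \<in> elements"
proof -
  obtain us ws where "set us \<subseteq> Gen" "g = compose_word us" "set ws \<subseteq> Gen" "h = compose_word ws"
    using assms by (auto simp: elements_def lists_eq_set)
  then show ?thesis using elementsI[of "us @ ws"] by (simp add: fold_append)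
qed

lemma id_elements: "id \<in> elements"
  using elementsI[of "[]"] by (simp add: id_def)

lemma elements_inverse:
  assumes "g \<in> elements"
  shows "\<exists>h\<in>elements. g \<circ> h = id \<and> h \<circ> g = id"
proof -
  have "\<exists>h\<in>elements. compose_word ws \<circ> h = id \<and> h \<circ> compose_word ws = id" if "set ws \<subseteq> Gen" for ws
    using that
  proof (induction ws)
    case Nil
    then show ?case using id_elements by (auto simp: id_def)
  next
    case (Cons g ws)
    then obtain h where h: "h \<in> elements" "compose_word ws \<circ> h = id" "h \<circ> compose_word ws = id"
      by (metis set_subset_Cons subset_trans)
    obtain k where k: "k \<in> Gen" "g \<circ> k = id" "k \<circ> g = id" using inverse[of g] Cons.prems by (metis list.set_intros(1) subset_iff)
    have "k \<circ> h \<in> elements" using elements_comp[OF h(1) Gen_elements[OF k(1)]] .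
    moreover have "compose_word (g # ws) \<circ> (k \<circ> h) = id" "(k \<circ> h) \<circ> compose_word (g # ws) = id"
      using h(2,3) k(2,3) by (simp_all add: fun_eq_iff)
    ultimately show ?case by blast
  qed
  then show ?thesis using assms by (auto simp: elements_def lists_eq_set)
qed

lemma carrier_action_group: "carrier action_group = enc ` elements"
  and one_action_group: "\<one>\<^bsub>action_group\<^esub> = enc id"
  by (simp_all add: action_group_def)

lemma enc_mult: "g \<in> elements \<Longrightarrow> h \<in> elements \<Longrightarrow> enc g \<otimes>\<^bsub>action_group\<^esub> enc h = enc (h \<circ> g)"
  by (simp add: action_group_def dec_enc)

lemma group_action_group: "group action_group"
proof (rule groupI)
  fix x y z
  assume "x \<in> carrier action_group" "y \<in> carrier action_group" "z \<in> carrier action_group"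
  then obtain f g h where e: "f \<in> elements" "g \<in> elements" "h \<in> elements"
    and xyz: "x = enc f" "y = enc g" "z = enc h" by (auto simp: carrier_action_group)
  show "x \<otimes>\<^bsub>action_group\<^esub> y \<otimes>\<^bsub>action_group\<^esub> z = x \<otimes>\<^bsub>action_group\<^esub> (y \<otimes>\<^bsub>action_group\<^esub> z)"
    using e by (simp add: xyz enc_mult elements_comp comp_assoc)
next
  fix x assume "x \<in> carrier action_group"
  then obtain f where f: "f \<in> elements" "x = enc f" by (auto simp: carrier_action_group)
  then obtain h where "h \<in> elements" "f \<circ> h = id" using elements_inverse by blast
  then show "\<exists>y\<in>carrier action_group. y \<otimes>\<^bsub>action_group\<^esub> x = \<one>\<^bsub>action_group\<^esub>"
    using f by (intro bexI[of _ "enc h"]) (auto simp: carrier_action_group one_action_group enc_mult)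
next
  fix x assume "x \<in> carrier action_group"
  then show "\<one>\<^bsub>action_group\<^esub> \<otimes>\<^bsub>action_group\<^esub> x = x"
    by (auto simp: carrier_action_group one_action_group enc_mult id_elements)
qed (auto simp: carrier_action_group one_action_group enc_mult id_elements elements_comp)

lemma finitely_generated: "finitely_generated_group action_group"
proof -
  interpret H: group action_group by (rule group_action_group)
  have S: "enc ` Gen \<subseteq> carrier action_group" using Gen_elements by (auto simp: carrier_action_group)
  have "enc (compose_word ws) \<in> generate action_group (enc ` Gen)" if "set ws \<subseteq> Gen" for ws
    using that
  proof (induction ws rule: rev_induct)
    case Nil
    then show ?case using generate.one[of action_group] by (simp add: one_action_group id_def)
  next
    case (snoc g ws)
    then have "enc (compose_word (ws @ [g])) = enc (compose_word ws) \<otimes>\<^bsub>action_group\<^esub> enc g"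
      using elementsI[of ws] Gen_elements[of g] by (simp add: enc_mult)
    moreover have "enc (compose_word ws) \<otimes>\<^bsub>action_group\<^esub> enc g \<in> generate action_group (enc ` Gen)"
      by (rule generate.eng[OF _ generate.incl]) (use snoc in auto)
    ultimately show ?case by metis
  qed
  then have "carrier action_group \<subseteq> generate action_group (enc ` Gen)"
    by (auto simp: carrier_action_group elements_def lists_eq_set)
  then have "finite_generating_set action_group (enc ` Gen)"
    using S finite_Gen H.generate_incl[OF S] by (simp add: finite_generating_set_def subset_antisym)
  then show ?thesis by (auto simp: finitely_generated_group_def group_action_group)
qed

end

section \<open>Coarse embeddings\<close>

lemma finite_word_metric_balls:
  assumes "group H" "finite_generating_set H S"
  shows "\<exists>n. \<forall>x\<in>carrier H. finite {y \<in> carrier H. word_metric H S x y \<le> D} \<and>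
    card {y \<in> carrier H. word_metric H S x y \<le> D} \<le> n"
proof -
  interpret group H by fact
  let ?A = "S \<union> (\<lambda>s. inv\<^bsub>H\<^esub> s) ` S"
  have S: "finite S" "S \<subseteq> carrier H" "generate H S = carrier H"
    using assms(2) by (auto simp: finite_generating_set_def)
  define K where "K = {ws. set ws \<subseteq> ?A \<and> length ws \<le> nat \<lfloor>D\<rfloor>}"
  have K: "finite K" unfolding K_def by (rule finite_lists_length_le) (use S in simp)
  have "finite {y \<in> carrier H. word_metric H S x y \<le> D} \<and>
    card {y \<in> carrier H. word_metric H S x y \<le> D} \<le> card K" if x: "x \<in> carrier H" for x
  proof -
    have "{y \<in> carrier H. word_metric H S x y \<le> D} \<subseteq> (\<lambda>ws. x \<otimes>\<^bsub>H\<^esub> foldr (\<otimes>\<^bsub>H\<^esub>) ws \<one>\<^bsub>H\<^esub>) ` K"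
    proof clarify
      fix y assume y: "y \<in> carrier H" "word_metric H S x y \<le> D"
      let ?g = "inv\<^bsub>H\<^esub> x \<otimes>\<^bsub>H\<^esub> y"
      have "\<exists>n ws. set ws \<subseteq> ?A \<and> foldr (\<otimes>\<^bsub>H\<^esub>) ws \<one>\<^bsub>H\<^esub> = ?g \<and> length ws = n"
        using generate_imp_word[OF assms(1) S(2), of ?g] S(3) x y by auto
      then have "\<exists>ws. set ws \<subseteq> ?A \<and> foldr (\<otimes>\<^bsub>H\<^esub>) ws \<one>\<^bsub>H\<^esub> = ?g \<and> length ws = word_length H S ?g"
        unfolding word_length_def by (rule LeastI_ex)
      then obtain ws where ws: "set ws \<subseteq> ?A" "foldr (\<otimes>\<^bsub>H\<^esub>) ws \<one>\<^bsub>H\<^esub> = ?g" "length ws = word_length H S ?g"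
        by blast
      have "ws \<in> K" using ws y(2) by (simp add: K_def word_metric_def le_nat_floor)
      moreover have "y = x \<otimes>\<^bsub>H\<^esub> ?g" using x y by (simp add: m_assoc[symmetric])
      ultimately show "y \<in> (\<lambda>ws. x \<otimes>\<^bsub>H\<^esub> foldr (\<otimes>\<^bsub>H\<^esub>) ws \<one>\<^bsub>H\<^esub>) ` K" using ws(2) by (intro image_eqI[of _ _ ws]) auto
    qed
    then show ?thesis using K by (meson finite_imageI finite_subset card_image_le card_mono le_trans)
  qed
  then show ?thesis by blast
qed

text \<open>These are the two consequences that the counting argument sees. The function \<rho>p
  bounds the displacement along finitely many elements K, which may differ from the generating set S
  of the metric; and \<rho>m exceeds R from some D on, so preimages of balls of radius R lie in word
  metric balls.\<close>

lemma coarse_embedding_bounds: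
  assumes "group H" "finite_generating_set H S"
    and f: "coarse_embedding (carrier H) (word_metric H S) Y d f"
    and K: "finite K" "K \<subseteq> carrier H"
  shows "\<exists>L. \<forall>x\<in>carrier H. \<forall>s\<in>K. d (f x) (f (x \<otimes>\<^bsub>H\<^esub> s)) \<le> L"
    and "\<exists>n. \<forall>x\<in>carrier H. finite {y \<in> carrier H. d (f x) (f y) \<le> R} \<and>
      card {y \<in> carrier H. d (f x) (f y) \<le> R} \<le> n"
proof -
  interpret group H by fact
  obtain \<rho>m \<rho>p :: "real \<Rightarrow> real" where rho: "mono_on {0..} \<rho>m" "mono_on {0..} \<rho>p"
    "filterlim \<rho>m at_top at_top"
    "\<forall>x\<in>carrier H. \<forall>y\<in>carrier H. \<rho>m (word_metric H S x y) \<le> d (f x) (f y) \<and> d (f x) (f y) \<le> \<rho>p (word_metric H S x y)"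
    using f unfolding coarse_embedding_def by blast
  have "\<forall>x\<in>carrier H. \<forall>s\<in>K. d (f x) (f (x \<otimes>\<^bsub>H\<^esub> s)) \<le> (\<Sum>s\<in>K. \<bar>\<rho>p (real (word_length H S s))\<bar>)"
  proof (intro ballI)
    fix x s assume x: "x \<in> carrier H" and s: "s \<in> K"
    then have "d (f x) (f (x \<otimes>\<^bsub>H\<^esub> s)) \<le> \<rho>p (word_metric H S x (x \<otimes>\<^bsub>H\<^esub> s))" using rho(4) K by auto
    also have "\<dots> = \<rho>p (real (word_length H S s))"
      using x s K by (auto simp: word_metric_def m_assoc[symmetric] subset_iff)
    also have "\<dots> \<le> \<bar>\<rho>p (real (word_length H S s))\<bar>" by simp
    also have "\<dots> \<le> (\<Sum>s\<in>K. \<bar>\<rho>p (real (word_length H S s))\<bar>)"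
      using s K by (intro member_le_sum) auto
    finally show "d (f x) (f (x \<otimes>\<^bsub>H\<^esub> s)) \<le> (\<Sum>s\<in>K. \<bar>\<rho>p (real (word_length H S s))\<bar>)" .
  qed
  then show "\<exists>L. \<forall>x\<in>carrier H. \<forall>s\<in>K. d (f x) (f (x \<otimes>\<^bsub>H\<^esub> s)) \<le> L" by blast
  have "eventually (\<lambda>t. R < \<rho>m t) at_top" using rho(3) by (simp add: filterlim_at_top_dense)
  then obtain D where D: "\<And>t. t \<ge> D \<Longrightarrow> R < \<rho>m t" by (auto simp: eventually_at_top_linorder)
  obtain n where n: "\<forall>x\<in>carrier H. finite {y \<in> carrier H. word_metric H S x y \<le> D} \<and>
    card {y \<in> carrier H. word_metric H S x y \<le> D} \<le> n"
    using finite_word_metric_balls[OF assms(1,2)] by metis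
  have "finite {y \<in> carrier H. d (f x) (f y) \<le> R} \<and> card {y \<in> carrier H. d (f x) (f y) \<le> R} \<le> n"
    if x: "x \<in> carrier H" for x
  proof -
    have "{y \<in> carrier H. d (f x) (f y) \<le> R} \<subseteq> {y \<in> carrier H. word_metric H S x y \<le> D}"
    proof clarify
      fix y assume y: "y \<in> carrier H" "d (f x) (f y) \<le> R"
      then have "\<rho>m (word_metric H S x y) \<le> R" using rho(4) x by fastforce
      then show "word_metric H S x y \<le> D" using D[of "word_metric H S x y"] by linarith
    qed
    then show ?thesis using n x by (meson finite_subset card_mono le_trans)
  qed
  then show "\<exists>n. \<forall>x\<in>carrier H. finite {y \<in> carrier H. d (f x) (f y) \<le> R} \<and>
      card {y \<in> carrier H. d (f x) (f y) \<le> R} \<le> n" by blast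
qed

text \<open>A ball of d has compact closure and is therefore bounded for d', which has the same
  topology; left invariance carries the bound from the identity to all points.\<close>

lemma proper_metrics_comparable:
  assumes "group G" "proper_left_invariant_compatible_metric G T d" "proper_left_invariant_compatible_metric G T d'"
  shows "\<exists>R'. \<forall>x\<in>carrier G. \<forall>y\<in>carrier G. d x y \<le> R \<longrightarrow> d' x y \<le> R'"
proof -
  interpret A: proper_metric_group G d by (rule proper_metric_groupI[OF assms(1,2)])
  interpret B: proper_metric_group G d' by (rule proper_metric_groupI[OF assms(1,3)])
  have top: "A.mtopology = B.mtopology"
    using assms(2,3) by (simp add: proper_left_invariant_compatible_metric_def)
  let ?B = "A.mcball \<one>\<^bsub>G\<^esub> R"
  have "B.mbounded (A.mtopology closure_of ?B)"
    using A.proper[OF A.mbounded_mcball] unfolding top by (rule B.compactin_imp_mbounded)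
  moreover have "?B \<subseteq> A.mtopology closure_of ?B"
    by (rule closure_of_subset) (simp add: A.mcball_subset_mspace)
  ultimately have "B.mbounded ?B" using B.mbounded_subset by blast
  then obtain c b where cb: "?B \<subseteq> B.mcball c b" by (auto simp: B.mbounded_def)
  have "d' x y \<le> d' \<one>\<^bsub>G\<^esub> c + b" if xy: "x \<in> carrier G" "y \<in> carrier G" "d x y \<le> R" for x y
  proof -
    let ?g = "inv\<^bsub>G\<^esub> x \<otimes>\<^bsub>G\<^esub> y"
    have "?g \<in> ?B" using A.d_translate_inv[of x "\<one>\<^bsub>G\<^esub>" y] xy by simp
    then have "c \<in> carrier G" "d' c ?g \<le> b" using cb by auto
    then have "d' \<one>\<^bsub>G\<^esub> ?g \<le> d' \<one>\<^bsub>G\<^esub> c + b" using B.triangle[of "\<one>\<^bsub>G\<^esub>" c ?g] xy by simp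
    then show ?thesis using B.d_translate_inv[of x "\<one>\<^bsub>G\<^esub>" y] xy by simp
  qed
  then show ?thesis by blast
qed

section \<open>Assembling the blocks of involutions\<close>

lemma finitely_generated_action_moves:
  assumes "\<And>m x. \<pi> m (\<pi> m x) = x"
  shows "finitely_generated_action (moves \<pi>)"
proof unfold_locales
  show "finite (moves \<pi>)" by (simp add: moves_def)
  show "\<exists>h\<in>moves \<pi>. g \<circ> h = id \<and> h \<circ> g = id" if "g \<in> moves \<pi>" for g
    using assms that by (rule moves_inverse)
qed

text \<open>The index k * q + c with c < q is at most k * q + q, so the words for the spins have
  length at most 4 * (k * q + q) + 4; this is the factor in the Lipschitz constant. A product of
  spins in the block and its action on the points (a, 0, 0) determine each other, so F is well
  defined on permutations and multiplicities carry over.\<close>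

lemma admits_map_of_lipschitz:
  fixes \<pi> :: "nat \<Rightarrow> 'p \<Rightarrow> 'p" and p :: "nat \<Rightarrow> 'p \<Rightarrow> 'p" and f :: "nat \<Rightarrow> 'a"
  assumes "proper_metric_group G d"
    and inv: "\<And>m x. \<pi> m (\<pi> m x) = x"
    and p: "\<And>c. c < q \<Longrightarrow> p c = \<pi> (k * q + c)"
  defines "H \<equiv> finitely_generated_action.action_group (moves \<pi>)"
  assumes f: "f \<in> carrier H \<rightarrow> carrier G"
    and lip: "\<And>x g. x \<in> carrier H \<Longrightarrow> g \<in> moves \<pi> \<Longrightarrow>
      d (f x) (f (x \<otimes>\<^bsub>H\<^esub> finitely_generated_action.enc (moves \<pi>) g)) \<le> L"
    and balls: "\<And>x. x \<in> carrier H \<Longrightarrow> finite {y \<in> carrier H. d (f x) (f y) \<le> 4} \<and>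
      card {y \<in> carrier H. d (f x) (f y) \<le> 4} \<le> M"
  shows "proper_metric_group.admits_map G d q p (L * real (4 * (k * q + q) + 4)) M"
proof -
  interpret G: proper_metric_group G d by fact
  interpret finitely_generated_action "moves \<pi>" using inv by (rule finitely_generated_action_moves)
  interpret H: group H unfolding H_def by (rule group_action_group)
  have encH: "enc g \<in> carrier H" if "g \<in> elements" for g
    using that by (simp add: H_def carrier_action_group)
  have mult: "enc g \<otimes>\<^bsub>H\<^esub> enc h = enc (h \<circ> g)" if "g \<in> elements" "h \<in> elements" for g h
    using that by (simp add: H_def enc_mult)
  have fG: "f x \<in> carrier G" if "x \<in> carrier H" for x using f that by blast
  have L: "0 \<le> L"
  proof -
    have "up \<in> moves \<pi>" by (simp add: moves_def)
    then show ?thesis using lip[OF H.one_closed, of up] G.nonneg order_trans by blast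
  qed
  have path: "d (f (enc g)) (f (enc (compose_word ws \<circ> g))) \<le> L * real (length ws)"
    if "g \<in> elements" "set ws \<subseteq> moves \<pi>" for g ws
    using that(2)
  proof (induction ws rule: rev_induct)
    case Nil
    then show ?case using fG[OF encH[OF that(1)]] by (simp add: id_def[symmetric])
  next
    case (snoc h ws)
    let ?g = "compose_word ws \<circ> g"
    have e: "?g \<in> elements" "h \<in> elements"
      using snoc elements_comp[OF that(1)] elementsI[of ws] Gen_elements[of h] by auto
    have eq: "compose_word (ws @ [h]) \<circ> g = h \<circ> ?g" by (simp add: fun_eq_iff)
    have "d (f (enc g)) (f (enc (h \<circ> ?g))) \<le> d (f (enc g)) (f (enc ?g)) + d (f (enc ?g)) (f (enc (h \<circ> ?g)))"
      using that(1) e elements_comp by (intro G.triangle fG encH) auto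
    also have "d (f (enc g)) (f (enc ?g)) \<le> L * real (length ws)"
      using snoc.IH snoc.prems by (metis Un_subset_iff set_append)
    also have "d (f (enc ?g)) (f (enc (h \<circ> ?g))) \<le> L"
      using lip[OF encH[OF e(1)], of h] snoc mult[OF e] by simp
    finally have "d (f (enc g)) (f (enc (h \<circ> ?g))) \<le> L * real (length ws) + L" by simp
    moreover have "L * real (length (ws @ [h])) = L * real (length ws) + L" by (simp add: algebra_simps)
    ultimately show ?case unfolding eq by linarith
  qed
  define \<xi> where "\<xi> ws = fold (\<lambda>c. spin \<pi> (k * q + c)) ws" for ws
  have spin_el: "spin \<pi> m \<in> elements" for m
    using elementsI[OF set_spin_word] compose_spin_word[of \<pi>, OF inv] by metis
  have xi_el: "\<xi> ws \<in> elements" for ws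
  proof (induction ws rule: rev_induct)
    case Nil
    then show ?case using id_elements by (simp add: \<xi>_def id_def)
  next
    case (snoc c ws)
    then show ?case using elements_comp[OF snoc.IH spin_el] by (simp add: \<xi>_def comp_def)
  qed
  have fold_p: "fold p ws = fold (\<lambda>c. \<pi> (k * q + c)) ws" if "set ws \<subseteq> {..<q}" for ws
    by (rule ext, rule List.fold_cong) (use p that in auto)
  have xi: "\<xi> ws (a, i, j) = (if i = 0 \<and> j = 0 then fold p ws a else a, i, j)" if "set ws \<subseteq> {..<q}" for ws a i j
    using fold_spin[of \<pi> "\<lambda>c. k * q + c" ws a i j] by (simp add: \<xi>_def fold_p[OF that])
  define F where "F ws = f (enc (\<xi> ws))" for ws
  have F1: "F ws \<in> carrier G" for ws using fG encH xi_el by (simp add: F_def)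
  have F2: "F us = F ws" if "set us \<subseteq> {..<q}" "set ws \<subseteq> {..<q}" "fold p us = fold p ws" for us ws
  proof -
    have "\<xi> us = \<xi> ws" using xi[OF that(1)] xi[OF that(2)] that(3) by (auto simp: fun_eq_iff)
    then show ?thesis by (simp add: F_def)
  qed
  have F3: "d (F ws) (F (ws @ [c])) \<le> L * real (4 * (k * q + q) + 4)" if "c < q" for ws c
  proof -
    have "d (F ws) (F (ws @ [c])) \<le> L * real (length (spin_word \<pi> (k * q + c)))"
      using path[OF xi_el set_spin_word, of ws "k * q + c"] compose_spin_word[of \<pi>, OF inv]
      by (simp add: F_def \<xi>_def)
    also have "\<dots> \<le> L * real (4 * (k * q + q) + 4)"
      using that L by (intro mult_left_mono) (auto simp: length_spin_word)
    finally show ?thesis .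
  qed
  have F4: "card S \<le> M"
    if S: "S \<subseteq> {fold p us |us. set us \<subseteq> {..<q} \<and> d (F ws) (F us) \<le> 4}" for ws S
  proof -
    let ?B = "{y \<in> carrier H. d (F ws) (f y) \<le> 4}"
    have B: "finite ?B" "card ?B \<le> M" using balls[OF encH[OF xi_el[of ws]]] by (simp_all add: F_def)
    have "S \<subseteq> (\<lambda>y a. fst (dec y (a, 0, 0))) ` ?B"
    proof
      fix s assume "s \<in> S"
      then obtain us where us: "s = fold p us" "set us \<subseteq> {..<q}" "d (F ws) (F us) \<le> 4" using S by blast
      have "s = (\<lambda>a. fst (dec (enc (\<xi> us)) (a, 0, 0)))"
        using us xi[OF us(2)] by (simp add: dec_enc xi_el)
      then show "s \<in> (\<lambda>y a. fst (dec y (a, 0, 0))) ` ?B"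
        using us(3) encH[OF xi_el[of us]] by (intro image_eqI[of _ _ "enc (\<xi> us)"]) (auto simp: F_def)
    qed
    from surj_card_le[OF B(1) this] B(2) show ?thesis by (rule order_trans)
  qed
  show ?thesis
    unfolding G.admits_map_def using F1 F2 F3 F4 by (intro exI[of _ F]) blast
qed

theorem exists_finitely_generated_group_not_embedding:
  fixes G :: "nat \<Rightarrow> 'a monoid" and T :: "nat \<Rightarrow> 'a topology"
  assumes G: "\<And>i. i \<ge> 1 \<Longrightarrow> group (G i)"
  shows "\<exists>H :: nat monoid. finitely_generated_group H \<and> (\<forall>i\<ge>1. \<not> coarsely_embeds_into H (G i) (T i))"
proof -
  define q where "q = 4 * palette"
  have q: "0 < q" by (simp add: q_def palette_def)
  \<comment> \<open>The metric used by a hypothetical embedding is unknown, so one metric per group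
    is fixed now and compared with it afterwards. The choice is proper as soon as any such metric
    exists.\<close>
  define d where "d i = (SOME d. proper_left_invariant_compatible_metric (G i) (T i) d)" for i
  define \<Lambda> :: "nat \<Rightarrow> nat \<Rightarrow> real" where "\<Lambda> k L = real L * real (4 * (k * q + q) + 4)" for k L
  have "\<exists>\<pi> :: nat \<Rightarrow> rword set \<Rightarrow> rword set. (\<forall>c x. \<pi> c (\<pi> c x) = x) \<and>
      (\<forall>i L M. k = prod_encode (i, prod_encode (L, M)) \<longrightarrow> proper_metric_group (G i) (d i) \<longrightarrow>
        \<not> proper_metric_group.admits_map (G i) (d i) q \<pi> (\<Lambda> k L) M)" for k
  proof -
    obtain i L M where k: "k = prod_encode (i, prod_encode (L, M))"
      by (metis prod_decode_inverse surj_pair)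
    have eq: "i' = i \<and> L' = L \<and> M' = M" if "k = prod_encode (i', prod_encode (L', M'))" for i' L' M'
      using that by (simp add: k prod_encode_eq)
    show ?thesis
    proof (cases "proper_metric_group (G i) (d i)")
      case True
      have "0 \<le> \<Lambda> k L" by (simp add: \<Lambda>_def)
      from proper_metric_group.exists_non_embedding[OF True this, of M, folded q_def]
      obtain \<pi> :: "nat \<Rightarrow> rword set \<Rightarrow> rword set" where "\<forall>c x. \<pi> c (\<pi> c x) = x"
        "\<not> proper_metric_group.admits_map (G i) (d i) q \<pi> (\<Lambda> k L) M" by (elim exE conjE) (rule that)
      then show ?thesis by (intro exI[of _ \<pi>]) (auto dest!: eq)
    next
      case False
      then show ?thesis by (intro exI[of _ "\<lambda>c x. x"]) (auto dest!: eq)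
    qed
  qed
  then obtain p :: "nat \<Rightarrow> nat \<Rightarrow> rword set \<Rightarrow> rword set" where
    p_inv: "\<And>k c x. p k c (p k c x) = x" and
    p_no: "\<And>i L M. proper_metric_group (G i) (d i) \<Longrightarrow> \<not> proper_metric_group.admits_map (G i) (d i) q
      (p (prod_encode (i, prod_encode (L, M)))) (\<Lambda> (prod_encode (i, prod_encode (L, M))) L) M" by metis
  \<comment> \<open>The q indices from k * q on form the block that defeats the triple with code
    k.\<close>
  define \<pi> where "\<pi> m = p (m div q) (m mod q)" for m
  have inv: "\<pi> m (\<pi> m x) = x" for m x by (simp add: \<pi>_def p_inv)
  interpret finitely_generated_action "moves \<pi>" using inv by (rule finitely_generated_action_moves)
  have "\<not> coarsely_embeds_into action_group (G i) (T i)" if i: "i \<ge> 1" for i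
  proof
    assume "coarsely_embeds_into action_group (G i) (T i)"
    then obtain S \<delta> f where S: "finite_generating_set action_group S"
      and \<delta>: "proper_left_invariant_compatible_metric (G i) (T i) \<delta>"
      and f: "coarse_embedding (carrier action_group) (word_metric action_group S) (carrier (G i)) \<delta> f"
      by (auto simp: coarsely_embeds_into_def)
    have d: "proper_left_invariant_compatible_metric (G i) (T i) (d i)"
      unfolding d_def using \<delta> by (rule someI[where P = "proper_left_invariant_compatible_metric (G i) (T i)"])
    have fG: "f \<in> carrier action_group \<rightarrow> carrier (G i)" using f by (simp add: coarse_embedding_def)
    have K: "finite (enc ` moves \<pi>)" "enc ` moves \<pi> \<subseteq> carrier action_group"
      using finite_Gen Gen_elements by (auto simp: carrier_action_group)
    have closed: "x \<otimes>\<^bsub>action_group\<^esub> enc g \<in> carrier action_group"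
      if "x \<in> carrier action_group" "g \<in> moves \<pi>" for x g
      using that K(2) group_action_group by (auto intro!: monoid.m_closed group.is_monoid)
    obtain L0 where L0: "\<forall>x\<in>carrier action_group. \<forall>s\<in>enc ` moves \<pi>. \<delta> (f x) (f (x \<otimes>\<^bsub>action_group\<^esub> s)) \<le> L0"
      using coarse_embedding_bounds(1)[OF group_action_group S f K] by metis
    obtain L1 where L1: "\<forall>x\<in>carrier (G i). \<forall>y\<in>carrier (G i). \<delta> x y \<le> L0 \<longrightarrow> d i x y \<le> L1"
      using proper_metrics_comparable[OF G[OF i] \<delta> d] by metis
    \<comment> \<open>Constants are rounded up to natural numbers, so that countably many triples
      cover all cases.\<close>
    define L where "L = nat \<lceil>L1\<rceil>"
    have L: "d i (f x) (f (x \<otimes>\<^bsub>action_group\<^esub> enc g)) \<le> real L"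
      if "x \<in> carrier action_group" "g \<in> moves \<pi>" for x g
    proof -
      have "d i (f x) (f (x \<otimes>\<^bsub>action_group\<^esub> enc g)) \<le> L1" using L0 L1 fG that closed[OF that] by blast
      also have "\<dots> \<le> real L" unfolding L_def by (rule real_nat_ceiling_ge)
      finally show ?thesis .
    qed
    obtain R where R: "\<forall>x\<in>carrier (G i). \<forall>y\<in>carrier (G i). d i x y \<le> 4 \<longrightarrow> \<delta> x y \<le> R"
      using proper_metrics_comparable[OF G[OF i] d \<delta>] by metis
    obtain M where M: "\<forall>x\<in>carrier action_group. finite {y \<in> carrier action_group. \<delta> (f x) (f y) \<le> R} \<and>
        card {y \<in> carrier action_group. \<delta> (f x) (f y) \<le> R} \<le> M"
      using coarse_embedding_bounds(2)[OF group_action_group S f K, of R] by (elim exE) (rule that)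
    have balls: "finite {y \<in> carrier action_group. d i (f x) (f y) \<le> 4} \<and>
        card {y \<in> carrier action_group. d i (f x) (f y) \<le> 4} \<le> M" if x: "x \<in> carrier action_group" for x
    proof -
      have "{y \<in> carrier action_group. d i (f x) (f y) \<le> 4} \<subseteq> {y \<in> carrier action_group. \<delta> (f x) (f y) \<le> R}"
        using R fG x by auto
      then show ?thesis using M x by (meson finite_subset card_mono le_trans)
    qed
    define k where "k = prod_encode (i, prod_encode (L, M))"
    have pk: "p k c = \<pi> (k * q + c)" if "c < q" for c using that by (simp add: \<pi>_def)
    have pm: "proper_metric_group (G i) (d i)" by (rule proper_metric_groupI[OF G[OF i] d])
    have "proper_metric_group.admits_map (G i) (d i) q (p k) (\<Lambda> k L) M"
      unfolding \<Lambda>_def using pm inv pk fG L balls by (rule admits_map_of_lipschitz)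
    then show False using p_no[OF pm, of L M] by (simp add: k_def)
  qed
  then show ?thesis using finitely_generated by blast
qed

theorem corollary1p3:
  shows "(\<forall>(G :: nat \<Rightarrow> 'a monoid) (T :: nat \<Rightarrow> 'a topology).
            (\<forall>i\<ge>1. lcsc_group (G i) (T i)) \<longrightarrow>
            (\<exists>H :: nat monoid. finitely_generated_group H \<and>
               (\<forall>i\<ge>1. \<not> coarsely_embeds_into H (G i) (T i))))
       \<and> \<not> (\<exists>(G :: 'a monoid) (T :: 'a topology). lcsc_group G T \<and>
            (\<forall>H :: nat monoid. finitely_generated_group H \<longrightarrow> coarsely_embeds_into H G T))"
proof (intro conjI allI impI notI)
  fix G :: "nat \<Rightarrow> 'a monoid" and T :: "nat \<Rightarrow> 'a topology"
  assume "\<forall>i\<ge>1. lcsc_group (G i) (T i)"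
  then have "group (G i)" if "i \<ge> 1" for i
    using that by (simp add: lcsc_group_def topological_group_def)
  then show "\<exists>H :: nat monoid. finitely_generated_group H \<and> (\<forall>i\<ge>1. \<not> coarsely_embeds_into H (G i) (T i))"
    by (rule exists_finitely_generated_group_not_embedding)
next
  assume "\<exists>(G :: 'a monoid) (T :: 'a topology). lcsc_group G T \<and>
            (\<forall>H :: nat monoid. finitely_generated_group H \<longrightarrow> coarsely_embeds_into H G T)"
  then obtain G :: "'a monoid" and T :: "'a topology" where "lcsc_group G T"
    and H: "\<And>H :: nat monoid. finitely_generated_group H \<Longrightarrow> coarsely_embeds_into H G T" by blast
  then have "group G" by (simp add: lcsc_group_def topological_group_def)
  then show False
    using exists_finitely_generated_group_not_embedding[of "\<lambda>_. G" "\<lambda>_. T"] H by blast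
qed

end
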